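(* On any almost Hermitian manifold $M$ the following identities of operators on $\Gamma(\mathbb{C}l(M))$ hold: $$\{\mathfrak B,\mathcal L\}=0,\qquad \{\overline{\mathfrak B},\overline{\mathcal L}\}=0,\qquad \{\mathfrak B,\overline{\mathcal L}\}=\mathfrak B^{\star},\qquad \{\overline{\mathfrak B},\mathcal L\}=\overline{\mathfrak B}^{\star},\qquad [\mathcal H,\mathfrak B]=\mathfrak B.$$
   Context: Almost Hermitian manifold: a smooth manifold $M$ of real dimension $2n$ with a Riemannian metric $\langle\cdot,\cdot\rangle$ and an orthogonal almost complex structure $J$; $\omega(X,Y)=\langle JX,Y\rangle$. $Cl(M)$ is the bundle $\Lambda(TM)\cong\Lambda(T^*M)$ (identified by the metric) with Clifford multiplication determined by $v\cdot\varphi=v\wedge\varphi-v\lrcorner\varphi$ for tangent vectors $v$, where $v\lrcorner$ is the adjoint of $v\wedge$. $\mathbb{C}l(M)=Cl(M)\otimes\mathbb{C}$. $J_{\mathrm{alg}}$ denotes the extension of $J$ to $\mathbb{C}l(M)$ as an algebra automorphism. $\star$ is the transpose, i.e. the complex-linear algebra anti-automorphism with $\star(v_1\cdots v_p)=v_p\cdots v_1$. For an operator $T$: $T_c=J_{\mathrm{alg}}^{-1}TJ_{\mathrm{alg}}$, $T^{\star}=\star T\star$. $[S,T]=ST-TS$ and $\{S,T\}=ST+TS$. For a local $J$-adapted orthonormal frame $e_1,\dots,e_n,Je_1,\dots,Je_n$ put $\epsilon_k=\tfrac12(e_k-iJe_k)$, $\bar\epsilon_k=\tfrac12(e_k+iJe_k)$,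 $\mathcal L(\varphi)=-\sum_k\epsilon_k\cdot\varphi\cdot\bar\epsilon_k$, $\overline{\mathcal L}(\varphi)=-\sum_k\bar\epsilon_k\cdot\varphi\cdot\epsilon_k$, $\mathcal H=[\mathcal L,\overline{\mathcal L}]$. $B=\sum_j v_j\cdot\nabla^{-1}_{v_j}$ ($v_1,\dots,v_{2n}$ a local orthonormal frame) is the Dirac operator of the connection $\nabla^{-1}$ (extended as a derivation to $Cl(M)$), the unique metric connection with $\nabla J=0$ whose torsion is $T=N-(d_c\omega)^+$. Here $TM$-valued 2-forms $\phi$ are identified with 3-tensors by $\phi(X,Y,Z)=\langle X,\phi(Y,Z)\rangle$; $N(X,Y)=\tfrac14([JX,JY]-J[JX,Y]-J[X,JY]-[X,Y])$; $d_c\omega(X,Y,Z)=-d\omega(JX,JY,JZ)$; and $\psi^+$ is the component of a real 3-form $\psi$ in $\mathrm{Re}(\Omega^{2,1}\oplus\Omega^{1,2})$. Put $\mathfrak B=\tfrac12(B+iB_c)$, $\overline{\mathfrak B}=\tfrac12(B-iB_c)$. *)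

theory Defs
  imports "HOL-Analysis.Analysis" "HOL-Library.Function_Algebras"
begin

section \<open>Smooth manifolds\<close>

primrec C_k_on :: "nat \<Rightarrow> 'a::euclidean_space set \<Rightarrow> ('a \<Rightarrow> 'b::real_normed_vector) \<Rightarrow> bool" where
  "C_k_on 0 S f \<longleftrightarrow> continuous_on S f"
| "C_k_on (Suc k) S f \<longleftrightarrow> (\<forall>x\<in>S. f differentiable (at x)) \<and>
     (\<forall>v. C_k_on k S (\<lambda>x. frechet_derivative f (at x) v))"

text \<open>Only used on open sets.\<close>

definition smooth_on :: "'a::euclidean_space set \<Rightarrow> ('a \<Rightarrow> 'b::real_normed_vector) \<Rightarrow> bool" where
  "smooth_on S f \<longleftrightarrow> (\<forall>k. C_k_on k S f)"

type_synonym ('m, 'e) chart = "'m set \<times> ('m \<Rightarrow> 'e)"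

definition cinv :: "('m, 'e) chart \<Rightarrow> 'e \<Rightarrow> 'm" where
  "cinv c = inv_into (fst c) (snd c)"

record ('m, 'e) almost_hermitian =
  ah_top :: "'m topology"
  ah_atlas :: "('m, 'e) chart set"
  ah_metric :: "'m \<Rightarrow> 'e \<Rightarrow> 'e \<Rightarrow> real"
  ah_J :: "'m \<Rightarrow> 'e \<Rightarrow> 'e"

definition smooth_manifold :: "('m, 'e::euclidean_space, 'z) almost_hermitian_scheme \<Rightarrow> bool" where
  "smooth_manifold M \<longleftrightarrow>
     Hausdorff_space (ah_top M) \<and> second_countable (ah_top M) \<and>
     (\<forall>c\<in>ah_atlas M. openin (ah_top M) (fst c) \<and> open (snd c ` fst c) \<and>
        homeomorphic_map (subtopology (ah_top M) (fst c)) (top_of_set (snd c ` fst c)) (snd c)) \<and>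
     (\<Union>c\<in>ah_atlas M. fst c) = topspace (ah_top M) \<and>
     (\<forall>c\<in>ah_atlas M. \<forall>d\<in>ah_atlas M. smooth_on (snd c ` (fst c \<inter> fst d)) (snd d \<circ> cinv c))"

text \<open>
  Every tangent space is modelled on \<open>'e\<close>: a vector \<open>v :: 'e\<close> at the point \<open>p\<close> stands for the
  tangent vector whose components in the preferred chart at \<open>p\<close> are \<open>v\<close>.  Components in
  any other chart are obtained from the Jacobian of the coordinate change.  The preferred chart
  may jump from point to point, so smoothness is always tested in a fixed chart.
\<close>

definition chart_at :: "('m, 'e, 'z) almost_hermitian_scheme \<Rightarrow> 'm \<Rightarrow> ('m, 'e) chart" where
  "chart_at M p = (SOME c. c \<in> ah_atlas M \<and> p \<in> fst c)"

definition jacobian :: "('m, 'e::euclidean_space) chart \<Rightarrow> ('m, 'e) chart \<Rightarrow> 'm \<Rightarrow> 'e \<Rightarrow> 'e" where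
  "jacobian c d p = frechet_derivative (snd d \<circ> cinv c) (at (snd c p))"

definition components ::
  "('m, 'e::euclidean_space, 'z) almost_hermitian_scheme \<Rightarrow> ('m, 'e) chart \<Rightarrow> 'm \<Rightarrow> 'e \<Rightarrow> 'e" where
  "components M c p = jacobian (chart_at M p) c p"

definition coord_vector ::
  "('m, 'e::euclidean_space, 'z) almost_hermitian_scheme \<Rightarrow> ('m, 'e) chart \<Rightarrow> 'm \<Rightarrow> 'e \<Rightarrow> 'e" where
  "coord_vector M c p = jacobian c (chart_at M p) p"

definition smooth_fun ::
  "('m, 'e::euclidean_space, 'z) almost_hermitian_scheme \<Rightarrow> 'm set \<Rightarrow> ('m \<Rightarrow> 'b::real_normed_vector) \<Rightarrow> bool" where
  "smooth_fun M U f \<longleftrightarrow> (\<forall>c\<in>ah_atlas M. smooth_on (snd c ` (U \<inter> fst c)) (\<lambda>x. f (cinv c x)))"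

definition smooth_vf ::
  "('m, 'e::euclidean_space, 'z) almost_hermitian_scheme \<Rightarrow> 'm set \<Rightarrow> ('m \<Rightarrow> 'e) \<Rightarrow> bool" where
  "smooth_vf M U X \<longleftrightarrow> (\<forall>c\<in>ah_atlas M.
     smooth_on (snd c ` (U \<inter> fst c)) (\<lambda>x. components M c (cinv c x) (X (cinv c x))))"

definition dir_deriv ::
  "('m, 'e::euclidean_space, 'z) almost_hermitian_scheme \<Rightarrow> 'm \<Rightarrow> 'e \<Rightarrow> ('m \<Rightarrow> 'b::real_normed_vector) \<Rightarrow> 'b" where
  "dir_deriv M p v f =
     frechet_derivative (\<lambda>x. f (cinv (chart_at M p) x)) (at (snd (chart_at M p) p)) v"

definition lie_bracket ::
  "('m, 'e::euclidean_space, 'z) almost_hermitian_scheme \<Rightarrow> ('m \<Rightarrow> 'e) \<Rightarrow> ('m \<Rightarrow> 'e) \<Rightarrow> 'm \<Rightarrow> 'e" where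
  "lie_bracket M X Y p =
     dir_deriv M p (X p) (\<lambda>q. components M (chart_at M p) q (Y q)) -
     dir_deriv M p (Y p) (\<lambda>q. components M (chart_at M p) q (X q))"


section \<open>Almost Hermitian manifolds\<close>

definition inner_product :: "('e::euclidean_space \<Rightarrow> 'e \<Rightarrow> real) \<Rightarrow> bool" where
  "inner_product G \<longleftrightarrow> (\<forall>u. linear (G u)) \<and> (\<forall>u v. G u v = G v u) \<and> (\<forall>u. u \<noteq> 0 \<longrightarrow> G u u > 0)"

definition almost_hermitian_manifold ::
  "('m, 'e::euclidean_space, 'z) almost_hermitian_scheme \<Rightarrow> bool" where
  "almost_hermitian_manifold M \<longleftrightarrow> smooth_manifold M \<and>
     (\<forall>p\<in>topspace (ah_top M).
        inner_product (ah_metric M p) \<and> linear (ah_J M p) \<and>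
        (\<forall>v. ah_J M p (ah_J M p v) = - v) \<and>
        (\<forall>u v. ah_metric M p (ah_J M p u) (ah_J M p v) = ah_metric M p u v)) \<and>
     (\<forall>U X. openin (ah_top M) U \<and> smooth_vf M U X \<longrightarrow> smooth_vf M U (\<lambda>p. ah_J M p (X p))) \<and>
     (\<forall>U X Y. openin (ah_top M) U \<and> smooth_vf M U X \<and> smooth_vf M U Y \<longrightarrow>
        smooth_fun M U (\<lambda>p. ah_metric M p (X p) (Y p)))"

definition orthonormal_basis :: "('e::euclidean_space \<Rightarrow> 'e \<Rightarrow> real) \<Rightarrow> (nat \<Rightarrow> 'e) \<Rightarrow> bool" where
  "orthonormal_basis G v \<longleftrightarrow> (\<forall>j<DIM('e). \<forall>k<DIM('e). G (v j) (v k) = (if j = k then 1 else 0))"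

text \<open>
  With \<open>n = DIM('e) div 2\<close>, the vectors \<open>e 0, \<dots>, e (n - 1), J (e 0), \<dots>, J (e (n - 1))\<close> are
  orthonormal.
\<close>

definition adapted_frame ::
  "('e::euclidean_space \<Rightarrow> 'e \<Rightarrow> real) \<Rightarrow> ('e \<Rightarrow> 'e) \<Rightarrow> (nat \<Rightarrow> 'e) \<Rightarrow> bool" where
  "adapted_frame G J e \<longleftrightarrow>
     orthonormal_basis G (\<lambda>k. if k < DIM('e) div 2 then e k else J (e (k - DIM('e) div 2)))"


section \<open>Complex exterior forms on one tangent space\<close>

text \<open>
  An element of \<open>\<Lambda>(T\<^sub>pM) \<otimes> \<complex>\<close>, identified with \<open>\<Lambda>(T\<^sub>p\<^sup>*M) \<otimes> \<complex>\<close> by the metric, is a family of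
  alternating real-multilinear complex-valued maps, one for every number of arguments; the
  homogeneous component of degree \<open>k\<close> is the restriction to lists of length \<open>k\<close>.
\<close>

type_synonym 'e form = "'e list \<Rightarrow> complex"

definition forms :: "'e::euclidean_space form set" where
  "forms = {\<phi>. (\<forall>xs ys. linear (\<lambda>w. \<phi> (xs @ w # ys))) \<and>
               (\<forall>xs ys zs w. \<phi> (xs @ w # ys @ w # zs) = 0)}"

definition csmul :: "complex \<Rightarrow> 'e form \<Rightarrow> 'e form"  (infixr \<open>\<odot>\<close> 75) where
  "c \<odot> \<phi> = (\<lambda>ws. c * \<phi> ws)"

definition one_form0 :: "'e form" where
  "one_form0 = (\<lambda>ws. if ws = [] then 1 else 0)"

definition flat :: "('e \<Rightarrow> 'e \<Rightarrow> real) \<Rightarrow> 'e \<Rightarrow> 'e form" where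
  "flat G v = (\<lambda>ws. case ws of [w] \<Rightarrow> complex_of_real (G v w) | _ \<Rightarrow> 0)"

definition remove_nth :: "nat \<Rightarrow> 'a list \<Rightarrow> 'a list" where
  "remove_nth i ws = take i ws @ drop (Suc i) ws"

definition vwedge :: "('e \<Rightarrow> 'e \<Rightarrow> real) \<Rightarrow> 'e \<Rightarrow> 'e form \<Rightarrow> 'e form" where
  "vwedge G v \<phi> = (\<lambda>ws. \<Sum>i<length ws. (-1) ^ i * complex_of_real (G v (ws ! i)) * \<phi> (remove_nth i ws))"

definition contraction :: "'e \<Rightarrow> 'e form \<Rightarrow> 'e form" where
  "contraction v \<phi> = (\<lambda>ws. \<phi> (v # ws))"

text \<open>
  The Hermitian product on forms induced by the metric; summing over all index tuples counts every
  increasing one \<open>k!\<close> times.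
\<close>

definition form_inner :: "(nat \<Rightarrow> 'e::euclidean_space) \<Rightarrow> 'e form \<Rightarrow> 'e form \<Rightarrow> complex" where
  "form_inner v \<phi> \<psi> = (\<Sum>k\<le>DIM('e). (1 / fact k) *
     (\<Sum>js | set js \<subseteq> {..<DIM('e)} \<and> length js = k. \<phi> (map v js) * cnj (\<psi> (map v js))))"

lemma forms_swap:
  assumes "\<phi> \<in> forms"
  shows "\<phi> (xs @ a # b # ys) = - \<phi> (xs @ b # a # ys)"
proof -
  have lin: "linear (\<lambda>w. \<phi> (us @ w # vs))" for us vs
    using assms by (simp add: forms_def)
  have alt: "\<phi> (us @ w # vs @ w # zs) = 0" for us vs zs w
    using assms by (simp add: forms_def)
  have l1: "\<phi> (xs @ (u + v) # w # ys) = \<phi> (xs @ u # w # ys) + \<phi> (xs @ v # w # ys)" for u v w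
    using linear_add[OF lin[of xs "w # ys"]] .
  have l2: "\<phi> (xs @ w # (u + v) # ys) = \<phi> (xs @ w # u # ys) + \<phi> (xs @ w # v # ys)" for u v w
    using linear_add[OF lin[of "xs @ [w]" ys]] by simp
  have a2: "\<phi> (xs @ w # w # ys) = 0" for w using alt[of xs w "[]"] by simp
  have z: "\<phi> (xs @ (a + b) # (a + b) # ys) = 0" by (rule a2)
  have "\<phi> (xs @ a # b # ys) + \<phi> (xs @ b # a # ys) = 0"
    using z unfolding l1 l2 using a2[of a] a2[of b] by (simp add: add.commute)
  then show ?thesis by (simp add: add_eq_0_iff2)
qed

lemma forms_move_front:
  assumes "\<phi> \<in> forms"
  shows "\<phi> (xs @ a # ys) = (-1) ^ length xs * \<phi> (a # xs @ ys)"
proof (induction xs arbitrary: ys rule: rev_induct)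
  case (snoc x xs)
  have "\<phi> ((xs @ [x]) @ a # ys) = - \<phi> (xs @ a # x # ys)"
    using forms_swap[OF assms, of xs x a ys] by simp
  then show ?case using snoc[of "x # ys"] by simp
qed simp

lemma forms_too_long:
  assumes "\<phi> \<in> forms" and "set js \<subseteq> {..<n}" and "length js > n"
  shows "\<phi> (map v js) = 0"
proof -
  have "\<not> distinct js"
  proof
    assume "distinct js"
    then have "length js = card (set js)" by (simp add: distinct_card)
    also have "\<dots> \<le> card {..<n}" by (rule card_mono) (use assms in auto)
    finally show False using assms by simp
  qed
  then obtain xs ys zs y where "js = xs @ [y] @ ys @ [y] @ zs"
    using not_distinct_decomp by blast
  then show ?thesis using assms(1) by (simp add: forms_def)
qed

lemma orthonormal_expand:
  fixes v :: "nat \<Rightarrow> 'e::euclidean_space"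
  assumes G: "inner_product G" and v: "orthonormal_basis G v"
  shows "u = (\<Sum>j<DIM('e). G u (v j) *\<^sub>R v j)"
proof -
  have lin: "linear (G u)" for u using G by (simp add: inner_product_def)
  have sym: "G u w = G w u" for u w using G by (simp add: inner_product_def)
  have coef: "G (v k) (\<Sum>j<DIM('e). c j *\<^sub>R v j) = c k" if "k < DIM('e)" for c k
  proof -
    have "G (v k) (\<Sum>j<DIM('e). c j *\<^sub>R v j) = (\<Sum>j<DIM('e). c j * G (v k) (v j))"
      by (simp add: linear_sum[OF lin] linear_cmul[OF lin])
    also have "\<dots> = (\<Sum>j<DIM('e). if j = k then c j else 0)"
      using v that by (intro sum.cong) (auto simp: orthonormal_basis_def)
    finally show ?thesis using that by simp
  qed
  have inj: "inj_on v {..<DIM('e)}"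
  proof (rule inj_onI)
    fix i j assume "i \<in> {..<DIM('e)}" "j \<in> {..<DIM('e)}" "v i = v j"
    then show "i = j" using v unfolding orthonormal_basis_def
      by (metis lessThan_iff zero_neq_one)
  qed
  have ind: "independent (v ` {..<DIM('e)})"
  proof (rule independent_if_scalars_zero)
    fix f x assume 0: "(\<Sum>x\<in>v ` {..<DIM('e)}. f x *\<^sub>R x) = 0" and x: "x \<in> v ` {..<DIM('e)}"
    then obtain k where k: "k < DIM('e)" "x = v k" by auto
    have "(\<Sum>j<DIM('e). f (v j) *\<^sub>R v j) = 0" using 0 by (simp add: sum.reindex[OF inj])
    then show "f x = 0" using coef[OF k(1), of "\<lambda>j. f (v j)"] k linear_0[OF lin] by simp
  qed simp
  have "span (v ` {..<DIM('e)}) = UNIV"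
    using ind card_image[OF inj] card_eq_dim[of "v ` {..<DIM('e)}" UNIV] by auto
  then obtain c where c: "u = (\<Sum>x\<in>v ` {..<DIM('e)}. c x *\<^sub>R x)"
    using span_finite[of "v ` {..<DIM('e)}"] by auto
  then have u: "u = (\<Sum>j<DIM('e). c (v j) *\<^sub>R v j)" by (simp add: sum.reindex[OF inj])
  have "G u (v k) = c (v k)" if "k < DIM('e)" for k
    using coef[OF that, of "\<lambda>j. c (v j)"] u sym[of u "v k"] by simp
  then show ?thesis using u by (metis (no_types, lifting) lessThan_iff sum.cong)
qed

lemma remove_insert_bij:
  assumes "i \<le> m"
  shows "bij_betw (\<lambda>js. (js ! i, remove_nth i js))
    {js. set js \<subseteq> A \<and> length js = Suc m} (A \<times> {js. set js \<subseteq> A \<and> length js = m})"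
proof (rule bij_betw_byWitness[where f' = "\<lambda>(j, js). take i js @ j # drop i js"])
  have "set (remove_nth i js) \<subseteq> set js" for js :: "'a list"
    by (auto simp: remove_nth_def dest: in_set_takeD in_set_dropD)
  then show "(\<lambda>js. (js ! i, remove_nth i js)) ` {js. set js \<subseteq> A \<and> length js = Suc m}
      \<subseteq> A \<times> {js. set js \<subseteq> A \<and> length js = m}"
    using assms by (fastforce simp: remove_nth_def)
  show "(\<lambda>(j, js). take i js @ j # drop i js) ` (A \<times> {js. set js \<subseteq> A \<and> length js = m})
      \<subseteq> {js. set js \<subseteq> A \<and> length js = Suc m}"
    using assms by (fastforce dest: in_set_takeD in_set_dropD)
qed (use assms in \<open>auto simp: remove_nth_def nth_append id_take_nth_drop[symmetric] min_def\<close>)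

lemma vwedge_adjoint_contraction:
  fixes v :: "nat \<Rightarrow> 'e::euclidean_space"
  assumes G: "inner_product G" and v: "orthonormal_basis G v"
    and \<phi>: "\<phi> \<in> forms" and \<psi>: "\<psi> \<in> forms"
  shows "form_inner v (vwedge G u \<phi>) \<psi> = form_inner v \<phi> (contraction u \<psi>)"
proof -
  define I where "I k = {js. set js \<subseteq> {..<DIM('e)} \<and> length js = k}" for k
  define S where "S m = (\<Sum>js\<in>I m. \<phi> (map v js) * cnj (contraction u \<psi> (map v js)))" for m
  have lin: "linear (\<lambda>w. \<psi> (w # ws))" for ws
  proof -
    have "\<forall>xs ys. linear (\<lambda>w. \<psi> (xs @ w # ys))" using \<psi> by (simp add: forms_def)
    from this[rule_format, of "[]" ws] show ?thesis by simp
  qed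
  have contr: "contraction u \<psi> ws = (\<Sum>j<DIM('e). complex_of_real (G u (v j)) * \<psi> (v j # ws))" for ws
    unfolding contraction_def
    by (subst orthonormal_expand[OF G v, of u])
       (simp add: linear_sum[OF lin] linear_cmul[OF lin] scaleR_conv_of_real)
  have step: "(\<Sum>js\<in>I (Suc m). vwedge G u \<phi> (map v js) * cnj (\<psi> (map v js))) = of_nat (Suc m) * S m" for m
  proof -
    have one: "(\<Sum>js\<in>I (Suc m). (-1) ^ i * complex_of_real (G u (v (js ! i))) *
        \<phi> (map v (remove_nth i js)) * cnj (\<psi> (map v js))) = S m" if i: "i \<le> m" for i
    proof -
      let ?h = "\<lambda>(j, js). complex_of_real (G u (v j)) * \<phi> (map v js) * cnj (\<psi> (v j # map v js))"
      have "(-1) ^ i * complex_of_real (G u (v (js ! i))) * \<phi> (map v (remove_nth i js)) * cnj (\<psi> (map v js))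
          = ?h (js ! i, remove_nth i js)" if "js \<in> I (Suc m)" for js
      proof -
        have len: "i < length js" using that i by (simp add: I_def)
        have "map v js = map v (take i js) @ v (js ! i) # map v (drop (Suc i) js)"
          using arg_cong[OF id_take_nth_drop[OF len], of "map v"] by simp
        then have "\<psi> (map v js) = (-1) ^ i * \<psi> (v (js ! i) # map v (remove_nth i js))"
          using forms_move_front[OF \<psi>, of "map v (take i js)" "v (js ! i)"] len
          by (simp add: remove_nth_def)
        then show ?thesis by (simp add: algebra_simps flip: power_mult_distrib)
      qed
      then have "(\<Sum>js\<in>I (Suc m). (-1) ^ i * complex_of_real (G u (v (js ! i))) *
          \<phi> (map v (remove_nth i js)) * cnj (\<psi> (map v js))) = (\<Sum>js\<in>I (Suc m). ?h (js ! i, remove_nth i js))"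
        by (intro sum.cong) auto
      also have "\<dots> = (\<Sum>x\<in>{..<DIM('e)} \<times> I m. ?h x)"
        unfolding I_def by (rule sum.reindex_bij_betw[OF remove_insert_bij[OF i]])
      also have "\<dots> = (\<Sum>j<DIM('e). \<Sum>js\<in>I m. ?h (j, js))"
        by (simp add: sum.cartesian_product)
      also have "\<dots> = (\<Sum>js\<in>I m. \<Sum>j<DIM('e). ?h (j, js))" by (rule sum.swap)
      also have "\<dots> = S m"
        unfolding S_def contr by (simp add: sum_distrib_left mult_ac)
      finally show ?thesis .
    qed
    have "(\<Sum>js\<in>I (Suc m). vwedge G u \<phi> (map v js) * cnj (\<psi> (map v js))) =
        (\<Sum>js\<in>I (Suc m). \<Sum>i<Suc m. (-1) ^ i * complex_of_real (G u (v (js ! i))) *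
          \<phi> (map v (remove_nth i js)) * cnj (\<psi> (map v js)))"
      by (intro sum.cong)
         (auto simp: I_def vwedge_def sum_distrib_right remove_nth_def take_map drop_map simp del: sum.lessThan_Suc intro!: sum.cong)
    also have "\<dots> = (\<Sum>i<Suc m. S m)"
      by (subst sum.swap) (intro sum.cong refl one, simp)
    finally show ?thesis by simp
  qed
  have top: "S DIM('e) = 0"
  proof -
    have "contraction u \<psi> (map v js) = 0" if "js \<in> I DIM('e)" for js
      unfolding contr
    proof (intro sum.neutral ballI)
      fix j assume "j \<in> {..<DIM('e)}"
      then show "complex_of_real (G u (v j)) * \<psi> (v j # map v js) = 0"
        using forms_too_long[OF \<psi>, of "j # js" "DIM('e)" v] that by (simp add: I_def)
    qed
    then show ?thesis by (simp add: S_def)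
  qed
  have "form_inner v (vwedge G u \<phi>) \<psi> =
      (\<Sum>k<Suc DIM('e). (1 / fact k) * (\<Sum>js\<in>I k. vwedge G u \<phi> (map v js) * cnj (\<psi> (map v js))))"
    by (simp only: form_inner_def I_def lessThan_Suc_atMost)
  also have "\<dots> = (\<Sum>m<DIM('e). (1 / fact (Suc m)) * (of_nat (Suc m) * S m))"
    unfolding sum.lessThan_Suc_shift step by (simp add: I_def vwedge_def del: fact_Suc of_nat_Suc)
  also have "\<dots> = (\<Sum>m<DIM('e). (1 / fact m) * S m)"
    by (intro sum.cong refl) (simp add: field_simps del: of_nat_Suc)
  also have "\<dots> = (\<Sum>m<Suc DIM('e). (1 / fact m) * S m)" by (simp add: top)
  also have "\<dots> = form_inner v \<phi> (contraction u \<psi>)"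
    by (simp only: form_inner_def S_def I_def lessThan_Suc_atMost)
  finally show ?thesis .
qed



section \<open>Clifford algebra\<close>

definition clinear_forms :: "('e::euclidean_space form \<Rightarrow> 'e form) \<Rightarrow> bool" where
  "clinear_forms T \<longleftrightarrow> (\<forall>\<phi>\<in>forms. T \<phi> \<in> forms) \<and>
     (\<forall>\<phi>\<in>forms. \<forall>\<psi>\<in>forms. T (\<phi> + \<psi>) = T \<phi> + T \<psi>) \<and>
     (\<forall>c. \<forall>\<phi>\<in>forms. T (c \<odot> \<phi>) = c \<odot> T \<phi>)"

definition is_clifford_product ::
  "('e::euclidean_space \<Rightarrow> 'e \<Rightarrow> real) \<Rightarrow> ('e form \<Rightarrow> 'e form \<Rightarrow> 'e form) \<Rightarrow> bool" where
  "is_clifford_product G P \<longleftrightarrow>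
     (\<forall>\<phi>\<in>forms. clinear_forms (P \<phi>)) \<and> (\<forall>\<psi>\<in>forms. clinear_forms (\<lambda>\<phi>. P \<phi> \<psi>)) \<and>
     (\<forall>\<phi>\<in>forms. \<forall>\<psi>\<in>forms. \<forall>\<theta>\<in>forms. P (P \<phi> \<psi>) \<theta> = P \<phi> (P \<psi> \<theta>)) \<and>
     (\<forall>\<phi>\<in>forms. P one_form0 \<phi> = \<phi> \<and> P \<phi> one_form0 = \<phi>) \<and>
     (\<forall>v. \<forall>\<phi>\<in>forms. P (flat G v) \<phi> = vwedge G v \<phi> - contraction v \<phi>)"

text \<open>
  The objects chosen in the next definitions are unique on \<^term>\<open>forms\<close>; they are never applied
  outside of it.
\<close>

definition clifford :: "('e::euclidean_space \<Rightarrow> 'e \<Rightarrow> real) \<Rightarrow> 'e form \<Rightarrow> 'e form \<Rightarrow> 'e form" where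
  "clifford G = (SOME P. is_clifford_product G P)"

definition clifford_word :: "('e::euclidean_space \<Rightarrow> 'e \<Rightarrow> real) \<Rightarrow> 'e list \<Rightarrow> 'e form" where
  "clifford_word G vs = foldr (\<lambda>v \<phi>. clifford G (flat G v) \<phi>) vs one_form0"

definition Jalg :: "('e::euclidean_space \<Rightarrow> 'e \<Rightarrow> real) \<Rightarrow> ('e \<Rightarrow> 'e) \<Rightarrow> 'e form \<Rightarrow> 'e form" where
  "Jalg G J = (SOME T. clinear_forms T \<and> bij_betw T forms forms \<and> T one_form0 = one_form0 \<and>
     (\<forall>\<phi>\<in>forms. \<forall>\<psi>\<in>forms. T (clifford G \<phi> \<psi>) = clifford G (T \<phi>) (T \<psi>)) \<and>
     (\<forall>v. T (flat G v) = flat G (J v)))"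

definition transpose_form :: "('e::euclidean_space \<Rightarrow> 'e \<Rightarrow> real) \<Rightarrow> 'e form \<Rightarrow> 'e form" where
  "transpose_form G = (SOME T. clinear_forms T \<and>
     (\<forall>\<phi>\<in>forms. \<forall>\<psi>\<in>forms. T (clifford G \<phi> \<psi>) = clifford G (T \<psi>) (T \<phi>)) \<and>
     (\<forall>vs. T (clifford_word G vs) = clifford_word G (rev vs)))"


section \<open>Sections of the complex Clifford bundle and their operators\<close>

type_synonym ('m, 'e) form_field = "'m \<Rightarrow> 'e form"

definition smooth_form_field ::
  "('m, 'e::euclidean_space, 'z) almost_hermitian_scheme \<Rightarrow> 'm set \<Rightarrow> ('m, 'e) form_field \<Rightarrow> bool" where
  "smooth_form_field M U \<phi> \<longleftrightarrow> (\<forall>p\<in>U. \<phi> p \<in> forms) \<and>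
     (\<forall>c\<in>ah_atlas M. \<forall>ws. smooth_on (snd c ` (U \<inter> fst c))
        (\<lambda>x. \<phi> (cinv c x) (map (coord_vector M c (cinv c x)) ws)))"

definition Gamma_Cl :: "('m, 'e::euclidean_space, 'z) almost_hermitian_scheme \<Rightarrow> ('m, 'e) form_field set" where
  "Gamma_Cl M = {\<phi>. smooth_form_field M (topspace (ah_top M)) \<phi>}"

type_synonym ('m, 'e) form_op = "('m, 'e) form_field \<Rightarrow> ('m, 'e) form_field"

definition op_eq ::
  "('m, 'e::euclidean_space, 'z) almost_hermitian_scheme \<Rightarrow> ('m, 'e) form_op \<Rightarrow> ('m, 'e) form_op \<Rightarrow> bool" where
  "op_eq M S T \<longleftrightarrow> (\<forall>\<phi>\<in>Gamma_Cl M. \<forall>p\<in>topspace (ah_top M). S \<phi> p = T \<phi> p)"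

definition commutator :: "('m, 'e) form_op \<Rightarrow> ('m, 'e) form_op \<Rightarrow> ('m, 'e) form_op" where
  "commutator S T = (\<lambda>\<phi>. S (T \<phi>) - T (S \<phi>))"

definition anticommutator :: "('m, 'e) form_op \<Rightarrow> ('m, 'e) form_op \<Rightarrow> ('m, 'e) form_op" where
  "anticommutator S T = (\<lambda>\<phi>. S (T \<phi>) + T (S \<phi>))"

definition Jalg_op :: "('m, 'e::euclidean_space, 'z) almost_hermitian_scheme \<Rightarrow> ('m, 'e) form_op" where
  "Jalg_op M \<phi> = (\<lambda>p. Jalg (ah_metric M p) (ah_J M p) (\<phi> p))"

definition Jalg_inv_op :: "('m, 'e::euclidean_space, 'z) almost_hermitian_scheme \<Rightarrow> ('m, 'e) form_op" where
  "Jalg_inv_op M \<phi> = (\<lambda>p. inv_into forms (Jalg (ah_metric M p) (ah_J M p)) (\<phi> p))"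

definition star_op :: "('m, 'e::euclidean_space, 'z) almost_hermitian_scheme \<Rightarrow> ('m, 'e) form_op" where
  "star_op M \<phi> = (\<lambda>p. transpose_form (ah_metric M p) (\<phi> p))"

definition op_c ::
  "('m, 'e::euclidean_space, 'z) almost_hermitian_scheme \<Rightarrow> ('m, 'e) form_op \<Rightarrow> ('m, 'e) form_op" where
  "op_c M T = (\<lambda>\<phi>. Jalg_inv_op M (T (Jalg_op M \<phi>)))"

definition op_star ::
  "('m, 'e::euclidean_space, 'z) almost_hermitian_scheme \<Rightarrow> ('m, 'e) form_op \<Rightarrow> ('m, 'e) form_op" where
  "op_star M T = (\<lambda>\<phi>. star_op M (T (star_op M \<phi>)))"

text \<open>
  The value at \<open>p\<close> of an expression in a local adapted frame only involves the frame at \<open>p\<close>, and the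
  operators below do not depend on its choice; the same applies to the orthonormal frame in the
  Dirac operator.
\<close>

definition frame_at :: "('m, 'e::euclidean_space, 'z) almost_hermitian_scheme \<Rightarrow> 'm \<Rightarrow> nat \<Rightarrow> 'e" where
  "frame_at M p = (SOME e. adapted_frame (ah_metric M p) (ah_J M p) e)"

definition eps :: "('m, 'e::euclidean_space, 'z) almost_hermitian_scheme \<Rightarrow> 'm \<Rightarrow> nat \<Rightarrow> 'e form" where
  "eps M p k = (1/2) \<odot> (flat (ah_metric M p) (frame_at M p k) -
     \<i> \<odot> flat (ah_metric M p) (ah_J M p (frame_at M p k)))"

definition eps_bar :: "('m, 'e::euclidean_space, 'z) almost_hermitian_scheme \<Rightarrow> 'm \<Rightarrow> nat \<Rightarrow> 'e form" where
  "eps_bar M p k = (1/2) \<odot> (flat (ah_metric M p) (frame_at M p k) +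
     \<i> \<odot> flat (ah_metric M p) (ah_J M p (frame_at M p k)))"

definition L_op :: "('m, 'e::euclidean_space, 'z) almost_hermitian_scheme \<Rightarrow> ('m, 'e) form_op" where
  "L_op M \<phi> = (\<lambda>p. - (\<Sum>k<DIM('e) div 2.
     clifford (ah_metric M p) (clifford (ah_metric M p) (eps M p k) (\<phi> p)) (eps_bar M p k)))"

definition L_bar_op :: "('m, 'e::euclidean_space, 'z) almost_hermitian_scheme \<Rightarrow> ('m, 'e) form_op" where
  "L_bar_op M \<phi> = (\<lambda>p. - (\<Sum>k<DIM('e) div 2.
     clifford (ah_metric M p) (clifford (ah_metric M p) (eps_bar M p k) (\<phi> p)) (eps M p k)))"

definition H_op :: "('m, 'e::euclidean_space, 'z) almost_hermitian_scheme \<Rightarrow> ('m, 'e) form_op" where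
  "H_op M = commutator (L_op M) (L_bar_op M)"


section \<open>Exterior derivative, bidegree and the Nijenhuis tensor\<close>

text \<open>
  The coordinate fields of the preferred chart at \<open>p\<close> commute and have the values \<open>ws\<close> at \<open>p\<close>, so
  only the derivative terms of the invariant formula survive.
\<close>

definition ext_deriv ::
  "('m, 'e::euclidean_space, 'z) almost_hermitian_scheme \<Rightarrow> ('m, 'e) form_field \<Rightarrow> ('m, 'e) form_field" where
  "ext_deriv M \<alpha> p ws = (\<Sum>i<length ws. (-1) ^ i *
     dir_deriv M p (ws ! i)
       (\<lambda>q. \<alpha> q (map (coord_vector M (chart_at M p) q) (remove_nth i ws))))"

definition omega :: "('m, 'e, 'z) almost_hermitian_scheme \<Rightarrow> ('m, 'e) form_field" where
  "omega M p ws = (case ws of [u, v] \<Rightarrow> complex_of_real (ah_metric M p (ah_J M p u) v) | _ \<Rightarrow> 0)"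

definition dc_omega :: "('m, 'e::euclidean_space, 'z) almost_hermitian_scheme \<Rightarrow> ('m, 'e) form_field" where
  "dc_omega M p ws = - ext_deriv M (omega M) p (map (ah_J M p) ws)"

text \<open>Complex-multilinear extension; the pair \<open>(x, y)\<close> stands for the complex vector \<open>x + \<i> y\<close>.\<close>

fun complexified :: "'e form \<Rightarrow> ('e \<times> 'e) list \<Rightarrow> complex" where
  "complexified \<phi> [] = \<phi> []"
| "complexified \<phi> ((x, y) # zs) =
     complexified (\<lambda>ws. \<phi> (x # ws)) zs + \<i> * complexified (\<lambda>ws. \<phi> (y # ws)) zs"

text \<open>
  \<open>(True, u)\<close> encodes the \<open>(1,0)\<close>-vector \<open>u - \<i> J u\<close>, and \<open>(False, u)\<close> the \<open>(0,1)\<close>-vector \<open>u + \<i> J u\<close>.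
\<close>

definition pure_vector :: "('e::euclidean_space \<Rightarrow> 'e) \<Rightarrow> bool \<times> 'e \<Rightarrow> 'e \<times> 'e" where
  "pure_vector J t = (if fst t then (snd t, - J (snd t)) else (snd t, J (snd t)))"

definition bidegree :: "('e::euclidean_space \<Rightarrow> 'e) \<Rightarrow> nat \<Rightarrow> nat \<Rightarrow> 'e form set" where
  "bidegree J p q = {\<phi>\<in>forms. (\<forall>ws. length ws \<noteq> p + q \<longrightarrow> \<phi> ws = 0) \<and>
     (\<forall>ts. length ts = p + q \<and> length (filter fst ts) \<noteq> p \<longrightarrow>
        complexified \<phi> (map (pure_vector J) ts) = 0)}"

definition plus_part :: "('e::euclidean_space \<Rightarrow> 'e) \<Rightarrow> 'e form \<Rightarrow> 'e form" where
  "plus_part J \<psi> = (THE \<theta>. \<exists>a\<in>bidegree J 3 0. \<exists>b\<in>bidegree J 2 1. \<exists>c\<in>bidegree J 1 2. \<exists>d\<in>bidegree J 0 3.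
     \<psi> = a + b + c + d \<and> \<theta> = b + c)"

definition nijenhuis ::
  "('m, 'e::euclidean_space, 'z) almost_hermitian_scheme \<Rightarrow> ('m \<Rightarrow> 'e) \<Rightarrow> ('m \<Rightarrow> 'e) \<Rightarrow> 'm \<Rightarrow> 'e" where
  "nijenhuis M X Y p = (let JX = (\<lambda>q. ah_J M q (X q)); JY = (\<lambda>q. ah_J M q (Y q)) in
     (1/4) *\<^sub>R (lie_bracket M JX JY p - ah_J M p (lie_bracket M JX Y p)
       - ah_J M p (lie_bracket M X JY p) - lie_bracket M X Y p))"


section \<open>The connection and its Dirac operator\<close>

text \<open>
  \<open>nabla p v Y\<close> is the covariant derivative at \<open>p\<close> of the local vector field \<open>Y\<close> in the direction
  \<open>v\<close>; it is only constrained for fields that are smooth near \<open>p\<close>.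
\<close>

type_synonym ('m, 'e) connection = "'m \<Rightarrow> 'e \<Rightarrow> ('m \<Rightarrow> 'e) \<Rightarrow> 'e"

definition affine_connection ::
  "('m, 'e::euclidean_space, 'z) almost_hermitian_scheme \<Rightarrow> ('m, 'e) connection \<Rightarrow> bool" where
  "affine_connection M nabla \<longleftrightarrow>
     (\<forall>U p v Y Z. openin (ah_top M) U \<and> p \<in> U \<and> smooth_vf M U Y \<and> smooth_vf M U Z \<longrightarrow>
        linear (\<lambda>u. nabla p u Y) \<and>
        ((\<forall>q\<in>U. Y q = Z q) \<longrightarrow> nabla p v Y = nabla p v Z) \<and>
        nabla p v (\<lambda>q. Y q + Z q) = nabla p v Y + nabla p v Z \<and>
        (\<forall>f::'m \<Rightarrow> real. smooth_fun M U f \<longrightarrow>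
           nabla p v (\<lambda>q. f q *\<^sub>R Y q) = dir_deriv M p v f *\<^sub>R Y p + f p *\<^sub>R nabla p v Y)) \<and>
     (\<forall>U X Y. openin (ah_top M) U \<and> smooth_vf M U X \<and> smooth_vf M U Y \<longrightarrow>
        smooth_vf M U (\<lambda>p. nabla p (X p) Y))"

text \<open>
  The last clause states that the torsion is \<open>N - (d\<^sub>c\<omega>)\<^sup>+\<close>, paired with an arbitrary tangent
  vector \<open>u\<close>: a 3-form corresponds to a vector-valued 2-form through its first argument.
\<close>

definition canonical_connection ::
  "('m, 'e::euclidean_space, 'z) almost_hermitian_scheme \<Rightarrow> ('m, 'e) connection \<Rightarrow> bool" where
  "canonical_connection M nabla \<longleftrightarrow> affine_connection M nabla \<and>
     (\<forall>U p X Y. openin (ah_top M) U \<and> p \<in> U \<and> smooth_vf M U X \<and> smooth_vf M U Y \<longrightarrow>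
        (\<forall>v. dir_deriv M p v (\<lambda>q. ah_metric M q (X q) (Y q)) =
           ah_metric M p (nabla p v X) (Y p) + ah_metric M p (X p) (nabla p v Y)) \<and>
        (\<forall>v. nabla p v (\<lambda>q. ah_J M q (X q)) = ah_J M p (nabla p v X)) \<and>
        (\<forall>u. ah_metric M p u (nabla p (X p) Y - nabla p (Y p) X - lie_bracket M X Y p) =
           ah_metric M p u (nijenhuis M X Y p) -
           Re (plus_part (ah_J M p) (dc_omega M p) [u, X p, Y p])))"

type_synonym ('m, 'e) form_connection = "'m \<Rightarrow> 'e \<Rightarrow> ('m, 'e) form_field \<Rightarrow> 'e form"

definition derivation_extension ::
  "('m, 'e::euclidean_space, 'z) almost_hermitian_scheme \<Rightarrow> ('m, 'e) connection \<Rightarrow>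
   ('m, 'e) form_connection \<Rightarrow> bool" where
  "derivation_extension M nabla D \<longleftrightarrow>
     (\<forall>U p v. openin (ah_top M) U \<and> p \<in> U \<longrightarrow>
        (\<forall>\<phi> \<psi>. smooth_form_field M U \<phi> \<and> smooth_form_field M U \<psi> \<longrightarrow>
           D p v \<phi> \<in> forms \<and>
           ((\<forall>q\<in>U. \<phi> q = \<psi> q) \<longrightarrow> D p v \<phi> = D p v \<psi>) \<and>
           D p v (\<phi> + \<psi>) = D p v \<phi> + D p v \<psi> \<and>
           D p v (\<lambda>q. clifford (ah_metric M q) (\<phi> q) (\<psi> q)) =
             clifford (ah_metric M p) (D p v \<phi>) (\<psi> p) + clifford (ah_metric M p) (\<phi> p) (D p v \<psi>)) \<and>
        (\<forall>f::'m \<Rightarrow> complex. smooth_fun M U f \<longrightarrow>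
           D p v (\<lambda>q. f q \<odot> one_form0) = dir_deriv M p v f \<odot> one_form0) \<and>
        (\<forall>Y. smooth_vf M U Y \<longrightarrow>
           D p v (\<lambda>q. flat (ah_metric M q) (Y q)) = flat (ah_metric M p) (nabla p v Y)))"

definition dirac ::
  "('m, 'e::euclidean_space, 'z) almost_hermitian_scheme \<Rightarrow> ('m, 'e) form_connection \<Rightarrow> ('m, 'e) form_op" where
  "dirac M D \<phi> = (\<lambda>p. let v = (SOME v. orthonormal_basis (ah_metric M p) v) in
     \<Sum>j<DIM('e). clifford (ah_metric M p) (flat (ah_metric M p) (v j)) (D p (v j) \<phi>))"

definition frak_B ::
  "('m, 'e::euclidean_space, 'z) almost_hermitian_scheme \<Rightarrow> ('m, 'e) form_connection \<Rightarrow> ('m, 'e) form_op" where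
  "frak_B M D \<phi> = (\<lambda>p. (1/2) \<odot> (dirac M D \<phi> p + \<i> \<odot> op_c M (dirac M D) \<phi> p))"

definition frak_B_bar ::
  "('m, 'e::euclidean_space, 'z) almost_hermitian_scheme \<Rightarrow> ('m, 'e) form_connection \<Rightarrow> ('m, 'e) form_op" where
  "frak_B_bar M D \<phi> = (\<lambda>p. (1/2) \<odot> (dirac M D \<phi> p - \<i> \<odot> op_c M (dirac M D) \<phi> p))"

end

(*
  For a smooth section phi and an orthonormal basis v_1, ..., v_2n at a point p, the operator
  frak B is phi |-> 1/2 sum_j z_j . (nabla_{v_j} phi) with z_j = v_j - i J v_j.  Likewise
  L(phi) = -1/8 sum_j z_j . phi . conj(z_j) for every orthonormal basis.  Since nabla is metric
  and J is parallel, L, J_alg and the transpose commute with covariant differentiation, so the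
  identities become identities of Clifford multiplications at p:
  {z, L} = 0 and {z, L_bar} = right multiplication by z, because the z_j anticommute among
  themselves and anticommute with the conj(z_k) up to scalars.  The last identity then
  follows from {right multiplication by z, L} = z.  Replacing J by -J exchanges L with L_bar and
  frak B with its conjugate.
*)
theory Submission
  imports Defs
begin

section \<open>Calculus of smooth maps on open sets\<close>

text \<open>The Clifford product, \<open>Jalg\<close>, the transpose and the frames are choices made
  separately at each point, and \<open>D\<close> is known only through its rules on fields that are
  smooth near a point. Hence existence, smoothness and compatibility with \<open>D\<close> all have
  to be earned. At a point, explicit models witness the choices: operators commuting with right
  multiplication for the product, pullback along -J for \<open>Jalg\<close>, a degree-dependent sign
  for the transpose. Near a point, the engine is the number operator of the exterior algebra, the
  sum of v_j wedge (v_j contracted with \<phi>): it rebuilds a form of degree k + 1 from Clifford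
  products of vectors with forms of degree k. So every smooth form field near \<open>p\<close>
  arises from scalars by left multiplication with a smooth orthonormal frame, and for
  \<open>Jalg\<close> and the transpose it is enough to check this one operation. The frame itself
  comes from Gram-Schmidt over the complex numbers. For L the frame is not parallel, but its
  derivative is an infinitesimal rotation, to which a trace over an orthonormal basis is blind; the
  same blindness replaces the possibly jumping \<open>frame_at\<close> by a smooth frame.\<close>

lemma C_k_on_cong:
  assumes "open S" "\<And>x. x \<in> S \<Longrightarrow> f x = g x"
  shows "C_k_on k S f \<longleftrightarrow> C_k_on k S g"
  using assms(2)
proof (induction k arbitrary: f g)
  case 0
  then show ?case by (auto intro: continuous_on_cong[THEN iffD1])
next
  case (Suc k)
  have has: "(f has_derivative h) (at x) \<longleftrightarrow> (g has_derivative h) (at x)" if "x \<in> S" for x h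
    using Suc.prems has_derivative_transform_within_open[OF _ assms(1) that] by metis
  then have "frechet_derivative f (at x) = frechet_derivative g (at x)" if "x \<in> S" for x
    using that by (simp add: frechet_derivative_def)
  then have "C_k_on k S (\<lambda>x. frechet_derivative f (at x) v) \<longleftrightarrow> C_k_on k S (\<lambda>x. frechet_derivative g (at x) v)" for v
    by (intro Suc.IH) simp
  then show ?case using has by (simp add: differentiable_def)
qed

lemma C_k_on_subset: "C_k_on k S f \<Longrightarrow> T \<subseteq> S \<Longrightarrow> C_k_on k T f"
  by (induction k arbitrary: f) (auto intro: continuous_on_subset)

lemma C_k_on_imp_continuous_on: "C_k_on k S f \<Longrightarrow> continuous_on S f"
  by (cases k) (auto intro!: continuous_at_imp_continuous_on differentiable_imp_continuous_within)

lemma C_k_on_SucD: "C_k_on (Suc k) S f \<Longrightarrow> C_k_on k S f"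
proof (induction k arbitrary: f)
  case 0
  then show ?case using C_k_on_imp_continuous_on by (metis C_k_on.simps(1))
next
  case (Suc k)
  then show ?case by (metis C_k_on.simps(2))
qed

text \<open>Derivatives at a point are unique, so any proven derivative \<open>f'\<close> may stand
  for the chosen \<open>frechet_derivative\<close>. The inductive closure rules below start by
  supplying such an \<open>f'\<close>.\<close>

lemma C_k_on_SucI:
  assumes "open S" "\<And>x. x \<in> S \<Longrightarrow> (f has_derivative f' x) (at x)" "\<And>v. C_k_on k S (\<lambda>x. f' x v)"
  shows "C_k_on (Suc k) S f"
proof -
  have "frechet_derivative f (at x) = f' x" if "x \<in> S" for x
    using frechet_derivative_at[OF assms(2)[OF that]] by simp
  then have "C_k_on k S (\<lambda>x. frechet_derivative f (at x) v)" for v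
    using assms(3)[of v] C_k_on_cong[OF assms(1), of "\<lambda>x. frechet_derivative f (at x) v" "\<lambda>x. f' x v" k]
    by simp
  then show ?thesis using assms(2) by (auto simp: differentiable_def)
qed

lemma C_k_on_Suc_has_derivative:
  "C_k_on (Suc k) S f \<Longrightarrow> x \<in> S \<Longrightarrow> (f has_derivative frechet_derivative f (at x)) (at x)"
  by (simp add: frechet_derivative_works[symmetric])

lemma C_k_on_const: "open S \<Longrightarrow> C_k_on k S (\<lambda>x. c)"
proof (induction k arbitrary: c)
  case (Suc k)
  show ?case by (rule C_k_on_SucI[where f' = "\<lambda>x v. 0"]) (use Suc in auto)
qed simp

lemma C_k_on_bounded_linear:
  assumes "open S" "bounded_linear h" "C_k_on k S f"
  shows "C_k_on k S (\<lambda>x. h (f x))"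
  using assms(3)
proof (induction k arbitrary: f)
  case 0
  then show ?case using assms(2) by (auto intro: bounded_linear.continuous_on)
next
  case (Suc k)
  show ?case
  proof (rule C_k_on_SucI[where f' = "\<lambda>x v. h (frechet_derivative f (at x) v)"])
    show "((\<lambda>x. h (f x)) has_derivative (\<lambda>v. h (frechet_derivative f (at x) v))) (at x)" if "x \<in> S" for x
      by (rule bounded_linear.has_derivative[OF assms(2) C_k_on_Suc_has_derivative[OF Suc.prems that]])
    show "C_k_on k S (\<lambda>x. h (frechet_derivative f (at x) v))" for v
      by (rule Suc.IH) (use Suc.prems in simp)
  qed (fact assms)
qed

lemma C_k_on_add:
  assumes "open S" "C_k_on k S f" "C_k_on k S g"
  shows "C_k_on k S (\<lambda>x. f x + g x)"
  using assms(2,3)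
proof (induction k arbitrary: f g)
  case 0
  then show ?case by (auto intro: continuous_on_add)
next
  case (Suc k)
  show ?case
  proof (rule C_k_on_SucI[where f' = "\<lambda>x v. frechet_derivative f (at x) v + frechet_derivative g (at x) v"])
    show "((\<lambda>x. f x + g x) has_derivative
        (\<lambda>v. frechet_derivative f (at x) v + frechet_derivative g (at x) v)) (at x)" if "x \<in> S" for x
      using Suc.prems that by (intro has_derivative_add C_k_on_Suc_has_derivative)
    show "C_k_on k S (\<lambda>x. frechet_derivative f (at x) v + frechet_derivative g (at x) v)" for v
      by (rule Suc.IH) (use Suc.prems in simp_all)
  qed (fact assms)
qed

lemma C_k_on_sum:
  assumes "open S" "\<And>i. i \<in> I \<Longrightarrow> C_k_on k S (f i)"
  shows "C_k_on k S (\<lambda>x. \<Sum>i\<in>I. f i x)"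
  using assms(2) by (induction I rule: infinite_finite_induct) (auto intro: C_k_on_add C_k_on_const assms)

lemma C_k_on_bilinear:
  assumes "open S" "bounded_bilinear h" "C_k_on k S f" "C_k_on k S g"
  shows "C_k_on k S (\<lambda>x. h (f x) (g x))"
  using assms(3,4)
proof (induction k arbitrary: f g)
  case 0
  then show ?case using assms(2) by (auto intro: bounded_bilinear.continuous_on)
next
  case (Suc k)
  \<comment> \<open>The product rule pairs a derivative with the other factor undifferentiated, so
    the induction hypothesis needs \<open>f\<close> and \<open>g\<close> themselves at order
    k.\<close>
  have f: "C_k_on k S f" and g: "C_k_on k S g" using Suc.prems C_k_on_SucD by blast+
  show ?case
  proof (rule C_k_on_SucI[where f' = "\<lambda>x v. h (f x) (frechet_derivative g (at x) v) + h (frechet_derivative f (at x) v) (g x)"])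
    show "((\<lambda>x. h (f x) (g x)) has_derivative
        (\<lambda>v. h (f x) (frechet_derivative g (at x) v) + h (frechet_derivative f (at x) v) (g x))) (at x)"
      if "x \<in> S" for x
      using bounded_bilinear.FDERIV[OF assms(2) C_k_on_Suc_has_derivative[OF Suc.prems(1) that]
          C_k_on_Suc_has_derivative[OF Suc.prems(2) that]] .
    show "C_k_on k S (\<lambda>x. h (f x) (frechet_derivative g (at x) v) + h (frechet_derivative f (at x) v) (g x))" for v
      using Suc.prems by (intro C_k_on_add[OF assms(1)] Suc.IH f g) auto
  qed (fact assms)
qed

text \<open>The chain rule applies a varying linear map to a varying vector, while
  \<open>C_k_on\<close> speaks of derivatives in fixed directions only. Expanding the inner
  derivative in \<open>Basis\<close> turns each term into a product whose second factor is again a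
  composition with \<open>g\<close>, of lower order.\<close>

lemma C_k_on_compose:
  fixes f :: "'a::euclidean_space \<Rightarrow> 'b::real_normed_vector" and g :: "'c::euclidean_space \<Rightarrow> 'a"
  assumes "open S" "open T" "g ` S \<subseteq> T" "C_k_on k T f" "C_k_on k S g"
  shows "C_k_on k S (\<lambda>x. f (g x))"
  using assms(4,5)
proof (induction k arbitrary: f)
  case 0
  then show ?case using assms(3) by (auto intro: continuous_on_compose2)
next
  case (Suc k)
  let ?f' = "\<lambda>x v. \<Sum>b\<in>Basis. (frechet_derivative g (at x) v \<bullet> b) *\<^sub>R frechet_derivative f (at (g x)) b"
  show ?case
  proof (rule C_k_on_SucI[where f' = ?f'])
    fix x assume x: "x \<in> S"
    have f: "(f has_derivative frechet_derivative f (at (g x))) (at (g x))"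
      using C_k_on_Suc_has_derivative[OF Suc.prems(1)] x assms(3) by auto
    have g: "(g has_derivative frechet_derivative g (at x)) (at x)"
      using C_k_on_Suc_has_derivative[OF Suc.prems(2) x] .
    have "frechet_derivative f (at (g x)) u = (\<Sum>b\<in>Basis. (u \<bullet> b) *\<^sub>R frechet_derivative f (at (g x)) b)" for u
    proof -
      have "frechet_derivative f (at (g x)) (\<Sum>b\<in>Basis. (u \<bullet> b) *\<^sub>R b) =
          (\<Sum>b\<in>Basis. (u \<bullet> b) *\<^sub>R frechet_derivative f (at (g x)) b)"
        by (simp only: linear_sum[OF has_derivative_linear[OF f]] linear_cmul[OF has_derivative_linear[OF f]])
      then show ?thesis unfolding euclidean_representation .
    qed
    then have "(\<lambda>v. frechet_derivative f (at (g x)) (frechet_derivative g (at x) v)) = ?f' x" by blast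
    then show "((\<lambda>x. f (g x)) has_derivative ?f' x) (at x)"
      using has_derivative_compose[OF g f] by metis
  next
    fix v
    have g: "C_k_on k S g" using Suc.prems C_k_on_SucD by blast
    show "C_k_on k S (\<lambda>x. ?f' x v)"
    proof (intro C_k_on_sum[OF assms(1)] C_k_on_bilinear[OF assms(1) bounded_bilinear_scaleR])
      fix b :: 'a
      show "C_k_on k S (\<lambda>x. frechet_derivative g (at x) v \<bullet> b)"
        using Suc.prems(2) by (intro C_k_on_bounded_linear[OF assms(1) bounded_linear_inner_left]) simp
      show "C_k_on k S (\<lambda>x. frechet_derivative f (at (g x)) b)"
        using Suc.prems(1) by (intro Suc.IH[OF _ g]) simp
    qed
  qed (fact assms)
qed

text \<open>The factor \<open>c\<close> and the exponent \<open>a\<close> are general because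
  differentiation stays within this family and changes both. The case needed later is a = -1/2, for
  normalising vector fields.\<close>

lemma C_k_on_powr: "C_k_on k {0<..} (\<lambda>x. c * x powr a :: real)"
proof (induction k arbitrary: c a)
  case 0
  have "continuous_on {0<..} (\<lambda>x::real. c * x powr a)"
    by (intro continuous_intros) auto
  then show ?case by simp
next
  case (Suc k)
  show ?case
  proof (rule C_k_on_SucI[where f' = "\<lambda>x v. (c * a * v) * x powr (a - 1)"])
    fix x :: real assume "x \<in> {0<..}"
    then have "((\<lambda>x. c * x powr a) has_real_derivative (c * (a * x powr (a - 1)))) (at x)"
      by (intro DERIV_cmult has_real_derivative_powr) auto
    then show "((\<lambda>x. c * x powr a) has_derivative (\<lambda>v. c * a * v * x powr (a - 1))) (at x)"
      unfolding has_field_derivative_def by (rule has_derivative_eq_rhs) (simp add: fun_eq_iff mult_ac)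
  next
    show "C_k_on k {0<..} (\<lambda>x. c * a * v * x powr (a - 1))" for v by (rule Suc)
  qed simp
qed

section \<open>Closure rules for smooth maps\<close>

lemma smooth_on_cong:
  "open S \<Longrightarrow> (\<And>x. x \<in> S \<Longrightarrow> f x = g x) \<Longrightarrow> smooth_on S f \<longleftrightarrow> smooth_on S g"
  using C_k_on_cong[of S f g] by (simp add: smooth_on_def)

lemma smooth_on_subset: "smooth_on S f \<Longrightarrow> T \<subseteq> S \<Longrightarrow> smooth_on T f"
  by (simp add: smooth_on_def C_k_on_subset[of _ S])

lemma smooth_on_imp_continuous_on: "smooth_on S f \<Longrightarrow> continuous_on S f"
  unfolding smooth_on_def by (metis C_k_on.simps(1))

lemma smooth_on_has_derivative:
  "smooth_on S f \<Longrightarrow> x \<in> S \<Longrightarrow> (f has_derivative frechet_derivative f (at x)) (at x)"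
  using C_k_on_Suc_has_derivative[of 0 S f x] unfolding smooth_on_def by metis

lemma smooth_on_frechet_derivative: "smooth_on S f \<Longrightarrow> smooth_on S (\<lambda>x. frechet_derivative f (at x) v)"
  unfolding smooth_on_def by (metis C_k_on.simps(2))

lemma smooth_on_const: "open S \<Longrightarrow> smooth_on S (\<lambda>x. c)"
  by (simp add: smooth_on_def C_k_on_const)

lemma smooth_on_bounded_linear:
  "open S \<Longrightarrow> bounded_linear h \<Longrightarrow> smooth_on S f \<Longrightarrow> smooth_on S (\<lambda>x. h (f x))"
  by (simp add: smooth_on_def C_k_on_bounded_linear)

lemma smooth_on_add: "open S \<Longrightarrow> smooth_on S f \<Longrightarrow> smooth_on S g \<Longrightarrow> smooth_on S (\<lambda>x. f x + g x)"
  by (simp add: smooth_on_def C_k_on_add)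

lemma smooth_on_sum:
  "open S \<Longrightarrow> (\<And>i. i \<in> I \<Longrightarrow> smooth_on S (f i)) \<Longrightarrow> smooth_on S (\<lambda>x. \<Sum>i\<in>I. f i x)"
  unfolding smooth_on_def by (simp add: C_k_on_sum)

lemma smooth_on_bilinear:
  "open S \<Longrightarrow> bounded_bilinear h \<Longrightarrow> smooth_on S f \<Longrightarrow> smooth_on S g \<Longrightarrow> smooth_on S (\<lambda>x. h (f x) (g x))"
  by (simp add: smooth_on_def C_k_on_bilinear)

lemmas smooth_on_mult = smooth_on_bilinear[OF _ bounded_bilinear_mult]
lemmas smooth_on_scaleR = smooth_on_bilinear[OF _ bounded_bilinear_scaleR]

lemma smooth_on_compose:
  "open S \<Longrightarrow> open T \<Longrightarrow> g ` S \<subseteq> T \<Longrightarrow> smooth_on T f \<Longrightarrow> smooth_on S g \<Longrightarrow> smooth_on S (\<lambda>x. f (g x))"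
  unfolding smooth_on_def using C_k_on_compose[of S T g _ f] by simp

lemma smooth_on_powr:
  fixes f :: "'a::euclidean_space \<Rightarrow> real"
  assumes "open S" "smooth_on S f" "\<And>x. x \<in> S \<Longrightarrow> f x > 0"
  shows "smooth_on S (\<lambda>x. f x powr a)"
proof -
  have "smooth_on {0<..} (\<lambda>x::real. x powr a)"
    unfolding smooth_on_def using C_k_on_powr[of _ 1 a] by simp
  moreover have "f ` S \<subseteq> {0<..}" using assms(3) by auto
  ultimately show ?thesis
    using smooth_on_compose[OF assms(1) open_greaterThan] assms(2) by blast
qed

section \<open>The Clifford algebra of one tangent space\<close>

lemma csmul_apply [simp]: "(c \<odot> \<phi>) ws = c * \<phi> ws"
  by (simp add: csmul_def)

lemma csmul_add_right: "c \<odot> (\<phi> + \<psi>) = c \<odot> \<phi> + c \<odot> \<psi>"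
  and csmul_csmul [simp]: "a \<odot> b \<odot> \<phi> = (a * b) \<odot> \<phi>"
  and csmul_one [simp]: "1 \<odot> \<phi> = \<phi>"
  and csmul_minus_one [simp]: "(- 1) \<odot> \<phi> = - \<phi>"
  and csmul_zero_left [simp]: "0 \<odot> \<phi> = 0"
  and csmul_zero_right [simp]: "c \<odot> 0 = (0 :: 'e form)"
  and csmul_minus_right: "c \<odot> (- \<phi>) = - (c \<odot> \<phi>)"
  and csmul_minus_left: "(- c) \<odot> \<phi> = - (c \<odot> \<phi>)"
  and csmul_diff_left: "(a - b) \<odot> \<phi> = a \<odot> \<phi> - b \<odot> \<phi>"
  and csmul_diff_right: "c \<odot> (\<phi> - \<psi>) = c \<odot> \<phi> - c \<odot> \<psi>"
  by (auto simp: fun_eq_iff algebra_simps)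

lemma sum_fun_apply: "(\<Sum>i\<in>I. f i) x = (\<Sum>i\<in>I. f i x)"
  by (induction I rule: infinite_finite_induct) auto

lemma csmul_sum_right: "c \<odot> (\<Sum>i\<in>I. f i) = (\<Sum>i\<in>I. c \<odot> f i)"
  by (auto simp: fun_eq_iff sum_fun_apply sum_distrib_left)

lemma forms_linear: "\<phi> \<in> forms \<Longrightarrow> linear (\<lambda>w. \<phi> (xs @ w # ys))"
  and forms_alternating: "\<phi> \<in> forms \<Longrightarrow> \<phi> (xs @ w # ys @ w # zs) = 0"
  by (auto simp: forms_def)

text \<open>Polarising the vanishing on adjacent equal arguments gives antisymmetry under adjacent
  swaps, and swaps bring any two equal arguments together.\<close>

lemma formsI:
  assumes lin: "\<And>xs ys. linear (\<lambda>w. \<phi> (xs @ w # ys))"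
    and alt: "\<And>xs w ys. \<phi> (xs @ w # w # ys) = 0"
  shows "\<phi> \<in> forms"
proof -
  have swap: "\<phi> (xs @ a # b # ys) = - \<phi> (xs @ b # a # ys)" for xs a b ys
  proof -
    have "\<phi> (xs @ (a + b) # (a + b) # ys) = 0" by (rule alt)
    then have "\<phi> (xs @ a # b # ys) + \<phi> (xs @ b # a # ys) = 0"
      using linear_add[OF lin[of xs "(a + b) # ys"], of a b]
        linear_add[OF lin[of "xs @ [a]" ys], of a b] linear_add[OF lin[of "xs @ [b]" ys], of a b]
        alt[of xs a] alt[of xs b] by (simp add: add.commute)
    then show ?thesis by (simp add: add_eq_0_iff2)
  qed
  have "\<phi> (xs @ w # ys @ w # zs) = 0" for xs w ys zs
  proof (induction ys arbitrary: xs)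
    case (Cons y ys)
    then show ?case using swap[of xs w y "ys @ w # zs"] Cons[of "xs @ [y]"] by simp
  qed (use alt in simp)
  then show ?thesis using lin by (simp add: forms_def)
qed

lemma forms_add: "\<phi> \<in> forms \<Longrightarrow> \<psi> \<in> forms \<Longrightarrow> \<phi> + \<psi> \<in> forms"
  by (auto simp: forms_def intro: linear_compose_add)

lemma forms_csmul: "\<phi> \<in> forms \<Longrightarrow> c \<odot> \<phi> \<in> forms"
  by (auto simp: forms_def linear_iff algebra_simps)

lemma forms_0: "0 \<in> forms"
  by (auto simp: forms_def linear_iff)

lemma forms_minus: "\<phi> \<in> forms \<Longrightarrow> - \<phi> \<in> forms"
  using forms_csmul[of \<phi> "-1"] by simp

lemma forms_diff: "\<phi> \<in> forms \<Longrightarrow> \<psi> \<in> forms \<Longrightarrow> \<phi> - \<psi> \<in> forms"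
  using forms_add[of \<phi> "- \<psi>"] forms_minus[of \<psi>] by simp

lemma forms_sum: "(\<And>i. i \<in> I \<Longrightarrow> f i \<in> forms) \<Longrightarrow> (\<Sum>i\<in>I. f i) \<in> forms"
  by (induction I rule: infinite_finite_induct) (auto intro: forms_add forms_0)

lemma forms_one: "one_form0 \<in> forms"
  by (auto simp: forms_def one_form0_def linear_iff)

lemma forms_contraction: "\<phi> \<in> forms \<Longrightarrow> contraction u \<phi> \<in> forms"
  using forms_linear[of \<phi> "u # _"] forms_alternating[of \<phi> "u # _"]
  by (auto simp: forms_def contraction_def)

lemmas forms_closed = forms_add forms_csmul forms_0 forms_minus forms_diff forms_sum forms_one forms_contraction

lemma contraction_add_left: "\<phi> \<in> forms \<Longrightarrow> contraction (u + v) \<phi> = contraction u \<phi> + contraction v \<phi>"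
  using linear_add[OF forms_linear[of \<phi> "[]"]] by (auto simp: contraction_def)

lemma contraction_scaleR_left: "\<phi> \<in> forms \<Longrightarrow> contraction (r *\<^sub>R u) \<phi> = complex_of_real r \<odot> contraction u \<phi>"
  using linear_cmul[OF forms_linear[of \<phi> "[]"]] by (auto simp: contraction_def scaleR_conv_of_real)

lemma contraction_contraction: "\<phi> \<in> forms \<Longrightarrow> contraction u (contraction v \<phi>) = - contraction v (contraction u \<phi>)"
  unfolding contraction_def fun_eq_iff using forms_swap[of \<phi> "[]" v u] by simp

lemma contraction_self: "\<phi> \<in> forms \<Longrightarrow> contraction u (contraction u \<phi>) = 0"
  using forms_alternating[of \<phi> "[]" u "[]"] by (auto simp: contraction_def fun_eq_iff)

lemma contraction_add [simp]: "contraction u (\<phi> + \<psi>) = contraction u \<phi> + contraction u \<psi>"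
  and contraction_diff [simp]: "contraction u (\<phi> - \<psi>) = contraction u \<phi> - contraction u \<psi>"
  and contraction_minus [simp]: "contraction u (- \<phi>) = - contraction u \<phi>"
  and contraction_csmul [simp]: "contraction u (c \<odot> \<phi>) = c \<odot> contraction u \<phi>"
  by (auto simp: contraction_def)

lemma vwedge_Nil [simp]: "vwedge G v \<phi> [] = 0"
  by (simp add: vwedge_def)

text \<open>The term i = 0 is split off; in the others the index drops by one, which costs a sign.
  This makes contraction an antiderivation and lets identities be proved by induction on the
  argument list.\<close>

lemma vwedge_Cons: "vwedge G v \<phi> (x # ws) = complex_of_real (G v x) * \<phi> ws - vwedge G v (contraction x \<phi>) ws"
  by (simp add: vwedge_def sum.lessThan_Suc_shift remove_nth_def contraction_def sum_negf del: sum.lessThan_Suc)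

lemma contraction_vwedge: "contraction u (vwedge G v \<phi>) = complex_of_real (G v u) \<odot> \<phi> - vwedge G v (contraction u \<phi>)"
  by (auto simp: contraction_def[of _ "vwedge _ _ _"] vwedge_Cons)

lemma vwedge_add [simp]: "vwedge G v (\<phi> + \<psi>) = vwedge G v \<phi> + vwedge G v \<psi>"
  and vwedge_diff [simp]: "vwedge G v (\<phi> - \<psi>) = vwedge G v \<phi> - vwedge G v \<psi>"
  and vwedge_minus [simp]: "vwedge G v (- \<phi>) = - vwedge G v \<phi>"
  and vwedge_csmul [simp]: "vwedge G v (c \<odot> \<phi>) = c \<odot> vwedge G v \<phi>"
  by (auto simp: vwedge_def fun_eq_iff algebra_simps sum.distrib sum_subtractf sum_negf sum_distrib_left)

lemma vwedge_zero [simp]: "vwedge G v 0 = 0"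
  by (simp add: vwedge_def fun_eq_iff)

text \<open>
  Two forms are compared by their empty component and their contractions with all vectors, which
  reduces identities for \<^const>\<open>vwedge\<close> to the formula for \<open>contraction u (vwedge G v \<phi>)\<close>.
\<close>

lemma vwedge_vwedge: "vwedge G u (vwedge G v \<phi>) = - vwedge G v (vwedge G u \<phi>)"
proof -
  have "vwedge G u (vwedge G v \<phi>) ws + vwedge G v (vwedge G u \<phi>) ws = 0" for ws
  proof (induction ws arbitrary: \<phi>)
    case (Cons x ws)
    then show ?case using Cons[of "contraction x \<phi>"] by (simp add: vwedge_Cons contraction_vwedge algebra_simps)
  qed simp
  then show ?thesis by (auto simp: fun_eq_iff add_eq_0_iff2)
qed

text \<open>Induction on the arguments in front of the slot: by \<open>vwedge_Cons\<close> a front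
  argument \<open>x\<close> replaces \<open>\<phi>\<close> by \<open>contraction x \<phi>\<close>,
  hence the generalisation over \<open>\<phi>\<close>. With nothing in front, two equal arguments
  produce two terms that cancel and a double contraction that vanishes.\<close>

lemma forms_vwedge:
  assumes G: "inner_product G" and \<phi>: "\<phi> \<in> forms"
  shows "vwedge G v \<phi> \<in> forms"
proof (rule formsI)
  have G': "linear (G v)" using G by (simp add: inner_product_def)
  have app: "linear (\<lambda>w. contraction w \<psi> ws)" if "\<psi> \<in> forms" for \<psi> :: "'a form" and ws
    using forms_linear[OF that, of "[]" ws] by (simp add: contraction_def)
  have wapp: "linear (\<lambda>w. vwedge G v (contraction w \<psi>) ws)" if "\<psi> \<in> forms" for \<psi> :: "'a form" and ws
    using that by (auto simp: linear_iff contraction_add_left contraction_scaleR_left scaleR_conv_of_real)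
  show "linear (\<lambda>w. vwedge G v \<phi> (xs @ w # ys))" for xs ys
    using \<phi>
  proof (induction xs arbitrary: \<phi>)
    case Nil
    show ?case using wapp[OF Nil] G'
      by (auto simp: vwedge_Cons linear_iff algebra_simps scaleR_conv_of_real)
  next
    case (Cons x xs)
    show ?case using forms_linear[OF Cons.prems, of xs ys] Cons.IH[OF forms_contraction[OF Cons.prems]]
      by (auto simp: vwedge_Cons linear_iff algebra_simps scaleR_conv_of_real)
  qed
  show "vwedge G v \<phi> (xs @ w # w # ys) = 0" for xs w ys
    using \<phi>
  proof (induction xs arbitrary: \<phi>)
    case Nil
    then show ?case using contraction_self[OF Nil, of w] by (simp add: vwedge_Cons contraction_def[of _ \<phi>])
  next
    case (Cons x xs)
    then show ?case
      using forms_alternating[OF Cons.prems, of xs w "[]" ys] forms_contraction[OF Cons.prems]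
      by (simp add: vwedge_Cons)
  qed
qed

lemma vwedge_add_left: "inner_product G \<Longrightarrow> vwedge G (u + v) \<phi> = vwedge G u \<phi> + vwedge G v \<phi>"
  and vwedge_scaleR_left: "inner_product G \<Longrightarrow> vwedge G (r *\<^sub>R v) \<phi> = complex_of_real r \<odot> vwedge G v \<phi>"
proof -
  assume G: "inner_product G"
  have *: "G (u + v) w = G u w + G v w" "G (r *\<^sub>R v) w = r * G v w" for u v w r
    using G linear_add[of "G w" u v] linear_cmul[of "G w" r v] by (simp_all add: inner_product_def)
  show "vwedge G (u + v) \<phi> = vwedge G u \<phi> + vwedge G v \<phi>"
    "vwedge G (r *\<^sub>R v) \<phi> = complex_of_real r \<odot> vwedge G v \<phi>"
    by (auto simp: vwedge_def fun_eq_iff * algebra_simps sum.distrib sum_distrib_left)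
qed

subsection \<open>Left and right multiplication by vectors\<close>

text \<open>The parity involution of the exterior algebra.\<close>

definition grade_sign :: "'e form \<Rightarrow> 'e form" where
  "grade_sign \<phi> = (\<lambda>ws. (-1) ^ length ws * \<phi> ws)"

definition left_mult :: "('e \<Rightarrow> 'e \<Rightarrow> real) \<Rightarrow> 'e \<Rightarrow> 'e form \<Rightarrow> 'e form" where
  "left_mult G v \<phi> = vwedge G v \<phi> - contraction v \<phi>"

text \<open>On a form of degree \<open>k\<close>, the product \<open>\<phi> \<cdot> v\<close> is \<open>(-1) ^ k (v \<and> \<phi> + v \<lrcorner> \<phi>)\<close>.\<close>

definition right_mult :: "('e \<Rightarrow> 'e \<Rightarrow> real) \<Rightarrow> 'e \<Rightarrow> 'e form \<Rightarrow> 'e form" where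
  "right_mult G v \<phi> = vwedge G v (grade_sign \<phi>) + contraction v (grade_sign \<phi>)"

lemma grade_sign_add [simp]: "grade_sign (\<phi> + \<psi>) = grade_sign \<phi> + grade_sign \<psi>"
  and grade_sign_diff [simp]: "grade_sign (\<phi> - \<psi>) = grade_sign \<phi> - grade_sign \<psi>"
  and grade_sign_minus [simp]: "grade_sign (- \<phi>) = - grade_sign \<phi>"
  and grade_sign_csmul [simp]: "grade_sign (c \<odot> \<phi>) = c \<odot> grade_sign \<phi>"
  by (auto simp: grade_sign_def fun_eq_iff algebra_simps)

lemma grade_sign_contraction: "grade_sign (contraction v \<phi>) = - contraction v (grade_sign \<phi>)"
  by (auto simp: grade_sign_def contraction_def)

lemma grade_sign_vwedge: "grade_sign (vwedge G v \<phi>) = - vwedge G v (grade_sign \<phi>)"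
proof
  fix ws
  show "grade_sign (vwedge G v \<phi>) ws = (- vwedge G v (grade_sign \<phi>)) ws"
  proof (cases ws)
    case (Cons x xs)
    then show ?thesis
      by (auto simp: grade_sign_def vwedge_def remove_nth_def sum_distrib_left sum_negf[symmetric] min_def
            intro!: sum.cong simp del: sum.lessThan_Suc)
  qed (simp add: grade_sign_def)
qed

lemma forms_grade_sign: "\<phi> \<in> forms \<Longrightarrow> grade_sign \<phi> \<in> forms"
  by (auto simp: forms_def grade_sign_def linear_iff algebra_simps)

lemma forms_left_mult: "inner_product G \<Longrightarrow> \<phi> \<in> forms \<Longrightarrow> left_mult G v \<phi> \<in> forms"
  and forms_right_mult: "inner_product G \<Longrightarrow> \<phi> \<in> forms \<Longrightarrow> right_mult G v \<phi> \<in> forms"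
  by (simp_all add: left_mult_def right_mult_def forms_closed forms_vwedge forms_grade_sign)

lemma left_mult_add [simp]: "left_mult G v (\<phi> + \<psi>) = left_mult G v \<phi> + left_mult G v \<psi>"
  and left_mult_diff [simp]: "left_mult G v (\<phi> - \<psi>) = left_mult G v \<phi> - left_mult G v \<psi>"
  and left_mult_minus [simp]: "left_mult G v (- \<phi>) = - left_mult G v \<phi>"
  and left_mult_csmul [simp]: "left_mult G v (c \<odot> \<phi>) = c \<odot> left_mult G v \<phi>"
  and right_mult_add [simp]: "right_mult G v (\<phi> + \<psi>) = right_mult G v \<phi> + right_mult G v \<psi>"
  and right_mult_diff [simp]: "right_mult G v (\<phi> - \<psi>) = right_mult G v \<phi> - right_mult G v \<psi>"
  and right_mult_minus [simp]: "right_mult G v (- \<phi>) = - right_mult G v \<phi>"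
  and right_mult_csmul [simp]: "right_mult G v (c \<odot> \<phi>) = c \<odot> right_mult G v \<phi>"
  by (auto simp: left_mult_def right_mult_def csmul_diff_right csmul_add_right)

lemma left_mult_add_left:
    "inner_product G \<Longrightarrow> \<phi> \<in> forms \<Longrightarrow> left_mult G (u + v) \<phi> = left_mult G u \<phi> + left_mult G v \<phi>"
  and left_mult_scaleR_left:
    "inner_product G \<Longrightarrow> \<phi> \<in> forms \<Longrightarrow> left_mult G (r *\<^sub>R v) \<phi> = complex_of_real r \<odot> left_mult G v \<phi>"
  and right_mult_add_left:
    "inner_product G \<Longrightarrow> \<phi> \<in> forms \<Longrightarrow> right_mult G (u + v) \<phi> = right_mult G u \<phi> + right_mult G v \<phi>"
  and right_mult_scaleR_left:
    "inner_product G \<Longrightarrow> \<phi> \<in> forms \<Longrightarrow> right_mult G (r *\<^sub>R v) \<phi> = complex_of_real r \<odot> right_mult G v \<phi>"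
  by (simp_all add: left_mult_def right_mult_def vwedge_add_left vwedge_scaleR_left contraction_add_left
      contraction_scaleR_left forms_grade_sign csmul_diff_right csmul_add_right)

lemma inner_product_sym: "inner_product G \<Longrightarrow> G u v = G v u"
  by (simp add: inner_product_def)

text \<open>Wedges anticommute, contractions anticommute, and each of the two orders of a mixed
  product leaves one -G u v by \<open>contraction_vwedge\<close>.\<close>

lemma left_mult_anticommute:
  assumes "inner_product G" "\<phi> \<in> forms"
  shows "left_mult G u (left_mult G v \<phi>) + left_mult G v (left_mult G u \<phi>) = complex_of_real (- 2 * G u v) \<odot> \<phi>"
  using vwedge_vwedge[of G u v \<phi>] contraction_contraction[OF assms(2), of u v] inner_product_sym[OF assms(1), of u v]
  by (simp add: left_mult_def contraction_vwedge algebra_simps)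
     (auto simp: fun_eq_iff algebra_simps)

text \<open>Wedge plus contraction squares to +G u u; moving \<open>grade_sign\<close>, which
  anticommutes with both and squares to 1, past the second factor turns the sign into the same minus
  as on the left.\<close>

lemma right_mult_anticommute:
  assumes "inner_product G" "\<phi> \<in> forms"
  shows "right_mult G u (right_mult G v \<phi>) + right_mult G v (right_mult G u \<phi>) = complex_of_real (- 2 * G u v) \<odot> \<phi>"
proof -
  have "grade_sign (grade_sign \<phi>) = \<phi>"
    by (auto simp: grade_sign_def fun_eq_iff simp flip: mult.assoc power_mult_distrib)
  then show ?thesis
    using vwedge_vwedge[of G u v \<phi>] contraction_contraction[OF assms(2), of u v] inner_product_sym[OF assms(1), of u v]
    by (simp add: right_mult_def contraction_vwedge grade_sign_vwedge grade_sign_contraction algebra_simps)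
       (auto simp: fun_eq_iff algebra_simps)
qed

text \<open>Wedge minus contraction by u anticommutes with wedge plus contraction by v, since the
  two mixed terms G u v enter with opposite signs; \<open>grade_sign\<close> contributes one more
  sign and makes the operators commute.\<close>

lemma left_right_mult_commute:
  assumes "inner_product G" "\<phi> \<in> forms"
  shows "left_mult G u (right_mult G v \<phi>) = right_mult G v (left_mult G u \<phi>)"
  using vwedge_vwedge[of G u v "grade_sign \<phi>"] contraction_contraction[OF forms_grade_sign[OF assms(2)], of u v]
    inner_product_sym[OF assms(1), of u v]
  by (simp add: left_mult_def right_mult_def contraction_vwedge grade_sign_vwedge grade_sign_contraction algebra_simps)

lemma left_mult_one: "left_mult G v one_form0 = flat G v"
  and right_mult_one: "right_mult G v one_form0 = flat G v"
proof -
  have gs: "grade_sign one_form0 = (one_form0 :: 'a form)"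
    by (auto simp: grade_sign_def one_form0_def)
  have c: "contraction v one_form0 = 0" by (auto simp: contraction_def one_form0_def)
  have w: "vwedge G v one_form0 = flat G v"
  proof
    fix ws show "vwedge G v one_form0 ws = flat G v ws"
    proof (cases ws)
      case (Cons x xs)
      have "contraction x one_form0 = (0 :: 'a form)" by (auto simp: contraction_def one_form0_def)
      then show ?thesis using Cons by (auto simp: vwedge_Cons flat_def one_form0_def split: list.splits)
    qed (simp add: flat_def)
  qed
  show "left_mult G v one_form0 = flat G v" "right_mult G v one_form0 = flat G v"
    by (simp_all add: left_mult_def right_mult_def gs c w)
qed

lemma forms_flat: "inner_product G \<Longrightarrow> flat G v \<in> forms"
  using forms_left_mult[OF _ forms_one] by (metis left_mult_one)

lemmas form_apply = plus_fun_apply zero_fun_apply minus_apply uminus_apply csmul_apply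

text \<open>Pointwise evaluation would rewrite inside eta-expanded forms.\<close>

declare form_apply [simp del]

section \<open>Sums, degree decomposition and induction on forms\<close>

lemma sum_closed:
  fixes f :: "'i \<Rightarrow> 'b::comm_monoid_add"
  assumes "Q 0" "\<And>x y. Q x \<Longrightarrow> Q y \<Longrightarrow> Q (x + y)" "\<And>i. i \<in> I \<Longrightarrow> Q (f i)"
  shows "Q (\<Sum>i\<in>I. f i)"
  using assms(3) by (induction I rule: infinite_finite_induct) (simp_all add: assms(1,2))

text \<open>Additivity is assumed on a subset \<open>C\<close> only, because the operators chosen on
  forms are constrained on \<open>forms\<close> alone.\<close>

lemma sum_additive_on:
  fixes f :: "'i \<Rightarrow> 'b::comm_monoid_add" and T :: "'b \<Rightarrow> 'c::comm_monoid_add"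
  assumes "T 0 = 0" "0 \<in> C" "\<And>x y. x \<in> C \<Longrightarrow> y \<in> C \<Longrightarrow> x + y \<in> C"
    and "\<And>x y. x \<in> C \<Longrightarrow> y \<in> C \<Longrightarrow> T (x + y) = T x + T y" "\<And>i. i \<in> I \<Longrightarrow> f i \<in> C"
  shows "T (\<Sum>i\<in>I. f i) = (\<Sum>i\<in>I. T (f i))"
  using assms(5)
proof (induction I rule: infinite_finite_induct)
  case (insert i I)
  then have "(\<Sum>i\<in>I. f i) \<in> C" by (intro sum_closed[where Q = "\<lambda>x. x \<in> C"] assms(2,3)) auto
  then show ?case using insert by (simp add: assms(4))
qed (simp_all add: assms(1))

text \<open>More arguments than the dimension are repeated or dependent. In the second case one
  argument lies in the span of the others; by linearity in its slot it may be replaced by each of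
  those, which repeats an argument.\<close>

lemma forms_eq_0_if_too_long:
  fixes \<phi> :: "'e::euclidean_space form"
  assumes \<phi>: "\<phi> \<in> forms" and len: "length ws > DIM('e)"
  shows "\<phi> ws = 0"
proof (cases "distinct ws")
  case False
  then obtain xs ys zs y where "ws = xs @ [y] @ ys @ [y] @ zs"
    using not_distinct_decomp by blast
  then show ?thesis using forms_alternating[OF \<phi>] by simp
next
  case True
  then have "card (set ws) > DIM('e)" using len by (simp add: distinct_card)
  then have "dependent (set ws)" using independent_bound by fastforce
  then obtain a where a: "a \<in> set ws" "a \<in> span (set ws - {a})"
    unfolding dependent_def by blast
  then obtain xs ys where ws: "ws = xs @ a # ys" by (meson split_list)
  have "\<phi> (xs @ w # ys) = 0" if "w \<in> set ws - {a}" for w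
  proof -
    consider "w \<in> set xs" | "w \<in> set ys" using \<open>w \<in> set ws - {a}\<close> ws by auto
    then show ?thesis
    proof cases
      case 1
      then obtain bs cs where "xs = bs @ w # cs" by (meson split_list)
      then show ?thesis using forms_alternating[OF \<phi>, of bs w cs ys] by simp
    next
      case 2
      then obtain bs cs where "ys = bs @ w # cs" by (meson split_list)
      then show ?thesis using forms_alternating[OF \<phi>, of xs w bs cs] by simp
    qed
  qed
  then show ?thesis using linear_eq_0_on_span[OF forms_linear[OF \<phi>] _ a(2)] ws by blast
qed

definition degree_part :: "nat \<Rightarrow> 'e form \<Rightarrow> 'e form" where
  "degree_part k \<phi> = (\<lambda>ws. if length ws = k then \<phi> ws else 0)"

lemma forms_degree_part: "\<phi> \<in> forms \<Longrightarrow> degree_part k \<phi> \<in> forms"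
  by (auto simp: forms_def degree_part_def linear_iff)

lemma sum_degree_part:
  fixes \<phi> :: "'e::euclidean_space form"
  assumes "\<phi> \<in> forms"
  shows "(\<Sum>k\<le>DIM('e). degree_part k \<phi>) = \<phi>"
  using forms_eq_0_if_too_long[OF assms] by (force simp: fun_eq_iff sum_fun_apply degree_part_def)

lemma degree_part_0: "degree_part 0 \<phi> = \<phi> [] \<odot> one_form0"
  by (auto simp: degree_part_def one_form0_def fun_eq_iff form_apply)

lemma contraction_degree_part: "contraction v (degree_part (Suc k) \<phi>) = degree_part k (contraction v \<phi>)"
  by (auto simp: contraction_def degree_part_def)

lemma contraction_sum_left:
  assumes "\<phi> \<in> forms"
  shows "contraction (\<Sum>i\<in>I. a i *\<^sub>R u i) \<phi> = (\<Sum>i\<in>I. complex_of_real (a i) \<odot> contraction (u i) \<phi>)"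
proof -
  have "contraction 0 \<phi> = 0" using contraction_scaleR_left[OF assms, of 0 0] by simp
  then have "contraction (\<Sum>i\<in>I. a i *\<^sub>R u i) \<phi> = (\<Sum>i\<in>I. contraction (a i *\<^sub>R u i) \<phi>)"
    using contraction_add_left[OF assms] by (intro sum_additive_on[where T = "\<lambda>u. contraction u \<phi>" and C = UNIV]) simp_all
  then show ?thesis by (simp add: contraction_scaleR_left[OF assms])
qed

text \<open>This is the number operator. Evaluated on a first argument \<open>x\<close>, the sum
  splits into the orthonormal expansion of \<open>x\<close> put into \<open>\<phi>\<close>, which
  gives one copy of \<open>\<phi> (x # ws)\<close>, and the same sum for
  \<open>contraction x \<phi>\<close> on the shorter list.\<close>

lemma sum_vwedge_contraction:
  fixes v :: "nat \<Rightarrow> 'e::euclidean_space"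
  assumes G: "inner_product G" and v: "orthonormal_basis G v" and \<phi>: "\<phi> \<in> forms"
  shows "(\<Sum>j<DIM('e). vwedge G (v j) (contraction (v j) \<phi>)) ws = of_nat (length ws) * \<phi> ws"
  using \<phi>
proof (induction ws arbitrary: \<phi>)
  case Nil
  show ?case by (simp add: sum_fun_apply form_apply)
next
  case (Cons x ws)
  have x: "(\<Sum>j<DIM('e). complex_of_real (G (v j) x) * contraction (v j) \<phi> ws) = \<phi> (x # ws)"
  proof -
    have "contraction x \<phi> = (\<Sum>j<DIM('e). complex_of_real (G x (v j)) \<odot> contraction (v j) \<phi>)"
      by (subst orthonormal_expand[OF G v, of x]) (rule contraction_sum_left[OF Cons.prems])
    then have "contraction x \<phi> ws = (\<Sum>j<DIM('e). complex_of_real (G x (v j)) * contraction (v j) \<phi> ws)"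
      by (simp add: sum_fun_apply form_apply)
    then show ?thesis by (simp add: inner_product_sym[OF G, of x] contraction_def)
  qed
  have "(\<Sum>j<DIM('e). vwedge G (v j) (contraction (v j) \<phi>)) (x # ws) =
      \<phi> (x # ws) + (\<Sum>j<DIM('e). vwedge G (v j) (contraction (v j) (contraction x \<phi>))) ws"
    using contraction_contraction[OF Cons.prems, of x]
    by (simp add: sum_fun_apply form_apply vwedge_Cons sum.distrib x)
  then show ?case
    using Cons.IH[OF forms_contraction[OF Cons.prems], of x] by (simp add: contraction_def algebra_simps)
qed

lemma sum_vwedge_contraction_degree_part:
  fixes v :: "nat \<Rightarrow> 'e::euclidean_space"
  assumes G: "inner_product G" and v: "orthonormal_basis G v" and \<phi>: "\<phi> \<in> forms"
  shows "(\<Sum>j<DIM('e). vwedge G (v j) (contraction (v j) (degree_part k \<phi>))) = of_nat k \<odot> degree_part k \<phi>"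
  using sum_vwedge_contraction[OF G v forms_degree_part[OF \<phi>]] by (auto simp: fun_eq_iff degree_part_def form_apply)

text \<open>The contraction half of \<open>left_mult\<close> dies because the same vector would be
  contracted twice, and the number operator remains.\<close>

lemma sum_left_mult_contraction:
  fixes v :: "nat \<Rightarrow> 'e::euclidean_space"
  assumes G: "inner_product G" and v: "orthonormal_basis G v" and \<phi>: "\<phi> \<in> forms"
  shows "(\<Sum>j<DIM('e). left_mult G (v j) (contraction (v j) (degree_part k \<phi>))) = of_nat k \<odot> degree_part k \<phi>"
  by (simp add: left_mult_def contraction_self forms_degree_part \<phi> sum_vwedge_contraction_degree_part[OF G v \<phi>])

text \<open>Here the vector multiplies a form of degree k - 1 from the right, so the parity sign is
  that of k - 1, written with \<open>Suc k\<close> to avoid truncated subtraction.\<close>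

lemma sum_right_mult_contraction:
  fixes v :: "nat \<Rightarrow> 'e::euclidean_space"
  assumes G: "inner_product G" and v: "orthonormal_basis G v" and \<phi>: "\<phi> \<in> forms"
  shows "(\<Sum>j<DIM('e). right_mult G (v j) (contraction (v j) (degree_part k \<phi>))) =
    ((-1) ^ Suc k * of_nat k) \<odot> degree_part k \<phi>"
proof -
  have gs: "grade_sign (degree_part k \<phi>) = (-1) ^ k \<odot> degree_part k \<phi>"
    by (auto simp: grade_sign_def degree_part_def fun_eq_iff form_apply)
  show ?thesis
    using arg_cong[OF sum_vwedge_contraction_degree_part[OF G v \<phi>, of k], of "\<lambda>\<psi>. (-1) ^ Suc k \<odot> \<psi>"]
    by (simp add: right_mult_def grade_sign_contraction contraction_self forms_degree_part \<phi> gs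
        csmul_sum_right csmul_minus_left sum_negf)
qed

text \<open>Solving the Euler identity \<open>euler\<close> for the degree part, possible since
  \<open>c (Suc k)\<close> is nonzero, exhibits a form of degree k + 1 as a combination of
  F-multiples of forms of degree k. Keeping \<open>F\<close> abstract serves left and right
  multiplication alike.\<close>

lemma forms_induct_aux:
  fixes v :: "nat \<Rightarrow> 'e::euclidean_space"
  assumes \<phi>: "\<phi> \<in> forms"
    and euler: "\<And>k \<phi>. \<phi> \<in> forms \<Longrightarrow>
      (\<Sum>j<DIM('e). F (v j) (contraction (v j) (degree_part k \<phi>))) = c k \<odot> degree_part k \<phi>"
    and c: "\<And>k. c (Suc k) \<noteq> 0"
    and F: "\<And>u \<phi>. \<phi> \<in> forms \<Longrightarrow> F u \<phi> \<in> forms"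
    and one: "Q one_form0"
    and add: "\<And>\<phi> \<psi>. \<phi> \<in> forms \<Longrightarrow> \<psi> \<in> forms \<Longrightarrow> Q \<phi> \<Longrightarrow> Q \<psi> \<Longrightarrow> Q (\<phi> + \<psi>)"
    and csmul: "\<And>a \<phi>. \<phi> \<in> forms \<Longrightarrow> Q \<phi> \<Longrightarrow> Q (a \<odot> \<phi>)"
    and mult: "\<And>u \<phi>. \<phi> \<in> forms \<Longrightarrow> Q \<phi> \<Longrightarrow> Q (F u \<phi>)"
  shows "Q \<phi>"
proof -
  have sum: "Q (\<Sum>i\<in>I. f i)" if "\<And>i. i \<in> I \<Longrightarrow> f i \<in> forms" "\<And>i. i \<in> I \<Longrightarrow> Q (f i)"
    for f :: "nat \<Rightarrow> 'e form" and I
    using sum_closed[of "\<lambda>\<phi>. \<phi> \<in> forms \<and> Q \<phi>" I f] that add csmul[OF forms_one one, of 0]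
    by (simp add: forms_closed)
  have "Q (degree_part k \<phi>)" if "\<phi> \<in> forms" for k \<phi>
    using that
  proof (induction k arbitrary: \<phi>)
    case 0
    show ?case using csmul[OF forms_one one] by (simp add: degree_part_0)
  next
    case (Suc k)
    let ?s = "\<Sum>j<DIM('e). F (v j) (contraction (v j) (degree_part (Suc k) \<phi>))"
    have eq: "degree_part (Suc k) \<phi> = (1 / c (Suc k)) \<odot> ?s"
      using c[of k] by (simp add: euler[OF Suc.prems])
    have "Q ?s"
      using Suc forms_contraction
      by (intro sum F mult forms_contraction forms_degree_part) (auto simp: contraction_degree_part)
    moreover have "?s \<in> forms"
      by (intro forms_sum F forms_contraction forms_degree_part Suc.prems)
    ultimately show ?case by (subst eq) (rule csmul)
  qed
  then have "Q (\<Sum>k\<le>DIM('e). degree_part k \<phi>)"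
    using \<phi> by (intro sum forms_degree_part) auto
  then show ?thesis by (simp add: sum_degree_part \<phi>)
qed

lemma forms_induct_left [consumes 3, case_names one add csmul left_mult]:
  fixes v :: "nat \<Rightarrow> 'e::euclidean_space"
  assumes "inner_product G" "orthonormal_basis G v" "\<phi> \<in> forms"
    and "Q one_form0"
    and "\<And>\<phi> \<psi>. \<phi> \<in> forms \<Longrightarrow> \<psi> \<in> forms \<Longrightarrow> Q \<phi> \<Longrightarrow> Q \<psi> \<Longrightarrow> Q (\<phi> + \<psi>)"
    and "\<And>a \<phi>. \<phi> \<in> forms \<Longrightarrow> Q \<phi> \<Longrightarrow> Q (a \<odot> \<phi>)"
    and "\<And>u \<phi>. \<phi> \<in> forms \<Longrightarrow> Q \<phi> \<Longrightarrow> Q (left_mult G u \<phi>)"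
  shows "Q \<phi>"
  by (rule forms_induct_aux[OF assms(3) sum_left_mult_contraction[OF assms(1,2)]])
     (use assms in \<open>simp_all add: forms_left_mult del: of_nat_Suc\<close>)

lemma forms_induct_right [consumes 3, case_names one add csmul right_mult]:
  fixes v :: "nat \<Rightarrow> 'e::euclidean_space"
  assumes "inner_product G" "orthonormal_basis G v" "\<phi> \<in> forms"
    and "Q one_form0"
    and "\<And>\<phi> \<psi>. \<phi> \<in> forms \<Longrightarrow> \<psi> \<in> forms \<Longrightarrow> Q \<phi> \<Longrightarrow> Q \<psi> \<Longrightarrow> Q (\<phi> + \<psi>)"
    and "\<And>a \<phi>. \<phi> \<in> forms \<Longrightarrow> Q \<phi> \<Longrightarrow> Q (a \<odot> \<phi>)"
    and "\<And>u \<phi>. \<phi> \<in> forms \<Longrightarrow> Q \<phi> \<Longrightarrow> Q (right_mult G u \<phi>)"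
  shows "Q \<phi>"
  by (rule forms_induct_aux[OF assms(3) sum_right_mult_contraction[OF assms(1,2)]])
     (use assms in \<open>simp_all add: forms_right_mult del: of_nat_Suc\<close>)

subsection \<open>The Clifford product\<close>

lemma clinear_formsI:
  assumes "\<And>\<phi>. \<phi> \<in> forms \<Longrightarrow> T \<phi> \<in> forms"
    and "\<And>\<phi> \<psi>. \<phi> \<in> forms \<Longrightarrow> \<psi> \<in> forms \<Longrightarrow> T (\<phi> + \<psi>) = T \<phi> + T \<psi>"
    and "\<And>c \<phi>. \<phi> \<in> forms \<Longrightarrow> T (c \<odot> \<phi>) = c \<odot> T \<phi>"
  shows "clinear_forms T"
  using assms by (simp add: clinear_forms_def)

lemma clinear_formsD:
  assumes "clinear_forms T" "\<phi> \<in> forms"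
  shows "T \<phi> \<in> forms" and "\<psi> \<in> forms \<Longrightarrow> T (\<phi> + \<psi>) = T \<phi> + T \<psi>" and "T (c \<odot> \<phi>) = c \<odot> T \<phi>"
  using assms by (simp_all add: clinear_forms_def)

lemma clinear_forms_minus: "clinear_forms T \<Longrightarrow> \<phi> \<in> forms \<Longrightarrow> T (- \<phi>) = - T \<phi>"
  using clinear_formsD(3)[of T \<phi> "-1"] by simp

lemma clinear_forms_diff:
  "clinear_forms T \<Longrightarrow> \<phi> \<in> forms \<Longrightarrow> \<psi> \<in> forms \<Longrightarrow> T (\<phi> - \<psi>) = T \<phi> - T \<psi>"
  using clinear_formsD(2)[of T \<phi> "- \<psi>"] clinear_forms_minus[of T \<psi>] by (simp add: forms_minus)

lemma clinear_forms_sum: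
  assumes "clinear_forms T" "\<And>i. i \<in> I \<Longrightarrow> f i \<in> forms"
  shows "T (\<Sum>i\<in>I. f i) = (\<Sum>i\<in>I. T (f i))"
proof -
  have "T 0 = 0" using clinear_formsD(3)[OF assms(1) forms_0, of 0] by simp
  then show ?thesis
    using assms by (intro sum_additive_on[where T = T and C = forms]) (simp_all add: forms_closed clinear_formsD)
qed

text \<open>
  An operator that commutes with all right multiplications is determined by its value at \<open>1\<close>, and
  every form is such a value.  The product of \<open>\<phi>\<close> and \<open>\<psi>\<close> is the operator belonging to \<open>\<phi>\<close>, applied to
  \<open>\<psi>\<close>; associativity is composition of operators.
\<close>

definition right_commutant :: "('e::euclidean_space \<Rightarrow> 'e \<Rightarrow> real) \<Rightarrow> ('e form \<Rightarrow> 'e form) set" where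
  "right_commutant G = {T. clinear_forms T \<and>
     (\<forall>u. \<forall>\<phi>\<in>forms. T (right_mult G u \<phi>) = right_mult G u (T \<phi>))}"

lemma right_commutant_unique:
  fixes v :: "nat \<Rightarrow> 'e::euclidean_space"
  assumes Gv: "inner_product G" "orthonormal_basis G v" and "S \<in> right_commutant G" "T \<in> right_commutant G"
    and "S one_form0 = T one_form0" and "\<phi> \<in> forms"
  shows "S \<phi> = T \<phi>"
  using Gv \<open>\<phi> \<in> forms\<close>
proof (induction rule: forms_induct_right)
qed (use assms in \<open>auto simp: right_commutant_def clinear_forms_def\<close>)

lemma right_commutant_surj:
  fixes v :: "nat \<Rightarrow> 'e::euclidean_space"
  assumes Gv: "inner_product G" "orthonormal_basis G v" and "\<phi> \<in> forms"
  shows "\<exists>T\<in>right_commutant G. T one_form0 = \<phi>"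
  using Gv \<open>\<phi> \<in> forms\<close>
proof (induction rule: forms_induct_left)
  case one
  show ?case by (intro bexI[of _ "\<lambda>\<phi>. \<phi>"]) (auto simp: right_commutant_def clinear_forms_def)
next
  case (add \<phi> \<psi>)
  then obtain S T where "S \<in> right_commutant G" "S one_form0 = \<phi>" "T \<in> right_commutant G" "T one_form0 = \<psi>"
    by blast
  then show ?case
    by (intro bexI[of _ "\<lambda>\<theta>. S \<theta> + T \<theta>"])
       (auto simp: right_commutant_def clinear_forms_def forms_add algebra_simps csmul_add_right)
next
  case (csmul a \<phi>)
  then obtain S where "S \<in> right_commutant G" "S one_form0 = \<phi>" by blast
  then show ?case
    by (intro bexI[of _ "\<lambda>\<theta>. a \<odot> S \<theta>"])
       (auto simp: right_commutant_def clinear_forms_def forms_csmul csmul_add_right mult.commute)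
next
  case (left_mult u \<phi>)
  then obtain S where "S \<in> right_commutant G" "S one_form0 = \<phi>" by blast
  then show ?case
    by (intro bexI[of _ "\<lambda>\<theta>. left_mult G u (S \<theta>)"])
       (auto simp: right_commutant_def clinear_forms_def forms_left_mult[OF Gv(1)] left_right_mult_commute[OF Gv(1)])
qed

lemma clifford_product_exists:
  fixes v :: "nat \<Rightarrow> 'e::euclidean_space"
  assumes Gv: "inner_product G" "orthonormal_basis G v"
  shows "\<exists>P. is_clifford_product G P"
proof -
  obtain T where T: "\<And>\<phi>. \<phi> \<in> forms \<Longrightarrow> T \<phi> \<in> right_commutant G" "\<And>\<phi>. \<phi> \<in> forms \<Longrightarrow> T \<phi> one_form0 = \<phi>"
    using right_commutant_surj[OF Gv] by metis
  have lin: "clinear_forms (T \<phi>)" if "\<phi> \<in> forms" for \<phi>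
    using T(1)[OF that] by (simp add: right_commutant_def)
  \<comment> \<open>Each axiom below is settled by naming an operator \<open>S\<close> in the
    commutant with the right value at \<open>one_form0\<close>.\<close>
  have unique: "T \<phi> \<psi> = S \<psi>" if "\<phi> \<in> forms" "\<psi> \<in> forms" "S \<in> right_commutant G" "S one_form0 = \<phi>" for \<phi> \<psi> S
    using right_commutant_unique[OF Gv T(1)[OF that(1)] that(3)] T(2)[OF that(1)] that by simp
  have "clinear_forms (\<lambda>\<phi>. T \<phi> \<psi>)" if \<psi>: "\<psi> \<in> forms" for \<psi>
  proof (rule clinear_formsI)
    fix \<phi> \<phi>' :: "'e form" and c assume f: "\<phi> \<in> forms" "\<phi>' \<in> forms"
    show "T (\<phi> + \<phi>') \<psi> = T \<phi> \<psi> + T \<phi>' \<psi>"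
      by (rule unique[where S = "\<lambda>\<theta>. T \<phi> \<theta> + T \<phi>' \<theta>"])
         (use f \<psi> T(1)[OF f(1)] T(1)[OF f(2)] in
          \<open>auto simp: right_commutant_def clinear_forms_def forms_add algebra_simps csmul_add_right T(2)\<close>)
  next
    fix \<phi> :: "'e form" and c assume f: "\<phi> \<in> forms"
    show "T (c \<odot> \<phi>) \<psi> = c \<odot> T \<phi> \<psi>"
      by (rule unique[where S = "\<lambda>\<theta>. c \<odot> T \<phi> \<theta>"])
         (use f \<psi> T(1)[OF f] in
          \<open>auto simp: right_commutant_def clinear_forms_def forms_csmul csmul_add_right T(2) mult.commute\<close>)
  qed (use clinear_formsD(1)[OF lin] \<psi> in simp)
  moreover have "T (T \<phi> \<psi>) \<theta> = T \<phi> (T \<psi> \<theta>)" if f: "\<phi> \<in> forms" "\<psi> \<in> forms" "\<theta> \<in> forms" for \<phi> \<psi> \<theta>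
    by (rule unique[where S = "\<lambda>\<theta>. T \<phi> (T \<psi> \<theta>)"])
       (use f T(1)[OF f(1)] T(1)[OF f(2)] in \<open>auto simp: right_commutant_def clinear_forms_def T(2)\<close>)
  moreover have "T one_form0 \<phi> = \<phi>" if f: "\<phi> \<in> forms" for \<phi>
    by (rule unique[where S = "\<lambda>\<theta>. \<theta>"]) (use f forms_one in \<open>auto simp: right_commutant_def clinear_forms_def\<close>)
  moreover have "T (flat G v) \<phi> = vwedge G v \<phi> - contraction v \<phi>" if f: "\<phi> \<in> forms" for \<phi> v
    by (subst unique[where S = "\<lambda>\<theta>. left_mult G v \<theta>"])
       (use f in \<open>auto simp: right_commutant_def clinear_forms_def forms_left_mult left_right_mult_commute
         left_mult_one forms_flat Gv\<close>, simp add: left_mult_def)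
  ultimately have "is_clifford_product G T"
    unfolding is_clifford_product_def using lin T(2) by blast
  then show ?thesis by blast
qed

text \<open>The basis \<open>v\<close> is part of the locale because the induction rules for forms
  require one; it is also the basis over which traces are taken.\<close>

locale clifford_space =
  fixes G :: "'e::euclidean_space \<Rightarrow> 'e \<Rightarrow> real" and v :: "nat \<Rightarrow> 'e"
  assumes inner: "inner_product G" and basis: "orthonormal_basis G v"
begin

lemma is_clifford_product_clifford: "is_clifford_product G (clifford G)"
  unfolding clifford_def by (rule someI_ex[OF clifford_product_exists[OF inner basis]])

lemma clifford_linear_right: "\<phi> \<in> forms \<Longrightarrow> clinear_forms (clifford G \<phi>)"
  and clifford_linear_left: "\<psi> \<in> forms \<Longrightarrow> clinear_forms (\<lambda>\<phi>. clifford G \<phi> \<psi>)"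
  and clifford_assoc: "\<phi> \<in> forms \<Longrightarrow> \<psi> \<in> forms \<Longrightarrow> \<theta> \<in> forms \<Longrightarrow>
    clifford G (clifford G \<phi> \<psi>) \<theta> = clifford G \<phi> (clifford G \<psi> \<theta>)"
  and clifford_one_left: "\<phi> \<in> forms \<Longrightarrow> clifford G one_form0 \<phi> = \<phi>"
  and clifford_one_right: "\<phi> \<in> forms \<Longrightarrow> clifford G \<phi> one_form0 = \<phi>"
  and clifford_flat_left: "\<phi> \<in> forms \<Longrightarrow> clifford G (flat G u) \<phi> = left_mult G u \<phi>"
  using is_clifford_product_clifford by (simp_all add: is_clifford_product_def left_mult_def)

lemma forms_clifford: "\<phi> \<in> forms \<Longrightarrow> \<psi> \<in> forms \<Longrightarrow> clifford G \<phi> \<psi> \<in> forms"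
  using clinear_formsD(1)[OF clifford_linear_right] .

lemma clifford_add_left: "\<phi> \<in> forms \<Longrightarrow> \<phi>' \<in> forms \<Longrightarrow> \<psi> \<in> forms \<Longrightarrow>
    clifford G (\<phi> + \<phi>') \<psi> = clifford G \<phi> \<psi> + clifford G \<phi>' \<psi>"
  and clifford_csmul_left: "\<phi> \<in> forms \<Longrightarrow> \<psi> \<in> forms \<Longrightarrow> clifford G (c \<odot> \<phi>) \<psi> = c \<odot> clifford G \<phi> \<psi>"
  and clifford_diff_left: "\<phi> \<in> forms \<Longrightarrow> \<phi>' \<in> forms \<Longrightarrow> \<psi> \<in> forms \<Longrightarrow>
    clifford G (\<phi> - \<phi>') \<psi> = clifford G \<phi> \<psi> - clifford G \<phi>' \<psi>"
  using clinear_formsD(2)[OF clifford_linear_left, of \<psi> \<phi> \<phi>'] clinear_formsD(3)[OF clifford_linear_left, of \<psi> \<phi>]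
    clinear_forms_diff[OF clifford_linear_left, of \<psi> \<phi> \<phi>'] by simp_all

lemma clifford_add_right: "\<phi> \<in> forms \<Longrightarrow> \<psi> \<in> forms \<Longrightarrow> \<psi>' \<in> forms \<Longrightarrow>
    clifford G \<phi> (\<psi> + \<psi>') = clifford G \<phi> \<psi> + clifford G \<phi> \<psi>'"
  and clifford_csmul_right: "\<phi> \<in> forms \<Longrightarrow> \<psi> \<in> forms \<Longrightarrow> clifford G \<phi> (c \<odot> \<psi>) = c \<odot> clifford G \<phi> \<psi>"
  and clifford_diff_right: "\<phi> \<in> forms \<Longrightarrow> \<psi> \<in> forms \<Longrightarrow> \<psi>' \<in> forms \<Longrightarrow>
    clifford G \<phi> (\<psi> - \<psi>') = clifford G \<phi> \<psi> - clifford G \<phi> \<psi>'"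
  using clinear_formsD(2)[OF clifford_linear_right, of \<phi> \<psi> \<psi>'] clinear_formsD(3)[OF clifford_linear_right, of \<phi> \<psi>]
    clinear_forms_diff[OF clifford_linear_right, of \<phi> \<psi> \<psi>'] by simp_all

lemmas clifford_simps = clifford_add_left clifford_csmul_left clifford_diff_left
  clifford_add_right clifford_csmul_right clifford_diff_right

lemma clifford_left_mult:
  "\<phi> \<in> forms \<Longrightarrow> \<psi> \<in> forms \<Longrightarrow> clifford G (left_mult G u \<phi>) \<psi> = left_mult G u (clifford G \<phi> \<psi>)"
  using clifford_assoc[of "flat G u" \<phi> \<psi>]
  by (simp add: clifford_flat_left forms_flat[OF inner] forms_clifford)

text \<open>The axioms of the product prescribe only left multiplication by vectors. Left induction
  starts at 1, where both sides are \<open>flat G u\<close>, and each step commutes a left with a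
  right multiplication.\<close>

lemma clifford_flat_right:
  assumes "\<phi> \<in> forms"
  shows "clifford G \<phi> (flat G u) = right_mult G u \<phi>"
  using inner basis assms
proof (induction rule: forms_induct_left)
  case one
  show ?case by (simp add: clifford_one_left forms_flat[OF inner] right_mult_one)
next
  case (left_mult w \<phi>)
  then show ?case by (simp add: clifford_left_mult forms_flat[OF inner] left_right_mult_commute[OF inner])
qed (simp_all add: clifford_simps forms_flat[OF inner])

lemma clifford_right_mult:
  "\<phi> \<in> forms \<Longrightarrow> \<psi> \<in> forms \<Longrightarrow> clifford G \<phi> (right_mult G u \<psi>) = right_mult G u (clifford G \<phi> \<psi>)"
  using clifford_assoc[of \<phi> \<psi> "flat G u"]
  by (simp add: clifford_flat_right forms_flat[OF inner] forms_clifford)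

text \<open>Vectors generate the algebra, so compatibility with left multiplication by vectors,
  which \<open>f\<close> transports, spreads to all products by left induction on the first
  factor.\<close>

lemma hom_if_left_mult:
  assumes T: "clinear_forms T" "T one_form0 = one_form0"
    and mult: "\<And>u \<phi>. \<phi> \<in> forms \<Longrightarrow> T (left_mult G u \<phi>) = left_mult G (f u) (T \<phi>)"
    and "\<phi> \<in> forms" "\<psi> \<in> forms"
  shows "T (clifford G \<phi> \<psi>) = clifford G (T \<phi>) (T \<psi>)"
  using inner basis \<open>\<phi> \<in> forms\<close>
proof (induction rule: forms_induct_left)
  case (left_mult u \<phi>)
  then show ?case
    using \<open>\<psi> \<in> forms\<close> clinear_formsD(1)[OF T(1)] by (simp add: clifford_left_mult mult forms_clifford)
qed (use assms in \<open>simp_all add: clifford_one_left clifford_simps clinear_formsD forms_clifford\<close>)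

lemma antihom_if_left_mult:
  assumes T: "clinear_forms T" "T one_form0 = one_form0"
    and mult: "\<And>u \<phi>. \<phi> \<in> forms \<Longrightarrow> T (left_mult G u \<phi>) = right_mult G u (T \<phi>)"
    and "\<phi> \<in> forms" "\<psi> \<in> forms"
  shows "T (clifford G \<phi> \<psi>) = clifford G (T \<psi>) (T \<phi>)"
  using inner basis \<open>\<phi> \<in> forms\<close>
proof (induction rule: forms_induct_left)
  case (left_mult u \<phi>)
  then show ?case
    using \<open>\<psi> \<in> forms\<close> clinear_formsD(1)[OF T(1)]
    by (simp add: clifford_left_mult clifford_right_mult mult forms_clifford)
qed (use assms in \<open>simp_all add: clifford_one_left clifford_one_right clifford_simps clinear_formsD forms_clifford\<close>)

lemma forms_clifford_word: "clifford_word G us \<in> forms"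
  by (induction us) (simp_all add: clifford_word_def forms_one forms_clifford forms_flat[OF inner])

lemma clifford_word_Nil: "clifford_word G [] = one_form0"
  and clifford_word_Cons: "clifford_word G (u # us) = left_mult G u (clifford_word G us)"
  using forms_clifford_word[of us] by (simp_all add: clifford_word_def clifford_flat_left)

lemma clifford_word_snoc: "clifford_word G (us @ [u]) = right_mult G u (clifford_word G us)"
proof (induction us)
  case Nil
  show ?case by (simp add: clifford_word_Cons clifford_word_Nil left_mult_one right_mult_one)
next
  case (Cons w us)
  then show ?case by (simp add: clifford_word_Cons left_right_mult_commute[OF inner forms_clifford_word])
qed

end

subsection \<open>The transpose\<close>

text \<open>Reversing \<open>k\<close> factors gives the sign of \<open>0 + 1 + \<dots> + (k - 1)\<close> transpositions.\<close>

definition reversal_sign :: "'e form \<Rightarrow> 'e form" where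
  "reversal_sign \<phi> = (\<lambda>ws. (-1) ^ (\<Sum>{..<length ws}) * \<phi> ws)"

text \<open>The wedge evaluates its form on lists one shorter, hence the shifted weight. For the
  empty list the truncated subtraction does no harm, since both sides vanish.\<close>

lemma vwedge_weight: "vwedge G u (\<lambda>ws. c (length ws) * \<phi> ws) ws = c (length ws - 1) * vwedge G u \<phi> ws"
  by (auto simp: vwedge_def sum_distrib_left remove_nth_def min_def intro!: sum.cong)

text \<open>Going from degree k to k + 1 multiplies the reversal sign by (-1)^k, which is
  \<open>grade_sign\<close> for the wedge. For the contraction the step goes down instead, and the
  resulting sign is opposite; this turns the minus of \<open>left_mult\<close> into the plus of
  \<open>right_mult\<close>.\<close>

lemma reversal_sign_left_mult: "reversal_sign (left_mult G u \<phi>) = right_mult G u (reversal_sign \<phi>)"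
proof -
  have "(vwedge G u (grade_sign (reversal_sign \<phi>))) ws = reversal_sign (vwedge G u \<phi>) ws" for ws
    using vwedge_weight[of G u "\<lambda>k. (-1) ^ k * (-1) ^ (\<Sum>{..<k})" \<phi> ws]
    by (cases ws) (auto simp: grade_sign_def reversal_sign_def mult_ac power_add)
  moreover have "contraction u (grade_sign (reversal_sign \<phi>)) ws = - reversal_sign (contraction u \<phi>) ws" for ws
    by (auto simp: grade_sign_def reversal_sign_def contraction_def power_add simp flip: power_mult_distrib mult.assoc)
  ultimately show ?thesis
    by (simp add: right_mult_def left_mult_def fun_eq_iff form_apply reversal_sign_def right_diff_distrib)
qed

lemma clinear_reversal_sign: "clinear_forms reversal_sign"
proof (rule clinear_formsI)
  show "reversal_sign \<phi> \<in> forms" if "\<phi> \<in> forms" for \<phi> :: "'e::euclidean_space form"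
    using that by (auto simp: forms_def reversal_sign_def linear_iff algebra_simps)
qed (auto simp: reversal_sign_def fun_eq_iff form_apply algebra_simps)

lemma reversal_sign_one: "reversal_sign one_form0 = one_form0"
  by (auto simp: reversal_sign_def one_form0_def)

context clifford_space
begin

text \<open>\<open>reversal_sign\<close> is the witness for the choice: it exchanges left for right
  multiplication by vectors, hence reverses words and products.\<close>

lemma transpose_form:
  "clinear_forms (transpose_form G) \<and>
   (\<forall>\<phi>\<in>forms. \<forall>\<psi>\<in>forms. transpose_form G (clifford G \<phi> \<psi>) = clifford G (transpose_form G \<psi>) (transpose_form G \<phi>)) \<and>
   (\<forall>us. transpose_form G (clifford_word G us) = clifford_word G (rev us))"
proof -
  have "reversal_sign (clifford_word G us) = clifford_word G (rev us)" for us
    by (induction us)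
       (simp_all add: clifford_word_Nil clifford_word_Cons clifford_word_snoc reversal_sign_one reversal_sign_left_mult)
  then have "\<exists>T. clinear_forms T \<and>
     (\<forall>\<phi>\<in>forms. \<forall>\<psi>\<in>forms. T (clifford G \<phi> \<psi>) = clifford G (T \<psi>) (T \<phi>)) \<and>
     (\<forall>us. T (clifford_word G us) = clifford_word G (rev us))"
    using antihom_if_left_mult[OF clinear_reversal_sign reversal_sign_one reversal_sign_left_mult]
      clinear_reversal_sign by blast
  from someI_ex[OF this] show ?thesis unfolding transpose_form_def .
qed

lemmas clinear_transpose = transpose_form[THEN conjunct1]
lemmas forms_transpose = clinear_formsD(1)[OF clinear_transpose]

lemma transpose_one: "transpose_form G one_form0 = one_form0"
  using transpose_form[THEN conjunct2, THEN conjunct2, rule_format, of "[]"] by (simp add: clifford_word_Nil)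

lemma transpose_flat: "transpose_form G (flat G u) = flat G u"
  using transpose_form[THEN conjunct2, THEN conjunct2, rule_format, of "[u]"]
  by (simp add: clifford_word_Nil clifford_word_Cons left_mult_one)

lemma transpose_left_mult:
  assumes "\<phi> \<in> forms"
  shows "transpose_form G (left_mult G u \<phi>) = right_mult G u (transpose_form G \<phi>)"
  using transpose_form[THEN conjunct2, THEN conjunct1, rule_format, OF forms_flat[OF inner] assms, of u] assms
  by (simp add: transpose_flat clifford_flat_left clifford_flat_right forms_transpose)

lemma transpose_right_mult:
  assumes "\<phi> \<in> forms"
  shows "transpose_form G (right_mult G u \<phi>) = left_mult G u (transpose_form G \<phi>)"
  using transpose_form[THEN conjunct2, THEN conjunct1, rule_format, OF assms forms_flat[OF inner], of u] assms
  by (simp add: transpose_flat clifford_flat_left clifford_flat_right forms_transpose)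

lemma transpose_transpose: "\<phi> \<in> forms \<Longrightarrow> transpose_form G (transpose_form G \<phi>) = \<phi>"
  using inner basis
proof (induction rule: forms_induct_left)
qed (simp_all add: transpose_one clinear_formsD[OF clinear_transpose] transpose_left_mult transpose_right_mult)

end

subsection \<open>The automorphism induced by an orthogonal complex structure\<close>

definition pullback :: "('e \<Rightarrow> 'e) \<Rightarrow> 'e form \<Rightarrow> 'e form" where
  "pullback f \<phi> = (\<lambda>ws. \<phi> (map f ws))"

lemma clinear_pullback:
  assumes f: "linear f"
  shows "clinear_forms (pullback f)"
proof (rule clinear_formsI)
  show "pullback f \<phi> \<in> forms" if \<phi>: "\<phi> \<in> forms" for \<phi>
    using linear_compose[OF f forms_linear[OF \<phi>]] forms_alternating[OF \<phi>]
    by (simp add: forms_def pullback_def o_def)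
qed (auto simp: pullback_def fun_eq_iff form_apply)

lemma pullback_one: "pullback f one_form0 = one_form0"
  by (auto simp: pullback_def one_form0_def)

text \<open>The first hypothesis, adjointness of \<open>g\<close> and \<open>f\<close>, carries the
  wedge through the pullback; the second, that \<open>g\<close> is a right inverse of
  \<open>f\<close>, carries the contraction.\<close>

lemma pullback_left_mult:
  assumes "\<And>w. G (g u) w = G u (f w)" "f (g u) = u"
  shows "pullback f (left_mult G u \<phi>) = left_mult G (g u) (pullback f \<phi>)"
  using assms
  by (auto simp: fun_eq_iff form_apply pullback_def left_mult_def vwedge_def contraction_def remove_nth_def
      take_map drop_map intro!: sum.cong)

locale hermitian_space = clifford_space G v
  for G :: "'e::euclidean_space \<Rightarrow> 'e \<Rightarrow> real" and v +
  fixes J :: "'e \<Rightarrow> 'e"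
  assumes linear_J: "linear J" and J_J: "J (J u) = - u" and G_J_J: "G (J u) (J w) = G u w"
begin

lemma J_minus: "J (- u) = - J u"
  using linear_neg[OF linear_J] .

lemma G_minus_right: "G u (- w) = - G u w" and G_minus_left: "G (- u) w = - G u w"
proof -
  have "linear (G u)" for u using inner by (simp add: inner_product_def)
  then show *: "G u (- w) = - G u w" for u w using linear_neg by blast
  show "G (- u) w = - G u w" using * inner_product_sym[OF inner] by metis
qed

lemma G_J_left: "G (J u) w = - G u (J w)"
  using G_J_J[of "J u" w] by (simp add: J_J G_minus_left)

lemma Jalg_exists:
  "\<exists>T. clinear_forms T \<and> bij_betw T forms forms \<and> T one_form0 = one_form0 \<and>
     (\<forall>\<phi>\<in>forms. \<forall>\<psi>\<in>forms. T (clifford G \<phi> \<psi>) = clifford G (T \<phi>) (T \<psi>)) \<and>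
     (\<forall>u. T (flat G u) = flat G (J u))"
proof -
  \<comment> \<open>Forms are covariant, so extending J from vectors means pulling back along the
    inverse of J, which is -J.\<close>
  let ?f = "\<lambda>w. - J w"
  have lin: "linear ?f" using linear_J linear_compose_neg by blast
  have mult: "pullback ?f (left_mult G u \<phi>) = left_mult G (J u) (pullback ?f \<phi>)" for u \<phi>
    by (rule pullback_left_mult) (simp_all add: G_J_left G_minus_right J_J)
  have "bij_betw (pullback ?f) forms forms"
  proof (rule bij_betw_byWitness[where f' = "pullback J"])
    show "\<forall>a\<in>forms. pullback J (pullback ?f a) = a" "\<forall>a'\<in>forms. pullback ?f (pullback J a') = a'"
      by (simp_all add: pullback_def o_def J_J J_minus)
    show "pullback ?f ` forms \<subseteq> forms" "pullback J ` forms \<subseteq> forms"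
      using clinear_formsD(1)[OF clinear_pullback[OF lin]] clinear_formsD(1)[OF clinear_pullback[OF linear_J]]
      by blast+
  qed
  moreover have "pullback ?f (flat G u) = flat G (J u)" for u
    using mult[of u one_form0] by (simp add: left_mult_one pullback_one)
  ultimately show ?thesis
    using hom_if_left_mult[OF clinear_pullback[OF lin] pullback_one mult] clinear_pullback[OF lin] pullback_one
    by blast
qed

lemma Jalg_spec:
  "clinear_forms (Jalg G J) \<and> bij_betw (Jalg G J) forms forms \<and> Jalg G J one_form0 = one_form0 \<and>
     (\<forall>\<phi>\<in>forms. \<forall>\<psi>\<in>forms. Jalg G J (clifford G \<phi> \<psi>) = clifford G (Jalg G J \<phi>) (Jalg G J \<psi>)) \<and>
     (\<forall>u. Jalg G J (flat G u) = flat G (J u))"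
  unfolding Jalg_def by (rule someI_ex[OF Jalg_exists])

lemma clinear_Jalg: "clinear_forms (Jalg G J)"
  and bij_Jalg: "bij_betw (Jalg G J) forms forms"
  and Jalg_one: "Jalg G J one_form0 = one_form0"
  and Jalg_clifford: "\<phi> \<in> forms \<Longrightarrow> \<psi> \<in> forms \<Longrightarrow> Jalg G J (clifford G \<phi> \<psi>) = clifford G (Jalg G J \<phi>) (Jalg G J \<psi>)"
  and Jalg_flat: "Jalg G J (flat G u) = flat G (J u)"
  using Jalg_spec by blast+

lemmas forms_Jalg = clinear_formsD(1)[OF clinear_Jalg]

lemma Jalg_left_mult: "\<phi> \<in> forms \<Longrightarrow> Jalg G J (left_mult G u \<phi>) = left_mult G (J u) (Jalg G J \<phi>)"
  using Jalg_clifford[OF forms_flat[OF inner], of \<phi> u] by (simp add: Jalg_flat clifford_flat_left forms_Jalg)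

end

section \<open>The operators L and their commutation relations at one point\<close>

lemma linear_form_sum:
  fixes F :: "'e::real_vector \<Rightarrow> 'e form"
  assumes add: "\<And>x y. F (x + y) = F x + F y" and scale: "\<And>r x. F (r *\<^sub>R x) = complex_of_real r \<odot> F x"
  shows "F (\<Sum>i\<in>I. a i *\<^sub>R u i) = (\<Sum>i\<in>I. complex_of_real (a i) \<odot> F (u i))"
proof -
  have "F 0 = 0" using scale[of 0 0] by simp
  then have "F (\<Sum>i\<in>I. a i *\<^sub>R u i) = (\<Sum>i\<in>I. F (a i *\<^sub>R u i))"
    using add by (intro sum_additive_on[where T = F and C = UNIV]) simp_all
  then show ?thesis by (simp add: scale)
qed

definition form_bilinear :: "('e::real_vector \<Rightarrow> 'e \<Rightarrow> 'e form) \<Rightarrow> bool" where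
  "form_bilinear b \<longleftrightarrow> (\<forall>x y z. b (x + y) z = b x z + b y z) \<and> (\<forall>x y z. b x (y + z) = b x y + b x z) \<and>
     (\<forall>r x y. b (r *\<^sub>R x) y = complex_of_real r \<odot> b x y) \<and> (\<forall>r x y. b x (r *\<^sub>R y) = complex_of_real r \<odot> b x y)"

lemma form_bilinear_sum:
  assumes "form_bilinear b"
  shows "b (\<Sum>i\<in>I. a i *\<^sub>R u i) w = (\<Sum>i\<in>I. complex_of_real (a i) \<odot> b (u i) w)"
    and "b w (\<Sum>i\<in>I. a i *\<^sub>R u i) = (\<Sum>i\<in>I. complex_of_real (a i) \<odot> b w (u i))"
  using assms linear_form_sum[of "\<lambda>x. b x w" a u I] linear_form_sum[of "\<lambda>x. b w x" a u I]
  by (simp_all add: form_bilinear_def)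

text \<open>Expanding the first slot in \<open>w\<close> and exchanging the sums leaves, for each
  \<open>w k\<close>, its expansion in \<open>v\<close> in the second slot, which is then
  reassembled.\<close>

lemma (in clifford_space) trace_basis_independent:
  assumes b: "form_bilinear b" and w: "orthonormal_basis G w"
  shows "(\<Sum>j<DIM('e). b (v j) (v j)) = (\<Sum>k<DIM('e). b (w k) (w k))"
proof -
  have "(\<Sum>j<DIM('e). b (v j) (v j)) = (\<Sum>j<DIM('e). \<Sum>k<DIM('e). complex_of_real (G (v j) (w k)) \<odot> b (w k) (v j))"
    by (intro sum.cong refl, subst orthonormal_expand[OF inner w]) (rule form_bilinear_sum(1)[OF b])
  also have "\<dots> = (\<Sum>k<DIM('e). \<Sum>j<DIM('e). complex_of_real (G (w k) (v j)) \<odot> b (w k) (v j))"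
    by (subst sum.swap) (simp add: inner_product_sym[OF inner])
  also have "\<dots> = (\<Sum>k<DIM('e). b (w k) (w k))"
    by (intro sum.cong refl, subst (3) orthonormal_expand[OF inner basis]) (rule form_bilinear_sum(2)[OF b, symmetric])
  finally show ?thesis .
qed

text \<open>Infinitesimal version of the previous lemma, for an infinitesimal rotation \<open>x\<close> of the basis.\<close>

lemma (in clifford_space) trace_skew:
  assumes b: "form_bilinear b"
    and skew: "\<And>j k. j < DIM('e) \<Longrightarrow> k < DIM('e) \<Longrightarrow> G (x j) (v k) + G (v j) (x k) = 0"
  shows "(\<Sum>j<DIM('e). b (x j) (v j) + b (v j) (x j)) = 0"
proof -
  have 1: "(\<Sum>j<DIM('e). b (x j) (v j)) = (\<Sum>j<DIM('e). \<Sum>k<DIM('e). complex_of_real (G (x j) (v k)) \<odot> b (v k) (v j))"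
    by (intro sum.cong refl, subst orthonormal_expand[OF inner basis]) (rule form_bilinear_sum(1)[OF b])
  have "(\<Sum>j<DIM('e). b (v j) (x j)) = (\<Sum>j<DIM('e). \<Sum>k<DIM('e). complex_of_real (G (x j) (v k)) \<odot> b (v j) (v k))"
    by (intro sum.cong refl, subst orthonormal_expand[OF inner basis]) (rule form_bilinear_sum(2)[OF b])
  also have "\<dots> = (\<Sum>j<DIM('e). \<Sum>k<DIM('e). complex_of_real (G (x k) (v j)) \<odot> b (v k) (v j))"
    by (subst sum.swap) simp
  also have "\<dots> = (\<Sum>j<DIM('e). \<Sum>k<DIM('e). - (complex_of_real (G (x j) (v k)) \<odot> b (v k) (v j)))"
  proof (intro sum.cong refl)
    fix j k assume "j \<in> {..<DIM('e)}" "k \<in> {..<DIM('e)}"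
    then have "G (x k) (v j) = - G (x j) (v k)" using skew[of k j] inner_product_sym[OF inner, of "v k"] by simp
    then show "complex_of_real (G (x k) (v j)) \<odot> b (v k) (v j) = - (complex_of_real (G (x j) (v k)) \<odot> b (v k) (v j))"
      by (simp add: csmul_minus_left)
  qed
  finally show ?thesis using 1 by (simp add: sum.distrib sum_negf)
qed

text \<open>What left and right multiplication have in common: every identity for complex vectors is
  proved once for such an action and used on both sides.\<close>

definition clifford_action :: "('e::euclidean_space \<Rightarrow> 'e \<Rightarrow> real) \<Rightarrow> ('e \<Rightarrow> 'e form \<Rightarrow> 'e form) \<Rightarrow> bool" where
  "clifford_action G M \<longleftrightarrow> (\<forall>u. clinear_forms (M u)) \<and>
     (\<forall>\<phi>\<in>forms. \<forall>u w. M (u + w) \<phi> = M u \<phi> + M w \<phi>) \<and>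
     (\<forall>\<phi>\<in>forms. \<forall>r u. M (r *\<^sub>R u) \<phi> = complex_of_real r \<odot> M u \<phi>) \<and>
     (\<forall>\<phi>\<in>forms. \<forall>u w. M u (M w \<phi>) + M w (M u \<phi>) = complex_of_real (- 2 * G u w) \<odot> \<phi>)"

lemma clifford_actionD:
  assumes "clifford_action G M" "\<phi> \<in> forms"
  shows "clinear_forms (M u)"
    and "M (u + w) \<phi> = M u \<phi> + M w \<phi>"
    and "M (r *\<^sub>R u) \<phi> = complex_of_real r \<odot> M u \<phi>"
    and "M u (M w \<phi>) + M w (M u \<phi>) = complex_of_real (- 2 * G u w) \<odot> \<phi>"
  using assms by (simp_all add: clifford_action_def)

lemma clifford_action_left: "inner_product G \<Longrightarrow> clifford_action G (left_mult G)"
  and clifford_action_right: "inner_product G \<Longrightarrow> clifford_action G (right_mult G)"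
  unfolding clifford_action_def
  by (auto simp: clinear_forms_def forms_left_mult forms_right_mult left_mult_add_left right_mult_add_left
      left_mult_scaleR_left right_mult_scaleR_left left_mult_anticommute right_mult_anticommute)

text \<open>Multiplication by the complex vector \<open>u - \<i> J u\<close>.\<close>

definition zmult :: "('e \<Rightarrow> 'e form \<Rightarrow> 'e form) \<Rightarrow> ('e \<Rightarrow> 'e) \<Rightarrow> 'e \<Rightarrow> 'e form \<Rightarrow> 'e form" where
  "zmult M J u \<phi> = M u \<phi> - \<i> \<odot> M (J u) \<phi>"

text \<open>The opposite structure is again orthogonal, and multiplication by u + \<i> J u is
  \<open>zmult\<close> for it. Conjugate statements thus come from a second interpretation of the
  locale.\<close>

definition conj_structure :: "('e::real_vector \<Rightarrow> 'e) \<Rightarrow> 'e \<Rightarrow> 'e" where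
  "conj_structure J u = - J u"

lemma conj_structure_conj_structure [simp]: "conj_structure (conj_structure J) = J"
  by (simp add: conj_structure_def fun_eq_iff)

text \<open>The frame-free form of L. The constant 1/8 arises from the factor 1/4 of the two halves
  in \<open>eps\<close> and \<open>eps_bar\<close>, halved once more because e_k and J e_k
  contribute equally to the sum over the full basis.\<close>

definition L_form :: "('e::euclidean_space \<Rightarrow> 'e \<Rightarrow> real) \<Rightarrow> ('e \<Rightarrow> 'e) \<Rightarrow> (nat \<Rightarrow> 'e) \<Rightarrow> 'e form \<Rightarrow> 'e form" where
  "L_form G J w \<phi> = (- 1 / 8) \<odot> (\<Sum>j<DIM('e).
     zmult (left_mult G) J (w j) (zmult (right_mult G) (conj_structure J) (w j) \<phi>))"

lemma clinear_zmult: "clifford_action G M \<Longrightarrow> clinear_forms (zmult M J u)"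
  by (rule clinear_formsI)
     (auto simp: clifford_action_def zmult_def clinear_formsD forms_diff forms_csmul csmul_add_right
        csmul_diff_right mult.commute algebra_simps)

section \<open>Multiplication by complex vectors and its commutation with L\<close>

context hermitian_space
begin

lemma hermitian_space_conj: "hermitian_space G v (conj_structure J)"
proof (intro hermitian_space.intro hermitian_space_axioms.intro clifford_space_axioms)
  have "conj_structure J = (\<lambda>u. - J u)" by (simp add: conj_structure_def fun_eq_iff)
  then show "linear (conj_structure J)" using linear_compose_neg[OF linear_J] by simp
qed (simp_all add: conj_structure_def J_minus J_J G_minus_right G_minus_left G_J_J)

lemma zmult_linear_left:
  assumes M: "clifford_action G M" and \<phi>: "\<phi> \<in> forms"
  shows "zmult M J (u + w) \<phi> = zmult M J u \<phi> + zmult M J w \<phi>"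
    and "zmult M J (r *\<^sub>R u) \<phi> = complex_of_real r \<odot> zmult M J u \<phi>"
  by (simp_all add: zmult_def linear_add[OF linear_J] linear_cmul[OF linear_J] clifford_actionD[OF M \<phi>]
      csmul_add_right csmul_diff_right mult.commute)

text \<open>J u - \<i> J (J u) = \<i> (u - \<i> J u): the passage from u to its complex vector turns
  J into multiplication by \<i>.\<close>

lemma zmult_J:
  assumes M: "clifford_action G M" and \<phi>: "\<phi> \<in> forms"
  shows "zmult M J (J u) \<phi> = \<i> \<odot> zmult M J u \<phi>"
  using clifford_actionD(3)[OF M \<phi>, of "-1" u]
  by (simp add: zmult_def J_J csmul_diff_right csmul_minus_right)

text \<open>The coefficients are the scalars produced by \<open>zmult_zmult\<close>. Their real
  parts sum to the multiplication by u, their imaginary parts to -\<i> times the one by J u, which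
  by \<open>zmult_J\<close> is the same again; hence the factor 2.\<close>

lemma zmult_expand:
  assumes M: "clifford_action G M" and \<phi>: "\<phi> \<in> forms"
  shows "(\<Sum>k<DIM('e). (complex_of_real (G u (v k)) + \<i> * complex_of_real (G u (J (v k)))) \<odot> zmult M J (v k) \<phi>) =
    2 \<odot> zmult M J u \<phi>"
proof -
  have *: "zmult M J u \<phi> = (\<Sum>k<DIM('e). complex_of_real (G u (v k)) \<odot> zmult M J (v k) \<phi>)" for u
    by (subst orthonormal_expand[OF inner basis, of u])
       (rule linear_form_sum[of "\<lambda>u. zmult M J u \<phi>"]; rule zmult_linear_left[OF M \<phi>])
  have "G u (J w) = - G (J u) w" for w by (simp add: G_J_left)
  then have "(\<Sum>k<DIM('e). (complex_of_real (G u (v k)) + \<i> * complex_of_real (G u (J (v k)))) \<odot> zmult M J (v k) \<phi>) =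
      zmult M J u \<phi> - \<i> \<odot> zmult M J (J u) \<phi>"
    by (simp add: *[of u] *[of "J u"] csmul_sum_right sum_subtractf[symmetric] csmul_diff_left)
  then show ?thesis by (simp add: zmult_J[OF M \<phi>]) (simp add: fun_eq_iff form_apply)
qed

text \<open>This is the Clifford relation for the complex-bilinear extension of G. The vectors u -
  \<i> J u are mutually isotropic, while u - \<i> J u and w + \<i> J w pair to 2 (G u w + \<i> G u
  (J w)); the Clifford factor -2 makes it -4.\<close>

lemma zmult_zmult:
  assumes M: "clifford_action G M" and \<phi>: "\<phi> \<in> forms"
  shows "zmult M J u (zmult M J w \<phi>) + zmult M J w (zmult M J u \<phi>) = 0"
    and "zmult M J u (zmult M (conj_structure J) w \<phi>) + zmult M (conj_structure J) w (zmult M J u \<phi>) =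
      (- 4 * (complex_of_real (G u w) + \<i> * complex_of_real (G u (J w)))) \<odot> \<phi>"
proof -
  have closed: "M u \<phi> \<in> forms" for u using clinear_formsD(1)[OF clifford_actionD(1)[OF M \<phi>] \<phi>] .
  have expand: "M x (M y \<phi> + a \<odot> M z \<phi>) = M x (M y \<phi>) + a \<odot> M x (M z \<phi>)" for x y z a
    using clifford_actionD(1)[OF M \<phi>, of x] by (simp add: clinear_formsD closed forms_csmul)
  have ac: "M x (M y \<phi>) ws + M y (M x \<phi>) ws = complex_of_real (- 2 * G x y) * \<phi> ws" for x y ws
    using fun_cong[OF clifford_actionD(4)[OF M \<phi>, of x y], of ws] by (simp add: form_apply)
  have minus: "M (- x) \<psi> = - M x \<psi>" if "\<psi> \<in> forms" for x \<psi>
    using clifford_actionD(3)[OF M that, of "-1" x] by simp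
  have Z: "zmult M J x \<psi> = M x \<psi> + (- \<i>) \<odot> M (J x) \<psi>" for x \<psi>
    by (simp add: zmult_def csmul_minus_left)
  have Zbar: "zmult M (conj_structure J) x \<psi> = M x \<psi> + \<i> \<odot> M (J x) \<psi>" if "\<psi> \<in> forms" for x \<psi>
    using minus[OF that] by (simp add: zmult_def conj_structure_def csmul_minus_right)
  have fm: "M x \<phi> + a \<odot> M y \<phi> \<in> forms" for x y a by (intro forms_add forms_csmul closed)
  \<comment> \<open>One expansion with free coefficients; the three products \<open>ZZ\<close>,
    \<open>ZZbar\<close> and \<open>ZbarZ\<close> below take \<open>a\<close> and \<open>b\<close>
    to be \<i> or -\<i>. Evaluation at \<open>ws\<close> reduces the rest to complex
    arithmetic.\<close>
  have prod: "(M x (M y \<phi> + a \<odot> M z \<phi>) + b \<odot> M x' (M y \<phi> + a \<odot> M z \<phi>)) ws =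
      M x (M y \<phi>) ws + a * M x (M z \<phi>) ws + b * M x' (M y \<phi>) ws + a * b * M x' (M z \<phi>) ws" for x x' y z a b ws
    unfolding expand form_apply by (simp add: algebra_simps)
  have ZZ: "zmult M J x (zmult M J y \<phi>) ws = M x (M y \<phi>) ws - \<i> * M x (M (J y) \<phi>) ws
      - \<i> * M (J x) (M y \<phi>) ws - M (J x) (M (J y) \<phi>) ws" for x y ws
    using prod[of x y "- \<i>" "J y" "- \<i>" "J x" ws] by (simp add: Z)
  have ZZbar: "zmult M J x (zmult M (conj_structure J) y \<phi>) ws = M x (M y \<phi>) ws + \<i> * M x (M (J y) \<phi>) ws
      - \<i> * M (J x) (M y \<phi>) ws + M (J x) (M (J y) \<phi>) ws" for x y ws
    using prod[of x y "\<i>" "J y" "- \<i>" "J x" ws] by (simp add: Z Zbar[OF \<phi>])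
  have ZbarZ: "zmult M (conj_structure J) x (zmult M J y \<phi>) ws = M x (M y \<phi>) ws - \<i> * M x (M (J y) \<phi>) ws
      + \<i> * M (J x) (M y \<phi>) ws + M (J x) (M (J y) \<phi>) ws" for x y ws
    using prod[of x y "- \<i>" "J y" "\<i>" "J x" ws] by (simp add: Z Zbar[OF fm])
  show "zmult M J u (zmult M J w \<phi>) + zmult M J w (zmult M J u \<phi>) = 0"
  proof
    fix ws
    let ?S = "\<lambda>x y. M x (M y \<phi>) ws + M y (M x \<phi>) ws"
    have "zmult M J u (zmult M J w \<phi>) ws + zmult M J w (zmult M J u \<phi>) ws =
        ?S u w - \<i> * ?S u (J w) - \<i> * ?S (J u) w - ?S (J u) (J w)"
      unfolding ZZ[of u w ws] ZZ[of w u ws] by (simp add: algebra_simps)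
    also have "\<dots> = 0"
      unfolding ac[of u w ws] ac[of "J u" w ws] ac[of u "J w" ws] ac[of "J u" "J w" ws] G_J_J G_J_left[of u w]
      by simp
    finally show "(zmult M J u (zmult M J w \<phi>) + zmult M J w (zmult M J u \<phi>)) ws = 0 ws" by (simp add: form_apply)
  qed
  show "zmult M J u (zmult M (conj_structure J) w \<phi>) + zmult M (conj_structure J) w (zmult M J u \<phi>) =
      (- 4 * (complex_of_real (G u w) + \<i> * complex_of_real (G u (J w)))) \<odot> \<phi>"
  proof
    fix ws
    let ?S = "\<lambda>x y. M x (M y \<phi>) ws + M y (M x \<phi>) ws"
    have "zmult M J u (zmult M (conj_structure J) w \<phi>) ws + zmult M (conj_structure J) w (zmult M J u \<phi>) ws =
        ?S u w + \<i> * ?S u (J w) - \<i> * ?S (J u) w + ?S (J u) (J w)"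
      unfolding ZZbar[of u w ws] ZbarZ[of w u ws] by (simp add: algebra_simps)
    also have "\<dots> = (- 4 * (complex_of_real (G u w) + \<i> * complex_of_real (G u (J w)))) * \<phi> ws"
      unfolding ac[of u w ws] ac[of "J u" w ws] ac[of u "J w" ws] ac[of "J u" "J w" ws] G_J_J G_J_left[of u w]
      by (simp add: algebra_simps)
    finally show "(zmult M J u (zmult M (conj_structure J) w \<phi>) + zmult M (conj_structure J) w (zmult M J u \<phi>)) ws =
      ((- 4 * (complex_of_real (G u w) + \<i> * complex_of_real (G u (J w)))) \<odot> \<phi>) ws" by (simp add: form_apply)
  qed
qed

lemma zmult_left_right_commute:
  assumes "\<phi> \<in> forms"
  shows "zmult (left_mult G) J' u (zmult (right_mult G) J'' w \<phi>) = zmult (right_mult G) J'' w (zmult (left_mult G) J' u \<phi>)"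
  using left_right_mult_commute[OF inner assms]
  by (simp add: zmult_def csmul_diff_right algebra_simps)

lemmas action_left = clifford_action_left[OF inner]
lemmas action_right = clifford_action_right[OF inner]
lemmas clinear_zleft = clinear_zmult[OF action_left]
lemmas clinear_zright = clinear_zmult[OF action_right]

abbreviation "Z \<equiv> zmult (left_mult G) J"
abbreviation "Zbar \<equiv> zmult (left_mult G) (conj_structure J)"
abbreviation "R \<equiv> zmult (right_mult G) J"
abbreviation "Rbar \<equiv> zmult (right_mult G) (conj_structure J)"
abbreviation "L \<equiv> L_form G J v"
abbreviation "Lbar \<equiv> L_form G (conj_structure J) v"

lemmas forms_Z = clinear_formsD(1)[OF clinear_zleft]
lemmas forms_R = clinear_formsD(1)[OF clinear_zright]

lemma clinear_L: "clinear_forms L"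
proof (rule clinear_formsI)
  show "L \<phi> \<in> forms" if "\<phi> \<in> forms" for \<phi>
    unfolding L_form_def by (intro forms_csmul forms_sum forms_Z forms_R that)
  show "L (\<phi> + \<psi>) = L \<phi> + L \<psi>" if "\<phi> \<in> forms" "\<psi> \<in> forms" for \<phi> \<psi>
    using that by (simp add: L_form_def clinear_formsD(2)[OF clinear_zright] clinear_formsD(2)[OF clinear_zleft]
      forms_R sum.distrib csmul_add_right)
  show "L (c \<odot> \<phi>) = c \<odot> L \<phi>" if "\<phi> \<in> forms" for c \<phi>
    using that by (simp add: L_form_def clinear_formsD(3)[OF clinear_zright] clinear_formsD(3)[OF clinear_zleft]
      forms_R csmul_sum_right mult.commute)
qed

text \<open>\<open>Z u\<close> commutes with the right factor and anticommutes with each left factor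
  \<open>Z (v j)\<close>, so the sum cancels term by term.\<close>

lemma Z_anticommutator_L:
  assumes \<phi>: "\<phi> \<in> forms"
  shows "Z u (L \<phi>) + L (Z u \<phi>) = 0"
proof -
  have "Z u (L \<phi>) = (- 1 / 8) \<odot> (\<Sum>j<DIM('e). Z u (Z (v j) (Rbar (v j) \<phi>)))"
    unfolding L_form_def using \<phi>
    by (simp add: clinear_formsD(3)[OF clinear_zleft] clinear_forms_sum[OF clinear_zleft] forms_sum forms_Z forms_R)
  moreover have "L (Z u \<phi>) = (- 1 / 8) \<odot> (\<Sum>j<DIM('e). Z (v j) (Z u (Rbar (v j) \<phi>)))"
    unfolding L_form_def using \<phi> by (simp add: zmult_left_right_commute)
  ultimately show ?thesis
    using zmult_zmult(1)[OF action_left forms_R[OF \<phi>]]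
    by (simp flip: csmul_add_right sum.distrib)
qed

lemma Z_anticommutator_Lbar:
  assumes \<phi>: "\<phi> \<in> forms"
  shows "Z u (Lbar \<phi>) + Lbar (Z u \<phi>) = R u \<phi>"
proof -
  have "Z u (Lbar \<phi>) = (- 1 / 8) \<odot> (\<Sum>j<DIM('e). Z u (Zbar (v j) (R (v j) \<phi>)))"
    unfolding L_form_def using \<phi>
    by (simp add: clinear_formsD(3)[OF clinear_zleft] clinear_forms_sum[OF clinear_zleft] forms_sum forms_Z forms_R)
  moreover have "Lbar (Z u \<phi>) = (- 1 / 8) \<odot> (\<Sum>j<DIM('e). Zbar (v j) (Z u (R (v j) \<phi>)))"
    unfolding L_form_def using \<phi> by (simp add: zmult_left_right_commute)
  ultimately have "Z u (Lbar \<phi>) + Lbar (Z u \<phi>) = (- 1 / 8) \<odot> (\<Sum>j<DIM('e).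
      (- 4 * (complex_of_real (G u (v j)) + \<i> * complex_of_real (G u (J (v j))))) \<odot> R (v j) \<phi>)"
    using zmult_zmult(2)[OF action_left forms_R[OF \<phi>]]
    by (simp flip: csmul_add_right sum.distrib)
  \<comment> \<open>The product of -1/8 and -4 is 1/2, which the 2 in \<open>zmult_expand\<close>
    then cancels.\<close>
  also have "\<dots> = (1 / 2) \<odot> (\<Sum>j<DIM('e).
      (complex_of_real (G u (v j)) + \<i> * complex_of_real (G u (J (v j)))) \<odot> R (v j) \<phi>)"
    unfolding csmul_sum_right csmul_csmul
    by (intro sum.cong refl arg_cong[where f = "\<lambda>c. c \<odot> _"]) (simp add: field_simps)
  finally show ?thesis unfolding zmult_expand[OF action_right \<phi>] by simp
qed

text \<open>Since left and right factors commute, L may be read with its right factor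
  \<open>Rbar (v j)\<close> outermost; then the mixed relation is used for the right action, and the
  left factors are summed up by \<open>zmult_expand\<close>.\<close>

lemma R_anticommutator_L:
  assumes \<phi>: "\<phi> \<in> forms"
  shows "R u (L \<phi>) + L (R u \<phi>) = Z u \<phi>"
proof -
  have "R u (L \<phi>) = (- 1 / 8) \<odot> (\<Sum>j<DIM('e). R u (Rbar (v j) (Z (v j) \<phi>)))"
    unfolding L_form_def using \<phi>
    by (simp add: clinear_formsD(3)[OF clinear_zright] clinear_forms_sum[OF clinear_zright] forms_sum forms_Z forms_R
        zmult_left_right_commute)
  moreover have "L (R u \<phi>) = (- 1 / 8) \<odot> (\<Sum>j<DIM('e). Rbar (v j) (R u (Z (v j) \<phi>)))"
    unfolding L_form_def using \<phi> by (simp add: zmult_left_right_commute forms_R forms_Z)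
  ultimately have "R u (L \<phi>) + L (R u \<phi>) = (- 1 / 8) \<odot> (\<Sum>j<DIM('e).
      (- 4 * (complex_of_real (G u (v j)) + \<i> * complex_of_real (G u (J (v j))))) \<odot> Z (v j) \<phi>)"
    using zmult_zmult(2)[OF action_right forms_Z[OF \<phi>]]
    by (simp flip: csmul_add_right sum.distrib)
  also have "\<dots> = (1 / 2) \<odot> (\<Sum>j<DIM('e).
      (complex_of_real (G u (v j)) + \<i> * complex_of_real (G u (J (v j)))) \<odot> Z (v j) \<phi>)"
    unfolding csmul_sum_right csmul_csmul
    by (intro sum.cong refl arg_cong[where f = "\<lambda>c. c \<odot> _"]) (simp add: field_simps)
  finally show ?thesis unfolding zmult_expand[OF action_left \<phi>] by simp
qed

text \<open>Jacobi: \<open>[[L, Lbar], Z] = {L, {Lbar, Z}} - {Lbar, {L, Z}}\<close>.\<close>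

lemma H_commutator_Z:
  assumes \<phi>: "\<phi> \<in> forms"
  shows "(L (Lbar (Z u \<phi>)) - Lbar (L (Z u \<phi>))) - Z u (L (Lbar \<phi>) - Lbar (L \<phi>)) = Z u \<phi>"
proof -
  interpret bar: hermitian_space G v "conj_structure J" by (rule hermitian_space_conj)
  have closed: "L \<phi> \<in> forms" "Lbar \<phi> \<in> forms" "L (Lbar \<phi>) \<in> forms" "Lbar (L \<phi>) \<in> forms"
    "L (Z u \<phi>) \<in> forms" "Z u (Lbar \<phi>) \<in> forms" "Z u (L \<phi>) \<in> forms" "R u \<phi> \<in> forms"
    using \<phi> forms_Z forms_R clinear_formsD(1)[OF clinear_L] clinear_formsD(1)[OF bar.clinear_L] by simp_all
  have "Lbar (Z u \<phi>) = R u \<phi> - Z u (Lbar \<phi>)" "L (Z u \<phi>) = - Z u (L \<phi>)"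
    using Z_anticommutator_Lbar[OF \<phi>, of u] Z_anticommutator_L[OF \<phi>, of u]
    by (simp_all add: eq_diff_eq eq_neg_iff_add_eq_0 add.commute)
  then have 1: "L (Lbar (Z u \<phi>)) = L (R u \<phi>) - L (Z u (Lbar \<phi>))" "Lbar (L (Z u \<phi>)) = - Lbar (Z u (L \<phi>))"
    using closed clinear_forms_diff[OF clinear_L] clinear_forms_minus[OF bar.clinear_L] by simp_all
  have 2: "L (Z u (Lbar \<phi>)) = - Z u (L (Lbar \<phi>))"
    using Z_anticommutator_L[OF closed(2), of u] by (simp add: eq_neg_iff_add_eq_0 add.commute)
  have 3: "Lbar (Z u (L \<phi>)) = R u (L \<phi>) - Z u (Lbar (L \<phi>))"
    using Z_anticommutator_Lbar[OF closed(1), of u] by (simp add: eq_diff_eq add.commute)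
  have 4: "Z u (L (Lbar \<phi>) - Lbar (L \<phi>)) = Z u (L (Lbar \<phi>)) - Z u (Lbar (L \<phi>))"
    using closed clinear_forms_diff[OF clinear_zleft] by simp
  show ?thesis
    unfolding 1 2 3 4 using R_anticommutator_L[OF \<phi>, of u] by (simp add: algebra_simps)
qed

lemma form_bilinear_L:
  assumes \<phi>: "\<phi> \<in> forms"
  shows "form_bilinear (\<lambda>u w. Z u (Rbar w \<phi>))"
proof -
  interpret bar: hermitian_space G v "conj_structure J" by (rule hermitian_space_conj)
  show ?thesis
    unfolding form_bilinear_def
    using \<phi> zmult_linear_left[OF action_left forms_R[OF \<phi>]] bar.zmult_linear_left[OF action_right \<phi>]
      clinear_formsD(2,3)[OF clinear_zleft] forms_R by simp
qed

lemma L_basis_independent: "\<phi> \<in> forms \<Longrightarrow> orthonormal_basis G w \<Longrightarrow> L_form G J w \<phi> = L \<phi>"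
  unfolding L_form_def using trace_basis_independent[OF form_bilinear_L] by simp

text \<open>Connects the sum over n frame vectors in the definition of L with the trace over all 2n
  basis vectors, whose independence of the basis is already known.\<close>

lemma L_form_adapted:
  assumes e: "adapted_frame G J e" and \<phi>: "\<phi> \<in> forms" and n: "DIM('e) = 2 * n"
  shows "- (\<Sum>k<n. clifford G (clifford G ((1/2) \<odot> (flat G (e k) - \<i> \<odot> flat G (J (e k)))) \<phi>)
      ((1/2) \<odot> (flat G (e k) + \<i> \<odot> flat G (J (e k))))) = L \<phi>"
proof -
  interpret bar: hermitian_space G v "conj_structure J" by (rule hermitian_space_conj)
  let ?w = "\<lambda>k. if k < n then e k else J (e (k - n))"
  let ?b = "\<lambda>u. Z u (Rbar u \<phi>)"
  have flat: "flat G u \<in> forms" for u using forms_flat[OF inner] .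
  have minus: "right_mult G (- u) \<phi>' = - right_mult G u \<phi>'" if "\<phi>' \<in> forms" for u \<phi>'
    using clifford_actionD(3)[OF action_right that, of "-1" u] by simp
  have summand: "clifford G (clifford G ((1/2) \<odot> (flat G u - \<i> \<odot> flat G (J u))) \<phi>)
      ((1/2) \<odot> (flat G u + \<i> \<odot> flat G (J u))) = (1/4) \<odot> ?b u" for u
  proof -
    have "clifford G ((1/2) \<odot> (flat G u - \<i> \<odot> flat G (J u))) \<phi> = (1/2) \<odot> Z u \<phi>"
      using \<phi> by (simp add: clifford_simps flat forms_diff forms_csmul clifford_flat_left zmult_def)
    moreover have "clifford G ((1/2) \<odot> Z u \<phi>) ((1/2) \<odot> (flat G u + \<i> \<odot> flat G (J u))) = (1/4) \<odot> Rbar u (Z u \<phi>)"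
      using \<phi> forms_Z[OF \<phi>]
      by (simp add: clifford_simps flat forms_add forms_csmul clifford_flat_right zmult_def[of "right_mult G"]
          conj_structure_def csmul_minus_right csmul_add_right minus)
    ultimately show ?thesis using zmult_left_right_commute[OF \<phi>] by simp
  qed
  \<comment> \<open>Replacing u by J u multiplies \<open>Z\<close> by \<i> and \<open>Rbar\<close>
    by -\<i>, so the product is unchanged and both halves of the adapted basis give the same
    sum.\<close>
  have bJ: "?b (J u) = ?b u" for u
  proof -
    have "Rbar (J u) \<phi> = - Rbar (- J u) \<phi>"
      using bar.zmult_linear_left(2)[OF action_right \<phi>, of "-1" "J u"] by simp
    also have "\<dots> = - (\<i> \<odot> Rbar u \<phi>)" using bar.zmult_J[OF action_right \<phi>, of u] by (simp add: conj_structure_def)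
    finally have "Rbar (J u) \<phi> = (- \<i>) \<odot> Rbar u \<phi>" by (simp add: csmul_minus_left)
    then show ?thesis
      using clinear_formsD(3)[OF clinear_zleft] zmult_J[OF action_left] forms_R[OF \<phi>] forms_Z by simp
  qed
  have "DIM('e) div 2 = n" using n by simp
  then have "orthonormal_basis G ?w" using e by (simp only: adapted_frame_def)
  then have "L \<phi> = (- 1 / 8) \<odot> (\<Sum>k<2 * n. ?b (?w k))"
    using L_basis_independent[OF \<phi>, of ?w] by (simp only: L_form_def n)
  also have "(\<Sum>k<2 * n. ?b (?w k)) = (\<Sum>k<n. ?b (?w k)) + (\<Sum>k<n. ?b (?w (k + n)))"
    by (simp only: mult_2 sum.nat_group[symmetric] lessThan_atLeast0 sum.atLeastLessThan_concat[of 0 n "n + n", symmetric]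
        sum.shift_bounds_nat_ivl[of _ 0 n n, simplified add_0] le0 le_add1 add_0)
  also have "\<dots> = 2 \<odot> (\<Sum>k<n. ?b (e k))"
    by (simp add: bJ) (simp add: fun_eq_iff form_apply)
  finally show ?thesis by (simp add: summand csmul_sum_right flip: csmul_minus_one)
qed

end

section \<open>Smooth fields on an almost Hermitian manifold\<close>

locale almost_hermitian_mfd =
  fixes M :: "('m, 'e::euclidean_space, 'z) almost_hermitian_scheme"
  assumes mfd: "almost_hermitian_manifold M"
begin

abbreviation "atlas \<equiv> ah_atlas M"
abbreviation "G \<equiv> ah_metric M"
abbreviation "J \<equiv> ah_J M"
abbreviation "open_set U \<equiv> openin (ah_top M) U"

section \<open>Charts and changes of coordinates\<close>

lemma smooth_mfd: "smooth_manifold M"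
  using mfd by (simp add: almost_hermitian_manifold_def)

lemma chart_open: "c \<in> atlas \<Longrightarrow> open_set (fst c)"
  and chart_homeo: "c \<in> atlas \<Longrightarrow>
    homeomorphic_map (subtopology (ah_top M) (fst c)) (top_of_set (snd c ` fst c)) (snd c)"
  and chart_image_open: "c \<in> atlas \<Longrightarrow> open (snd c ` fst c)"
  and transition_smooth: "c \<in> atlas \<Longrightarrow> d \<in> atlas \<Longrightarrow> smooth_on (snd c ` (fst c \<inter> fst d)) (snd d \<circ> cinv c)"
  using smooth_mfd by (simp_all add: smooth_manifold_def)

lemma chart_inj: "c \<in> atlas \<Longrightarrow> inj_on (snd c) (fst c)"
  using homeomorphic_imp_injective_map[OF chart_homeo[of c]] openin_subset[OF chart_open[of c]]
  by (simp add: Int_absorb1)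

lemma cinv_chart: "c \<in> atlas \<Longrightarrow> q \<in> fst c \<Longrightarrow> cinv c (snd c q) = q"
  by (simp add: cinv_def inv_into_f_f chart_inj)

lemma cinv_in:
  assumes "c \<in> atlas" "x \<in> snd c ` (U \<inter> fst c)"
  shows "cinv c x \<in> U" "cinv c x \<in> fst c" "snd c (cinv c x) = x"
proof -
  obtain q where "q \<in> U" "q \<in> fst c" "x = snd c q" using assms(2) by blast
  then show "cinv c x \<in> U" "cinv c x \<in> fst c" "snd c (cinv c x) = x" using cinv_chart[OF assms(1)] by simp_all
qed

lemma open_chart_image:
  assumes c: "c \<in> atlas" and U: "open_set U"
  shows "open (snd c ` (U \<inter> fst c))"
proof -
  have "openin (subtopology (ah_top M) (fst c)) (U \<inter> fst c)"
    using U by (auto simp: openin_subtopology)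
  then have "openin (top_of_set (snd c ` fst c)) (snd c ` (U \<inter> fst c))"
    using homeomorphic_map_openness[OF chart_homeo[OF c], of "U \<inter> fst c"] openin_subset[OF chart_open[OF c]] by auto
  then show ?thesis using chart_image_open[OF c] openin_open_trans by blast
qed

lemma open_set_Int_chart: "open_set U \<Longrightarrow> c \<in> atlas \<Longrightarrow> open_set (U \<inter> fst c)"
  using chart_open by blast

lemma open_set_chart_preimage:
  assumes c: "c \<in> atlas" and "open S"
  shows "open_set {q \<in> fst c. snd c q \<in> S}"
proof -
  have "continuous_map (subtopology (ah_top M) (fst c)) (top_of_set (snd c ` fst c)) (snd c)"
    using chart_homeo[OF c] homeomorphic_imp_continuous_map by blast
  then have "continuous_map (subtopology (ah_top M) (fst c)) euclidean (snd c)"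
    using continuous_map_into_fulltopology by blast
  from openin_continuous_map_preimage[OF this, of S]
  have "openin (subtopology (ah_top M) (fst c)) {q \<in> topspace (subtopology (ah_top M) (fst c)). snd c q \<in> S}"
    using assms(2) by simp
  moreover have "{q \<in> topspace (subtopology (ah_top M) (fst c)). snd c q \<in> S} = {q \<in> fst c. snd c q \<in> S}"
    using openin_subset[OF chart_open[OF c]] by auto
  ultimately show ?thesis using openin_trans_full[OF _ chart_open[OF c]] by metis
qed

lemma chart_at: "q \<in> topspace (ah_top M) \<Longrightarrow> chart_at M q \<in> atlas \<and> q \<in> fst (chart_at M q)"
proof -
  assume "q \<in> topspace (ah_top M)"
  then have "\<exists>c. c \<in> atlas \<and> q \<in> fst c" using smooth_mfd unfolding smooth_manifold_def by blast
  then show ?thesis unfolding chart_at_def by (rule someI_ex)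
qed

lemma in_chart_topspace: "c \<in> atlas \<Longrightarrow> q \<in> fst c \<Longrightarrow> q \<in> topspace (ah_top M)"
  using openin_subset[OF chart_open] by blast

lemma jacobian_has_derivative:
  assumes "c \<in> atlas" "d \<in> atlas" "q \<in> fst c" "q \<in> fst d"
  shows "((snd d \<circ> cinv c) has_derivative jacobian c d q) (at (snd c q))"
  unfolding jacobian_def using assms by (intro smooth_on_has_derivative[OF transition_smooth]) auto

lemma linear_jacobian: "c \<in> atlas \<Longrightarrow> d \<in> atlas \<Longrightarrow> q \<in> fst c \<Longrightarrow> q \<in> fst d \<Longrightarrow> linear (jacobian c d q)"
  using jacobian_has_derivative has_derivative_linear by blast

text \<open>The composite of two transition maps agrees with the direct one only over the image of
  the overlap with \<open>d\<close>; this image is open, which suffices for derivatives.\<close>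

lemma jacobian_chain:
  assumes c: "c \<in> atlas" "q \<in> fst c" and d: "d \<in> atlas" "q \<in> fst d" and e: "e \<in> atlas" "q \<in> fst e"
  shows "jacobian d e q (jacobian c d q w) = jacobian c e q w"
proof -
  have eq: "(snd d \<circ> cinv c) (snd c q) = snd d q" using cinv_chart c by simp
  have "((\<lambda>x. (snd e \<circ> cinv d) ((snd d \<circ> cinv c) x)) has_derivative (\<lambda>w. jacobian d e q (jacobian c d q w))) (at (snd c q))"
    by (rule has_derivative_compose[OF jacobian_has_derivative])
       (use assms jacobian_has_derivative[of d e q] in \<open>simp_all add: eq del: o_apply\<close>)
  moreover have "open (snd c ` (fst d \<inter> fst c))" using open_chart_image[OF c(1) chart_open[OF d(1)]] .
  ultimately have "((snd e \<circ> cinv c) has_derivative (\<lambda>w. jacobian d e q (jacobian c d q w))) (at (snd c q))"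
    by (rule has_derivative_transform_within_open)
       (use c d cinv_chart[OF d(1) cinv_in(1)[OF c(1)]] in auto)
  then have "(\<lambda>w. jacobian d e q (jacobian c d q w)) = jacobian c e q"
    using has_derivative_unique jacobian_has_derivative[OF c(1) e(1) c(2) e(2)] by blast
  then show ?thesis by metis
qed

lemma jacobian_same:
  assumes c: "c \<in> atlas" "q \<in> fst c"
  shows "jacobian c c q w = w"
proof -
  have "((\<lambda>x. x) has_derivative (\<lambda>w. w)) (at (snd c q))" by (rule has_derivative_ident)
  then have "((snd c \<circ> cinv c) has_derivative (\<lambda>w. w)) (at (snd c q))"
    by (rule has_derivative_transform_within_open[OF _ chart_image_open[OF c(1)]])
       (use c cinv_in(3)[OF c(1), of _ UNIV] in auto)
  then have "(\<lambda>w. w) = jacobian c c q"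
    using has_derivative_unique jacobian_has_derivative[OF c(1,1) c(2,2)] by blast
  then show ?thesis by metis
qed

text \<open>\<open>components\<close> starts from the preferred chart and
  \<open>coord_vector\<close> ends in it, so in composites the preferred chart drops out by
  \<open>jacobian_chain\<close>.\<close>

lemma
  assumes c: "c \<in> atlas" "q \<in> fst c"
  shows linear_components: "linear (components M c q)"
    and linear_coord_vector: "linear (coord_vector M c q)"
    and coord_vector_components: "coord_vector M c q (components M c q v) = v"
    and components_coord_vector: "d \<in> atlas \<Longrightarrow> q \<in> fst d \<Longrightarrow> components M d q (coord_vector M c q w) = jacobian c d q w"
  using chart_at[OF in_chart_topspace[OF c]] c
  by (simp_all add: components_def coord_vector_def linear_jacobian jacobian_chain jacobian_same)

lemma coord_vector_expand:
  assumes c: "c \<in> atlas" "q \<in> fst c"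
  shows "v = (\<Sum>b\<in>Basis. (components M c q v \<bullet> b) *\<^sub>R coord_vector M c q b)"
proof -
  have "(\<Sum>b\<in>Basis. (components M c q v \<bullet> b) *\<^sub>R coord_vector M c q b) =
      coord_vector M c q (\<Sum>b\<in>Basis. (components M c q v \<bullet> b) *\<^sub>R b)"
    by (simp add: linear_sum[OF linear_coord_vector[OF c]] linear_cmul[OF linear_coord_vector[OF c]])
  then show ?thesis by (simp add: euclidean_representation coord_vector_components[OF c])
qed

section \<open>Smooth functions and vector fields\<close>

lemma smooth_fun_subset: "smooth_fun M U f \<Longrightarrow> V \<subseteq> U \<Longrightarrow> smooth_fun M V f"
  unfolding smooth_fun_def by (meson Int_mono image_mono order_refl smooth_on_subset)

lemma smooth_vf_subset: "smooth_vf M U X \<Longrightarrow> V \<subseteq> U \<Longrightarrow> smooth_vf M V X"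
  unfolding smooth_vf_def by (meson Int_mono image_mono order_refl smooth_on_subset)

lemma smooth_form_field_subset: "smooth_form_field M U \<phi> \<Longrightarrow> V \<subseteq> U \<Longrightarrow> smooth_form_field M V \<phi>"
  unfolding smooth_form_field_def by (meson Int_mono image_mono order_refl smooth_on_subset subsetD)

lemma smooth_fun_const: "open_set U \<Longrightarrow> smooth_fun M U (\<lambda>q. a)"
  unfolding smooth_fun_def by (simp add: smooth_on_const open_chart_image)

lemma smooth_fun_powr:
  assumes "open_set U" "smooth_fun M U f" "\<And>q. q \<in> U \<Longrightarrow> f q > (0::real)"
  shows "smooth_fun M U (\<lambda>q. f q powr a)"
  unfolding smooth_fun_def
proof
  fix c assume c: "c \<in> atlas"
  show "smooth_on (snd c ` (U \<inter> fst c)) (\<lambda>x. f (cinv c x) powr a)"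
  proof (rule smooth_on_powr)
    show "smooth_on (snd c ` (U \<inter> fst c)) (\<lambda>x. f (cinv c x))"
      using assms(2) c by (simp add: smooth_fun_def)
    show "f (cinv c x) > 0" if "x \<in> snd c ` (U \<inter> fst c)" for x
      using cinv_in(1)[OF c that] assms(3) by blast
  qed (rule open_chart_image[OF c assms(1)])
qed

lemma smooth_vf_add:
  assumes U: "open_set U" and X: "smooth_vf M U X" and Y: "smooth_vf M U Y"
  shows "smooth_vf M U (\<lambda>q. X q + Y q)"
  unfolding smooth_vf_def
proof
  fix c assume c: "c \<in> atlas"
  let ?C = "\<lambda>X x. components M c (cinv c x) (X (cinv c x))"
  have "smooth_on (snd c ` (U \<inter> fst c)) (\<lambda>x. ?C X x + ?C Y x)"
    using X Y c by (intro smooth_on_add open_chart_image U) (simp_all add: smooth_vf_def)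
  moreover have "?C X x + ?C Y x = ?C (\<lambda>q. X q + Y q) x" if "x \<in> snd c ` (U \<inter> fst c)" for x
    using linear_add[OF linear_components[OF c cinv_in(2)[OF c that]]] by simp
  ultimately show "smooth_on (snd c ` (U \<inter> fst c)) (?C (\<lambda>q. X q + Y q))"
    using smooth_on_cong[OF open_chart_image[OF c U]] by (metis (no_types, lifting))
qed

lemma smooth_vf_scaleR:
  assumes U: "open_set U" and f: "smooth_fun M U f" and X: "smooth_vf M U X"
  shows "smooth_vf M U (\<lambda>q. f q *\<^sub>R X q)"
  unfolding smooth_vf_def
proof
  fix c assume c: "c \<in> atlas"
  let ?C = "\<lambda>X x. components M c (cinv c x) (X (cinv c x))"
  have "smooth_on (snd c ` (U \<inter> fst c)) (\<lambda>x. f (cinv c x) *\<^sub>R ?C X x)"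
    using f X c by (intro smooth_on_scaleR open_chart_image U) (simp_all add: smooth_vf_def smooth_fun_def)
  moreover have "f (cinv c x) *\<^sub>R ?C X x = ?C (\<lambda>q. f q *\<^sub>R X q) x" if "x \<in> snd c ` (U \<inter> fst c)" for x
    using linear_cmul[OF linear_components[OF c cinv_in(2)[OF c that]]] by simp
  ultimately show "smooth_on (snd c ` (U \<inter> fst c)) (?C (\<lambda>q. f q *\<^sub>R X q))"
    using smooth_on_cong[OF open_chart_image[OF c U]] by (metis (no_types, lifting))
qed

lemma smooth_vf_diff:
  "open_set U \<Longrightarrow> smooth_vf M U X \<Longrightarrow> smooth_vf M U Y \<Longrightarrow> smooth_vf M U (\<lambda>q. X q - Y q)"
  using smooth_vf_add[of U X "\<lambda>q. (-1) *\<^sub>R Y q"] smooth_vf_scaleR[of U "\<lambda>q. -1" Y] by (simp add: smooth_fun_const)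

lemma smooth_vf_sum:
  assumes "open_set U" "\<And>i. i < (n::nat) \<Longrightarrow> smooth_vf M U (X i)"
  shows "smooth_vf M U (\<lambda>q. \<Sum>i<n. X i q)"
  using assms(2)
proof (induction n)
  case 0
  have "smooth_on (snd c ` (U \<inter> fst c)) (\<lambda>x. components M c (cinv c x) 0)" if c: "c \<in> atlas" for c
  proof -
    have "components M c (cinv c x) 0 = 0" if "x \<in> snd c ` (U \<inter> fst c)" for x
      using linear_0[OF linear_components[OF c cinv_in(2)[OF c that]]] .
    then show ?thesis
      using smooth_on_cong[OF open_chart_image[OF c assms(1)], of "\<lambda>x. components M c (cinv c x) 0" "\<lambda>x. 0"]
        smooth_on_const[OF open_chart_image[OF c assms(1)]] by simp
  qed
  then show ?case by (simp add: smooth_vf_def)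
next
  case (Suc n)
  then show ?case by (simp add: smooth_vf_add assms(1))
qed

lemma smooth_vf_J: "open_set U \<Longrightarrow> smooth_vf M U X \<Longrightarrow> smooth_vf M U (\<lambda>q. J q (X q))"
  and smooth_fun_metric: "open_set U \<Longrightarrow> smooth_vf M U X \<Longrightarrow> smooth_vf M U Y \<Longrightarrow> smooth_fun M U (\<lambda>q. G q (X q) (Y q))"
  using mfd by (simp_all add: almost_hermitian_manifold_def)

text \<open>Seen in another chart \<open>d\<close>, the components are the derivative of the
  transition from \<open>c\<close> to \<open>d\<close> in the fixed direction \<open>w\<close>,
  composed with the transition back. The preferred charts, which may jump, have cancelled.\<close>

lemma smooth_vf_coord_vector:
  assumes c: "c \<in> atlas" and U: "open_set U" and "U \<subseteq> fst c"
  shows "smooth_vf M U (\<lambda>q. coord_vector M c q w)"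
proof (rule smooth_vf_subset[OF _ \<open>U \<subseteq> fst c\<close>])
  show "smooth_vf M (fst c) (\<lambda>q. coord_vector M c q w)"
    unfolding smooth_vf_def
  proof
    fix d assume d: "d \<in> atlas"
    let ?S = "snd d ` (fst c \<inter> fst d)" and ?T = "snd c ` (fst d \<inter> fst c)"
    have S: "open ?S" and T: "open ?T"
      using open_chart_image[OF d chart_open[OF c]] open_chart_image[OF c chart_open[OF d]] by simp_all
    have "smooth_on ?S (\<lambda>y. frechet_derivative (snd d \<circ> cinv c) (at ((snd c \<circ> cinv d) y)) w)"
    proof (rule smooth_on_compose[OF S T, where g = "snd c \<circ> cinv d"])
      show "smooth_on ?T (\<lambda>x. frechet_derivative (snd d \<circ> cinv c) (at x) w)"
        using smooth_on_frechet_derivative[OF transition_smooth[OF c d]] by (simp add: Int_commute)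
      show "smooth_on ?S (snd c \<circ> cinv d)" using transition_smooth[OF d c] by (simp add: Int_commute)
      show "(snd c \<circ> cinv d) ` ?S \<subseteq> ?T" using cinv_in[OF d] by fastforce
    qed
    moreover have "frechet_derivative (snd d \<circ> cinv c) (at ((snd c \<circ> cinv d) y)) w =
        components M d (cinv d y) (coord_vector M c (cinv d y) w)" if "y \<in> ?S" for y
      using components_coord_vector[OF c cinv_in(1)[OF d that] d cinv_in(2)[OF d that]] by (simp add: jacobian_def)
    ultimately show "smooth_on ?S (\<lambda>y. components M d (cinv d y) (coord_vector M c (cinv d y) w))"
      using smooth_on_cong[OF S] by (metis (no_types, lifting))
  qed
qed

section \<open>Smooth form fields through their coefficients in charts\<close>

definition local_form :: "('m, 'e) chart \<Rightarrow> 'e list \<Rightarrow> ('m, 'e) form_field \<Rightarrow> 'e \<Rightarrow> complex" where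
  "local_form c ws \<phi> x = \<phi> (cinv c x) (map (coord_vector M c (cinv c x)) ws)"

lemma smooth_form_field_iff: "smooth_form_field M U \<phi> \<longleftrightarrow> (\<forall>q\<in>U. \<phi> q \<in> forms) \<and>
    (\<forall>c\<in>atlas. \<forall>ws. smooth_on (snd c ` (U \<inter> fst c)) (local_form c ws \<phi>))"
  by (simp add: smooth_form_field_def local_form_def[abs_def])

text \<open>The values of \<open>cinv\<close> outside the chart image are arbitrary. An explicit
  coordinate expression \<open>f\<close> therefore has to match the field only at points of the
  manifold, and openness of the image does the rest.\<close>

lemma smooth_form_fieldI:
  assumes U: "open_set U" and "\<And>q. q \<in> U \<Longrightarrow> \<phi> q \<in> forms"
    and sm: "\<And>c ws. c \<in> atlas \<Longrightarrow> smooth_on (snd c ` (U \<inter> fst c)) (f c ws)"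
    and eq: "\<And>c ws q. c \<in> atlas \<Longrightarrow> q \<in> U \<Longrightarrow> q \<in> fst c \<Longrightarrow> f c ws (snd c q) = \<phi> q (map (coord_vector M c q) ws)"
  shows "smooth_form_field M U \<phi>"
proof -
  have "smooth_on (snd c ` (U \<inter> fst c)) (local_form c ws \<phi>)" if c: "c \<in> atlas" for c ws
  proof -
    have "f c ws x = local_form c ws \<phi> x" if "x \<in> snd c ` (U \<inter> fst c)" for x
      using eq[OF c cinv_in(1,2)[OF c that]] cinv_in(3)[OF c that] by (simp add: local_form_def)
    then show ?thesis using smooth_on_cong[OF open_chart_image[OF c U]] sm[OF c] by metis
  qed
  then show ?thesis using assms(2) by (simp add: smooth_form_field_iff)
qed

lemma smooth_form_fieldD: "smooth_form_field M U \<phi> \<Longrightarrow> q \<in> U \<Longrightarrow> \<phi> q \<in> forms"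
  and local_form_smooth: "smooth_form_field M U \<phi> \<Longrightarrow> c \<in> atlas \<Longrightarrow> smooth_on (snd c ` (U \<inter> fst c)) (local_form c ws \<phi>)"
  by (simp_all add: smooth_form_field_iff)

lemma local_form_chart: "c \<in> atlas \<Longrightarrow> q \<in> fst c \<Longrightarrow> local_form c ws \<phi> (snd c q) = \<phi> q (map (coord_vector M c q) ws)"
  by (simp add: local_form_def cinv_chart)

lemma smooth_form_field_cong:
  assumes U: "open_set U" and eq: "\<And>q. q \<in> U \<Longrightarrow> \<phi> q = \<psi> q" and \<phi>: "smooth_form_field M U \<phi>"
  shows "smooth_form_field M U \<psi>"
proof (rule smooth_form_fieldI[OF U, where f = "\<lambda>c ws. local_form c ws \<phi>"])
  show "\<psi> q \<in> forms" if "q \<in> U" for q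
    using smooth_form_fieldD[OF \<phi> that] eq[OF that] by simp
qed (use eq \<phi> in \<open>simp_all add: local_form_chart local_form_smooth\<close>)

lemma smooth_form_field_add:
  assumes U: "open_set U" and "smooth_form_field M U \<phi>" "smooth_form_field M U \<psi>"
  shows "smooth_form_field M U (\<lambda>q. \<phi> q + \<psi> q)"
  by (rule smooth_form_fieldI[OF U, where f = "\<lambda>c ws x. local_form c ws \<phi> x + local_form c ws \<psi> x"])
     (use assms in \<open>simp_all add: plus_fun_apply local_form_chart smooth_on_add open_chart_image local_form_smooth
       forms_add smooth_form_fieldD\<close>)

lemma smooth_form_field_csmul:
  assumes U: "open_set U" and f: "smooth_fun M U f" and \<phi>: "smooth_form_field M U \<phi>"
  shows "smooth_form_field M U (\<lambda>q. f q \<odot> \<phi> q)"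
  by (rule smooth_form_fieldI[OF U, where f = "\<lambda>c ws x. f (cinv c x) * local_form c ws \<phi> x"])
     (use assms in \<open>auto simp: form_apply local_form_chart cinv_chart smooth_fun_def intro!: smooth_on_mult open_chart_image
       local_form_smooth forms_csmul smooth_form_fieldD\<close>)

lemma smooth_form_field_sum:
  assumes U: "open_set U" and "\<And>i. i \<in> I \<Longrightarrow> smooth_form_field M U (\<phi> i)"
  shows "smooth_form_field M U (\<lambda>q. \<Sum>i\<in>I. \<phi> i q)"
  by (rule smooth_form_fieldI[OF U, where f = "\<lambda>c ws x. \<Sum>i\<in>I. local_form c ws (\<phi> i) x"])
     (use assms in \<open>auto simp: sum_fun_apply local_form_chart intro!: smooth_on_sum open_chart_image
       local_form_smooth forms_sum smooth_form_fieldD\<close>)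

lemma smooth_form_field_weight:
  assumes U: "open_set U" and \<phi>: "smooth_form_field M U \<phi>"
  shows "smooth_form_field M U (\<lambda>q ws. a (length ws) * \<phi> q ws)"
proof (rule smooth_form_fieldI[OF U, where f = "\<lambda>c ws x. a (length ws) * local_form c ws \<phi> x"])
  show "(\<lambda>ws. a (length ws) * \<phi> q ws) \<in> forms" if "q \<in> U" for q
    using smooth_form_fieldD[OF \<phi> that] by (auto simp: forms_def linear_iff algebra_simps)
qed (use assms in \<open>auto simp: local_form_chart intro!: smooth_on_mult smooth_on_const open_chart_image local_form_smooth\<close>)

lemma smooth_form_field_degree_part:
  "open_set U \<Longrightarrow> smooth_form_field M U \<phi> \<Longrightarrow> smooth_form_field M U (\<lambda>q. degree_part k (\<phi> q))"
  by (rule smooth_form_field_cong[OF _ _ smooth_form_field_weight[where a = "\<lambda>l. if l = k then 1 else 0"]])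
     (auto simp: degree_part_def fun_eq_iff)

lemma smooth_form_field_grade_sign:
  "open_set U \<Longrightarrow> smooth_form_field M U \<phi> \<Longrightarrow> smooth_form_field M U (\<lambda>q. grade_sign (\<phi> q))"
  by (rule smooth_form_field_cong[OF _ _ smooth_form_field_weight[where a = "\<lambda>l. (-1) ^ l"]])
     (auto simp: grade_sign_def)

lemma inner_metric: "q \<in> topspace (ah_top M) \<Longrightarrow> inner_product (G q)"
  using mfd by (simp add: almost_hermitian_manifold_def)

lemma in_open_topspace: "open_set U \<Longrightarrow> q \<in> U \<Longrightarrow> q \<in> topspace (ah_top M)"
  using openin_subset by blast

text \<open>\<open>X\<close> expands in the coordinate fields with smooth coefficients, and
  contracting with a coordinate field only adds a direction \<open>b\<close> to the list of a local
  coefficient.\<close>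

lemma smooth_form_field_contraction:
  assumes U: "open_set U" and X: "smooth_vf M U X" and \<phi>: "smooth_form_field M U \<phi>"
  shows "smooth_form_field M U (\<lambda>q. contraction (X q) (\<phi> q))"
proof (rule smooth_form_fieldI[OF U, where f = "\<lambda>c ws x. \<Sum>b\<in>Basis.
    (components M c (cinv c x) (X (cinv c x)) \<bullet> b) *\<^sub>R local_form c (b # ws) \<phi> x"])
  show "smooth_on (snd c ` (U \<inter> fst c)) (\<lambda>x. \<Sum>b\<in>Basis.
      (components M c (cinv c x) (X (cinv c x)) \<bullet> b) *\<^sub>R local_form c (b # ws) \<phi> x)" if c: "c \<in> atlas" for c ws
    using X c
    by (intro smooth_on_sum smooth_on_scaleR smooth_on_bounded_linear[OF _ bounded_linear_inner_left]
          open_chart_image local_form_smooth[OF \<phi>] U) (simp_all add: smooth_vf_def)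
  fix c ws q assume c: "c \<in> atlas" "q \<in> fst c" and q: "q \<in> U"
  let ?a = "\<lambda>b. components M c q (X q) \<bullet> b" and ?u = "coord_vector M c q"
  have "contraction (X q) (\<phi> q) = (\<Sum>b\<in>Basis. complex_of_real (?a b) \<odot> contraction (?u b) (\<phi> q))"
    by (subst coord_vector_expand[OF c, of "X q"]) (rule contraction_sum_left[OF smooth_form_fieldD[OF \<phi> q]])
  then show "(\<Sum>b\<in>Basis. (components M c (cinv c (snd c q)) (X (cinv c (snd c q))) \<bullet> b) *\<^sub>R local_form c (b # ws) \<phi> (snd c q)) =
      contraction (X q) (\<phi> q) (map ?u ws)"
    using c by (simp add: cinv_chart local_form_chart sum_fun_apply form_apply scaleR_conv_of_real)
       (simp add: contraction_def)
qed (use smooth_form_fieldD[OF \<phi>] in \<open>auto intro: forms_contraction\<close>)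

lemma smooth_form_field_vwedge:
  assumes U: "open_set U" and X: "smooth_vf M U X" and \<phi>: "smooth_form_field M U \<phi>"
  shows "smooth_form_field M U (\<lambda>q. vwedge (G q) (X q) (\<phi> q))"
proof (rule smooth_form_fieldI[OF U, where f = "\<lambda>c ws x. \<Sum>i<length ws. ((-1) ^ i *
    complex_of_real (G (cinv c x) (X (cinv c x)) (coord_vector M c (cinv c x) (ws ! i)))) *
    local_form c (remove_nth i ws) \<phi> x"])
  fix c ws assume c: "c \<in> atlas"
  \<comment> \<open>Coordinate fields of \<open>c\<close> are smooth on the chart domain only, so
    the metric coefficient is treated on \<open>U \<inter> fst c\<close>.\<close>
  have "smooth_fun M (U \<inter> fst c) (\<lambda>q. G q (X q) (coord_vector M c q w))" for w
    using X open_set_Int_chart[OF U c]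
    by (intro smooth_fun_metric smooth_vf_coord_vector[OF c]) (auto intro: smooth_vf_subset)
  then have "smooth_on (snd c ` (U \<inter> fst c \<inter> fst c)) (\<lambda>x. G (cinv c x) (X (cinv c x)) (coord_vector M c (cinv c x) w))" for w
    using c unfolding smooth_fun_def by blast
  then have *: "smooth_on (snd c ` (U \<inter> fst c)) (\<lambda>x. G (cinv c x) (X (cinv c x)) (coord_vector M c (cinv c x) w))" for w
    by (simp add: Int_assoc)
  show "smooth_on (snd c ` (U \<inter> fst c)) (\<lambda>x. \<Sum>i<length ws. ((-1) ^ i *
      complex_of_real (G (cinv c x) (X (cinv c x)) (coord_vector M c (cinv c x) (ws ! i)))) *
      local_form c (remove_nth i ws) \<phi> x)"
    by (intro smooth_on_sum smooth_on_mult smooth_on_const smooth_on_bounded_linear[OF _ bounded_linear_of_real]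
          open_chart_image local_form_smooth[OF \<phi>] c U *)
next
  show "vwedge (G q) (X q) (\<phi> q) \<in> forms" if "q \<in> U" for q
    using forms_vwedge[OF inner_metric[OF in_open_topspace[OF U that]] smooth_form_fieldD[OF \<phi> that]] .
qed (simp add: cinv_chart local_form_chart vwedge_def remove_nth_def take_map drop_map)

lemma smooth_form_field_left_mult:
  assumes U: "open_set U" and X: "smooth_vf M U X" and \<phi>: "smooth_form_field M U \<phi>"
  shows "smooth_form_field M U (\<lambda>q. left_mult (G q) (X q) (\<phi> q))"
proof -
  have "smooth_form_field M U (\<lambda>q. (-1) \<odot> contraction (X q) (\<phi> q))"
    by (intro smooth_form_field_csmul smooth_fun_const smooth_form_field_contraction assms)
  from smooth_form_field_add[OF U smooth_form_field_vwedge[OF U X \<phi>] this]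
  show ?thesis by (rule smooth_form_field_cong[OF U, rotated]) (simp add: form_apply left_mult_def)
qed

lemma smooth_form_field_right_mult:
  assumes U: "open_set U" and X: "smooth_vf M U X" and \<phi>: "smooth_form_field M U \<phi>"
  shows "smooth_form_field M U (\<lambda>q. right_mult (G q) (X q) (\<phi> q))"
  using smooth_form_field_add[OF U smooth_form_field_vwedge[OF U X smooth_form_field_grade_sign[OF U \<phi>]]
      smooth_form_field_contraction[OF U X smooth_form_field_grade_sign[OF U \<phi>]]]
  by (rule smooth_form_field_cong[OF U, rotated]) (simp add: form_apply right_mult_def)

lemma smooth_form_field_one: "open_set U \<Longrightarrow> smooth_form_field M U (\<lambda>q. one_form0)"
  by (rule smooth_form_fieldI[where f = "\<lambda>c ws x. if ws = [] then 1 else 0"])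
     (auto simp: one_form0_def[abs_def] forms_one[unfolded one_form0_def] intro!: smooth_on_const open_chart_image)

lemma smooth_form_field_flat:
  "open_set U \<Longrightarrow> smooth_vf M U X \<Longrightarrow> smooth_form_field M U (\<lambda>q. flat (G q) (X q))"
  using smooth_form_field_left_mult[OF _ _ smooth_form_field_one, of U X] by (simp add: left_mult_one)

lemma smooth_fun_form_Nil: "smooth_form_field M U \<phi> \<Longrightarrow> smooth_fun M U (\<lambda>q. \<phi> q [])"
  using local_form_smooth[of U \<phi> _ "[]"] by (simp add: smooth_fun_def local_form_def[abs_def])

end

section \<open>Local adapted frames\<close>

context almost_hermitian_mfd
begin

lemma linear_J_at: "q \<in> topspace (ah_top M) \<Longrightarrow> linear (J q)"
  and J_J_at: "q \<in> topspace (ah_top M) \<Longrightarrow> J q (J q u) = - u"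
  and G_J_J_at: "q \<in> topspace (ah_top M) \<Longrightarrow> G q (J q u) (J q w) = G q u w"
  using mfd by (simp_all add: almost_hermitian_manifold_def)

lemma metric_at:
  assumes "q \<in> topspace (ah_top M)"
  shows metric_sym: "G q u w = G q w u"
    and metric_linear: "linear (G q u)"
    and metric_pos: "u \<noteq> 0 \<Longrightarrow> G q u u > 0"
  using inner_metric[OF assms] by (simp_all add: inner_product_def)

lemma metric_J_left:
  assumes q: "q \<in> topspace (ah_top M)"
  shows "G q (J q u) w = - G q u (J q w)"
proof -
  have "G q (J q u) (J q (J q w)) = G q u (J q w)" by (rule G_J_J_at[OF q])
  then show ?thesis by (simp add: J_J_at[OF q] linear_neg[OF metric_linear[OF q]])
qed

lemma metric_J_self: "q \<in> topspace (ah_top M) \<Longrightarrow> G q u (J q u) = 0"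
  using metric_J_left[of q u u] metric_sym[of q "J q u" u] by simp

text \<open>Read in the chart, \<open>f\<close> is continuous, so positivity is an open condition
  there. This lets a neighbourhood shrink to where the length of a field stays positive.\<close>

lemma open_set_pos:
  assumes c: "c \<in> atlas" and U: "open_set U" "U \<subseteq> fst c" and f: "smooth_fun M U f"
  shows "open_set {q \<in> U. f q > (0::real)}"
proof -
  let ?S = "snd c ` (U \<inter> fst c)"
  have "continuous_on ?S (\<lambda>x. f (cinv c x))"
    using f c by (intro smooth_on_imp_continuous_on) (simp add: smooth_fun_def)
  then have "open (?S \<inter> (\<lambda>x. f (cinv c x)) -` {0<..})"
    using open_chart_image[OF c U(1)] by (intro continuous_open_preimage) auto
  moreover have "{q \<in> fst c. snd c q \<in> ?S \<inter> (\<lambda>x. f (cinv c x)) -` {0<..}} = {q \<in> U. f q > 0}"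
  proof (intro set_eqI iffI)
    fix q assume "q \<in> {q \<in> fst c. snd c q \<in> ?S \<inter> (\<lambda>x. f (cinv c x)) -` {0<..}}"
    then have "q \<in> fst c" "snd c q \<in> ?S" "f (cinv c (snd c q)) > 0" by simp_all
    then show "q \<in> {q \<in> U. f q > 0}" using cinv_in(1)[OF c] cinv_chart[OF c] by fastforce
  next
    fix q assume "q \<in> {q \<in> U. f q > 0}"
    then show "q \<in> {q \<in> fst c. snd c q \<in> ?S \<inter> (\<lambda>x. f (cinv c x)) -` {0<..}}"
      using U(2) cinv_chart[OF c] by auto
  qed
  ultimately show ?thesis
    using open_set_chart_preimage[OF c, of "?S \<inter> (\<lambda>x. f (cinv c x)) -` {0<..}"] by (simp only:)
qed

text \<open>Gram-Schmidt over the complex numbers: each step adds a field orthogonal to the earlier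
  fields and to their images under J, shrinking the neighbourhood as required.\<close>

lemma partial_adapted_frame:
  assumes p: "p \<in> topspace (ah_top M)" and n: "DIM('e) = 2 * n" and "k \<le> n"
  shows "\<exists>U E. open_set U \<and> p \<in> U \<and> (\<forall>i<k. smooth_vf M U (E i)) \<and>
    (\<forall>q\<in>U. \<forall>i<k. \<forall>j<k. G q (E i q) (E j q) = (if i = j then 1 else 0) \<and> G q (E i q) (J q (E j q)) = 0)"
  using \<open>k \<le> n\<close>
proof (induction k)
  case 0
  then show ?case using p by (intro exI[of _ "topspace (ah_top M)"]) auto
next
  case (Suc k)
  then obtain U E where U: "open_set U" "p \<in> U" and E: "\<And>i. i < k \<Longrightarrow> smooth_vf M U (E i)"
    and ortho: "\<And>q i j. q \<in> U \<Longrightarrow> i < k \<Longrightarrow> j < k \<Longrightarrow> G q (E i q) (E j q) = (if i = j then 1 else 0)"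
      "\<And>q i j. q \<in> U \<Longrightarrow> i < k \<Longrightarrow> j < k \<Longrightarrow> G q (E i q) (J q (E j q)) = 0"
    by (metis Suc_leD)
  define c where "c = chart_at M p"
  have c: "c \<in> atlas" "p \<in> fst c" using chart_at[OF p] by (simp_all add: c_def)
  \<comment> \<open>The earlier fields and their J-images span at most 2k < 2n dimensions at
    \<open>p\<close>. A vector outside, extended with constant coordinates in the chart, is the raw
    material for the next field.\<close>
  let ?B = "(\<lambda>i. E i p) ` {..<k} \<union> (\<lambda>i. J p (E i p)) ` {..<k}"
  have "card ?B \<le> k + k"
    by (rule order_trans[OF card_Un_le add_mono]) (use card_image_le[of "{..<k}"] in auto)
  then have "dim ?B < DIM('e)" using dim_le_card'[of ?B] n Suc.prems by simp
  then have "span ?B \<noteq> UNIV" by (metis dim_UNIV dim_span less_irrefl)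
  then obtain u where u: "u \<notin> span ?B" by blast
  define V where "V = U \<inter> fst c"
  have V: "open_set V" "p \<in> V" "V \<subseteq> fst c" "V \<subseteq> U"
    using U c open_set_Int_chart by (auto simp: V_def)
  have top: "q \<in> topspace (ah_top M)" if "q \<in> V" for q using in_open_topspace[OF V(1) that] .
  define W where "W q = coord_vector M c q u" for q
  have W: "smooth_vf M V W"
    unfolding W_def using smooth_vf_coord_vector[OF c(1) V(1,3)] .
  have EV: "smooth_vf M V (E i)" if "i < k" for i using smooth_vf_subset[OF E[OF that] V(4)] .
  have JEV: "smooth_vf M V (\<lambda>q. J q (E i q))" if "i < k" for i using smooth_vf_J[OF V(1) EV[OF that]] .
  \<comment> \<open>The two sums form the orthogonal projection of \<open>W\<close> to the complex
    span of the earlier fields. This span is invariant under J, so J Z will be orthogonal to it as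
    well.\<close>
  define Z where "Z q = W q - (\<Sum>i<k. G q (W q) (E i q) *\<^sub>R E i q) - (\<Sum>i<k. G q (W q) (J q (E i q)) *\<^sub>R J q (E i q))" for q
  have Z: "smooth_vf M V Z"
    unfolding Z_def
    by (intro smooth_vf_diff smooth_vf_sum smooth_vf_scaleR smooth_fun_metric V(1) W EV JEV)
  have orthoE: "G q (E i q) (E j q) = (if i = j then 1 else 0)" "G q (E i q) (J q (E j q)) = 0"
    "G q (J q (E i q)) (J q (E j q)) = (if i = j then 1 else 0)" "G q (J q (E i q)) (E j q) = 0"
    if "q \<in> V" "i < k" "j < k" for q i j
    using ortho[of q i j] ortho[of q j i] that V(4) top[OF that(1)]
      metric_J_left[OF top[OF that(1)], of "E i q" "E j q"] by (auto simp: G_J_J_at)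
  have GZ: "G q w (Z q) = G q w (W q) - (\<Sum>i<k. G q (W q) (E i q) * G q w (E i q))
      - (\<Sum>i<k. G q (W q) (J q (E i q)) * G q w (J q (E i q)))" if "q \<in> V" for q w
    using metric_linear[OF top[OF that], of w]
    by (simp add: Z_def linear_diff linear_sum linear_cmul)
  have Z_ortho: "G q (E j q) (Z q) = 0" "G q (J q (E j q)) (Z q) = 0" if "q \<in> V" "j < k" for q j
  proof -
    have "(\<Sum>i<k. a i * (if j = i then 1 else 0)) = a j" for a :: "nat \<Rightarrow> real"
    proof -
      have "(\<Sum>i<k. a i * (if j = i then 1 else 0)) = (\<Sum>i<k. if j = i then a i else 0)"
        by (intro sum.cong) auto
      then show ?thesis using that by simp
    qed
    then show "G q (E j q) (Z q) = 0" "G q (J q (E j q)) (Z q) = 0"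
      using that metric_sym[OF top[OF that(1)], of "W q"] by (simp_all add: GZ orthoE)
  qed
  have Wp: "W p = u" by (simp add: W_def c_def coord_vector_def jacobian_same chart_at[OF p])
  have "Z p \<noteq> 0"
  proof
    assume "Z p = 0"
    with Wp have "u = (\<Sum>i<k. G p (W p) (E i p) *\<^sub>R E i p) + (\<Sum>i<k. G p (W p) (J p (E i p)) *\<^sub>R J p (E i p))"
      by (simp add: Z_def algebra_simps)
    also have "\<dots> \<in> span ?B" by (intro span_add span_sum span_scale span_base) auto
    finally show False using u by contradiction
  qed
  define f where "f q = G q (Z q) (Z q)" for q
  have f: "smooth_fun M V f" unfolding f_def by (intro smooth_fun_metric V(1) Z)
  \<comment> \<open>\<open>Z\<close> is known to be nonzero at \<open>p\<close> only; dividing by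
    its length requires a neighbourhood on which it stays nonzero.\<close>
  define V' where "V' = {q \<in> V. f q > 0}"
  have V': "open_set V'" "p \<in> V'" "V' \<subseteq> V"
    using open_set_pos[OF c(1) V(1,3) f] V(2) metric_pos[OF p \<open>Z p \<noteq> 0\<close>] by (auto simp: V'_def f_def)
  define E' where "E' i = (if i = k then (\<lambda>q. f q powr (-1/2) *\<^sub>R Z q) else E i)" for i
  have new: "smooth_vf M V' (\<lambda>q. f q powr (-1/2) *\<^sub>R Z q)"
    by (intro smooth_vf_scaleR smooth_fun_powr V' smooth_fun_subset[OF f V'(3)] smooth_vf_subset[OF Z V'(3)])
       (simp add: V'_def)
  have "smooth_vf M V' (E' i)" if "i < Suc k" for i
    using new smooth_vf_subset[OF EV V'(3)] that by (auto simp: E'_def)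
  moreover have "G q (E' i q) (E' j q) = (if i = j then 1 else 0) \<and> G q (E' i q) (J q (E' j q)) = 0"
    if q: "q \<in> V'" and ij: "i < Suc k" "j < Suc k" for q i j
  proof -
    let ?r = "f q powr (-1/2)"
    have qV: "q \<in> V" using q V'(3) by blast
    note t = top[OF qV]
    have scale: "G q x (r *\<^sub>R y) = r * G q x y" "G q (r *\<^sub>R y) x = r * G q y x" "J q (r *\<^sub>R y) = r *\<^sub>R J q y" for r x y
      using linear_cmul[OF metric_linear[OF t]] linear_cmul[OF linear_J_at[OF t]] metric_sym[OF t, of "r *\<^sub>R y"]
        metric_sym[OF t, of y] by simp_all
    have "f q > 0" using q by (simp add: V'_def)
    then have "?r * ?r = inverse (f q)" unfolding powr_add[symmetric] by (simp add: powr_minus)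
    then have unit: "?r * (?r * G q (Z q) (Z q)) = 1"
      using \<open>f q > 0\<close> by (simp add: f_def mult.assoc[symmetric])
    have JZ: "G q (E l q) (J q (Z q)) = 0" "G q (Z q) (J q (E l q)) = 0" "G q (Z q) (E l q) = 0" if "l < k" for l
      using Z_ortho[OF qV that] metric_J_left[OF t, of "E l q" "Z q"] metric_sym[OF t, of "Z q"] by simp_all
    show ?thesis
      using ij orthoE[OF qV] Z_ortho[OF qV] JZ unit metric_J_self[OF t, of "Z q"]
      by (cases "i = k"; cases "j = k") (simp_all add: E'_def scale)
  qed
  ultimately show ?case using V' by blast
qed

lemma local_adapted_frame:
  assumes p: "p \<in> topspace (ah_top M)" and n: "DIM('e) = 2 * n"
  obtains U E where "open_set U" "p \<in> U" "\<And>i. i < n \<Longrightarrow> smooth_vf M U (E i)"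
    "\<And>q. q \<in> U \<Longrightarrow> adapted_frame (G q) (J q) (\<lambda>i. E i q)"
proof -
  obtain U E where U: "open_set U" "p \<in> U" and E: "\<And>i. i < n \<Longrightarrow> smooth_vf M U (E i)"
    and ortho: "\<And>q i j. q \<in> U \<Longrightarrow> i < n \<Longrightarrow> j < n \<Longrightarrow> G q (E i q) (E j q) = (if i = j then 1 else 0)"
      "\<And>q i j. q \<in> U \<Longrightarrow> i < n \<Longrightarrow> j < n \<Longrightarrow> G q (E i q) (J q (E j q)) = 0"
    using partial_adapted_frame[OF p n order_refl] by metis
  have half: "DIM('e) div 2 = n" using n by simp
  have "adapted_frame (G q) (J q) (\<lambda>i. E i q)" if q: "q \<in> U" for q
    unfolding adapted_frame_def orthonormal_basis_def half
  proof (intro allI impI)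
    fix j k assume "j < DIM('e)" "k < DIM('e)"
    then have jk: "j < 2 * n" "k < 2 * n" using n by simp_all
    note t = in_open_topspace[OF U(1) q]
    show "G q (if j < n then E j q else J q (E (j - n) q)) (if k < n then E k q else J q (E (k - n) q)) =
        (if j = k then 1 else 0)"
      using ortho[OF q, of j k] ortho(2)[OF q, of j "k - n"] ortho(2)[OF q, of "j - n" k] ortho(1)[OF q, of "j - n" "k - n"] jk
        metric_J_left[OF t, of "E (j - n) q" "E k q"]
      by (auto simp: G_J_J_at[OF t])
  qed
  with U E that show ?thesis by blast
qed

lemma local_orthonormal_frame:
  assumes p: "p \<in> topspace (ah_top M)" and n: "DIM('e) = 2 * n"
  obtains U V where "open_set U" "p \<in> U" "\<And>j. j < DIM('e) \<Longrightarrow> smooth_vf M U (V j)"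
    "\<And>q. q \<in> U \<Longrightarrow> orthonormal_basis (G q) (\<lambda>j. V j q)"
proof -
  obtain U E where U: "open_set U" "p \<in> U" and E: "\<And>i. i < n \<Longrightarrow> smooth_vf M U (E i)"
    and ad: "\<And>q. q \<in> U \<Longrightarrow> adapted_frame (G q) (J q) (\<lambda>i. E i q)"
    using local_adapted_frame[OF p n] by metis
  let ?V = "\<lambda>j q. if j < n then E j q else J q (E (j - n) q)"
  have half: "DIM('e) div 2 = n" using n by simp
  have V: "smooth_vf M U (?V j)" if "j < DIM('e)" for j
    using E[of j] smooth_vf_J[OF U(1) E, of "j - n"] that n by (cases "j < n") simp_all
  have "orthonormal_basis (G q) (\<lambda>j. ?V j q)" if "q \<in> U" for q
    using ad[OF that] unfolding adapted_frame_def half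
    by (simp only: if_distrib[where f = "\<lambda>g. g q"] if_distribR)
  then show ?thesis by (intro that[OF U, of ?V] V)
qed

end

section \<open>Parallel operators\<close>

locale dirac_setup = almost_hermitian_mfd M
  for M :: "('m, 'e::euclidean_space, 'z) almost_hermitian_scheme" +
  fixes nabla :: "('m, 'e) connection" and D :: "('m, 'e) form_connection"
  assumes canonical: "canonical_connection M nabla" and derivation: "derivation_extension M nabla D"

text \<open>All covariant derivatives are taken at the fixed point \<open>p\<close>, but
  \<open>D\<close> acts on fields, so the orthonormal frame must be smooth on a whole
  neighbourhood.\<close>

locale framed_dirac_setup = dirac_setup M nabla D
  for M :: "('m, 'e::euclidean_space, 'z) almost_hermitian_scheme" and nabla D +
  fixes p :: 'm and U :: "'m set" and V :: "nat \<Rightarrow> 'm \<Rightarrow> 'e"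
  assumes U: "open_set U" "p \<in> U"
    and smooth_V: "j < DIM('e) \<Longrightarrow> smooth_vf M U (V j)"
    and ortho_V: "q \<in> U \<Longrightarrow> orthonormal_basis (G q) (\<lambda>j. V j q)"
begin

abbreviation "smooth \<phi> \<equiv> smooth_form_field M U \<phi>"

lemma top: "q \<in> U \<Longrightarrow> q \<in> topspace (ah_top M)"
  using in_open_topspace[OF U(1)] .

lemma hermitian_V: "q \<in> U \<Longrightarrow> hermitian_space (G q) (\<lambda>j. V j q) (J q)"
  using inner_metric ortho_V linear_J_at J_J_at G_J_J_at top
  by (intro hermitian_space.intro hermitian_space_axioms.intro clifford_space.intro) auto

lemma clifford_V: "q \<in> U \<Longrightarrow> clifford_space (G q) (\<lambda>j. V j q)"
  using hermitian_V hermitian_space.axioms(1) by blast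

lemmas smooth_forms = smooth_form_fieldD
lemmas smooth_left_mult = smooth_form_field_left_mult[OF U(1)]
lemmas smooth_right_mult = smooth_form_field_right_mult[OF U(1)]

lemma smooth_scalar: "smooth_fun M U f \<Longrightarrow> smooth (\<lambda>q. f q \<odot> one_form0)"
  by (intro smooth_form_field_csmul smooth_form_field_one U)

lemma smooth_csmul: "smooth \<phi> \<Longrightarrow> smooth (\<lambda>q. a \<odot> \<phi> q)"
  by (intro smooth_form_field_csmul smooth_fun_const U)

lemma smooth_diff:
  assumes "smooth \<phi>" "smooth \<psi>"
  shows "smooth (\<lambda>q. \<phi> q - \<psi> q)"
  using smooth_form_field_add[OF U(1) assms(1) smooth_csmul[OF assms(2), of "-1"]] by simp

text \<open>Locally every smooth form field is a sum of Clifford words in the frame with smooth coefficients.\<close>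

lemma smooth_induct [consumes 1, case_names cong scalar add left_mult]:
  assumes \<phi>: "smooth \<phi>"
    and cong: "\<And>\<phi> \<psi>. smooth \<phi> \<Longrightarrow> (\<And>q. q \<in> U \<Longrightarrow> \<phi> q = \<psi> q) \<Longrightarrow> Q \<phi> \<Longrightarrow> Q \<psi>"
    and scalar: "\<And>f. smooth_fun M U f \<Longrightarrow> Q (\<lambda>q. f q \<odot> one_form0)"
    and add: "\<And>\<phi> \<psi>. smooth \<phi> \<Longrightarrow> smooth \<psi> \<Longrightarrow> Q \<phi> \<Longrightarrow> Q \<psi> \<Longrightarrow> Q (\<lambda>q. \<phi> q + \<psi> q)"
    and mult: "\<And>j \<phi>. j < DIM('e) \<Longrightarrow> smooth \<phi> \<Longrightarrow> Q \<phi> \<Longrightarrow> Q (\<lambda>q. left_mult (G q) (V j q) (\<phi> q))"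
  shows "Q \<phi>"
proof -
  have sum: "Q (\<lambda>q. \<Sum>i<m. \<phi> i q)" if "\<And>i. i < m \<Longrightarrow> smooth (\<phi> i)" "\<And>i. i < m \<Longrightarrow> Q (\<phi> i)"
    for m :: nat and \<phi> :: "nat \<Rightarrow> ('m, 'e) form_field"
    using that
  proof (induction m)
    case 0
    have "Q (\<lambda>q. 0 \<odot> one_form0)" by (intro scalar smooth_fun_const U)
    then show ?case by simp
  next
    case (Suc m)
    have "Q (\<lambda>q. (\<Sum>i<m. \<phi> i q) + \<phi> m q)"
      using Suc by (intro add smooth_form_field_sum[OF U(1)]) auto
    then show ?case by simp
  qed
  have part: "Q (\<lambda>q. degree_part k (\<phi> q))" if "smooth \<phi>" for k \<phi>
    using that
  proof (induction k arbitrary: \<phi>)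
    case 0
    have "Q (\<lambda>q. \<phi> q [] \<odot> one_form0)" by (intro scalar smooth_fun_form_Nil 0)
    then show ?case by (simp add: degree_part_0)
  next
    case (Suc k)
    \<comment> \<open>The factor 1 / (k + 1) offsets the eigenvalue of the number operator in degree
      k + 1.\<close>
    let ?\<psi> = "\<lambda>j q. contraction (V j q) ((1 / of_nat (Suc k)) \<odot> \<phi> q)"
    have \<psi>: "smooth (?\<psi> j)" if "j < DIM('e)" for j
      by (intro smooth_form_field_contraction[OF U(1)] smooth_V that smooth_csmul Suc.prems)
    have sm: "smooth (\<lambda>q. left_mult (G q) (V j q) (degree_part k (?\<psi> j q)))" if "j < DIM('e)" for j
      by (intro smooth_left_mult smooth_V that smooth_form_field_degree_part[OF U(1)] \<psi>)
    have "Q (\<lambda>q. left_mult (G q) (V j q) (degree_part k (?\<psi> j q)))" if "j < DIM('e)" for j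
      using that by (intro mult Suc.IH smooth_form_field_degree_part[OF U(1)] \<psi>)
    then have "Q (\<lambda>q. \<Sum>j<DIM('e). left_mult (G q) (V j q) (degree_part k (?\<psi> j q)))"
      by (intro sum sm)
    moreover have "smooth (\<lambda>q. \<Sum>j<DIM('e). left_mult (G q) (V j q) (degree_part k (?\<psi> j q)))"
      using sm by (intro smooth_form_field_sum[OF U(1)]) (simp only: lessThan_iff)
    moreover have "(\<Sum>j<DIM('e). left_mult (G q) (V j q) (degree_part k (?\<psi> j q))) = degree_part (Suc k) (\<phi> q)"
      if q: "q \<in> U" for q
    proof -
      have "(\<Sum>j<DIM('e). left_mult (G q) (V j q) (degree_part k (?\<psi> j q))) =
          of_nat (Suc k) \<odot> degree_part (Suc k) ((1 / of_nat (Suc k)) \<odot> \<phi> q)"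
        using sum_left_mult_contraction[OF inner_metric[OF top[OF q]] ortho_V[OF q]
            smooth_forms[OF smooth_csmul[OF Suc.prems] q], of "Suc k" "1 / of_nat (Suc k)"]
        by (simp only: contraction_degree_part)
      also have "\<dots> = degree_part (Suc k) (\<phi> q)"
        by (auto simp: fun_eq_iff degree_part_def form_apply simp del: of_nat_Suc)
      finally show ?thesis .
    qed
    ultimately show ?case by (rule cong[rotated 2]) auto
  qed
  have "Q (\<lambda>q. \<Sum>k<Suc DIM('e). degree_part k (\<phi> q))"
    by (intro sum part smooth_form_field_degree_part[OF U(1)] \<phi>)
  moreover have "smooth (\<lambda>q. \<Sum>k<Suc DIM('e). degree_part k (\<phi> q))"
    by (intro smooth_form_field_sum smooth_form_field_degree_part U(1) \<phi>)
  moreover have "(\<Sum>k<Suc DIM('e). degree_part k (\<phi> q)) = \<phi> q" if "q \<in> U" for q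
    using sum_degree_part[OF smooth_forms[OF \<phi> that]] by (simp only: lessThan_Suc_atMost)
  ultimately show ?thesis by (rule cong[rotated 2]) auto
qed

subsection \<open>Rules for the covariant derivative\<close>

lemma D_forms: "smooth \<phi> \<Longrightarrow> D p w \<phi> \<in> forms"
  and D_cong: "smooth \<phi> \<Longrightarrow> smooth \<psi> \<Longrightarrow> \<forall>q\<in>U. \<phi> q = \<psi> q \<Longrightarrow> D p w \<phi> = D p w \<psi>"
  and D_plus: "smooth \<phi> \<Longrightarrow> smooth \<psi> \<Longrightarrow> D p w (\<phi> + \<psi>) = D p w \<phi> + D p w \<psi>"
  and D_clifford: "smooth \<phi> \<Longrightarrow> smooth \<psi> \<Longrightarrow> D p w (\<lambda>q. clifford (G q) (\<phi> q) (\<psi> q)) =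
    clifford (G p) (D p w \<phi>) (\<psi> p) + clifford (G p) (\<phi> p) (D p w \<psi>)"
  and D_scalar: "smooth_fun M U f \<Longrightarrow> D p w (\<lambda>q. f q \<odot> one_form0) = dir_deriv M p w f \<odot> one_form0"
  and D_flat: "smooth_vf M U Y \<Longrightarrow> D p w (\<lambda>q. flat (G q) (Y q)) = flat (G p) (nabla p w Y)"
  using derivation[unfolded derivation_extension_def, rule_format, of U p w] U by blast+

lemma D_add: "smooth \<phi> \<Longrightarrow> smooth \<psi> \<Longrightarrow> D p w (\<lambda>q. \<phi> q + \<psi> q) = D p w \<phi> + D p w \<psi>"
  using D_plus[of \<phi> \<psi> w] plus_fun_def[of \<phi> \<psi>] by metis

lemma clifford_space_p: "clifford_space (G p) (\<lambda>j. V j p)"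
  using clifford_V[OF U(2)] .

text \<open>The product rule of \<open>D\<close> is stated for fields written with
  \<open>clifford\<close>. Rewriting \<open>left_mult\<close> in that form goes through
  \<open>D_cong\<close>, which asks for smoothness of both expressions.\<close>

lemma D_left_mult:
  assumes Y: "smooth_vf M U Y" and \<phi>: "smooth \<phi>"
  shows "D p w (\<lambda>q. left_mult (G q) (Y q) (\<phi> q)) =
    left_mult (G p) (nabla p w Y) (\<phi> p) + left_mult (G p) (Y p) (D p w \<phi>)"
proof -
  have eq: "\<forall>q\<in>U. left_mult (G q) (Y q) (\<phi> q) = clifford (G q) (flat (G q) (Y q)) (\<phi> q)"
    using clifford_space.clifford_flat_left[OF clifford_V smooth_forms[OF \<phi>]] by simp
  have sm: "smooth (\<lambda>q. left_mult (G q) (Y q) (\<phi> q))" by (rule smooth_left_mult[OF Y \<phi>])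
  then have "smooth (\<lambda>q. clifford (G q) (flat (G q) (Y q)) (\<phi> q))"
    by (rule smooth_form_field_cong[OF U(1), rotated]) (use eq in simp)
  from D_cong[OF sm this eq] show ?thesis
    using D_clifford[OF smooth_form_field_flat[OF U(1) Y] \<phi>]
      clifford_space.clifford_flat_left[OF clifford_space_p] smooth_forms[OF \<phi> U(2)] D_forms[OF \<phi>] D_flat[OF Y]
    by simp
qed

lemma D_right_mult:
  assumes Y: "smooth_vf M U Y" and \<phi>: "smooth \<phi>"
  shows "D p w (\<lambda>q. right_mult (G q) (Y q) (\<phi> q)) =
    right_mult (G p) (nabla p w Y) (\<phi> p) + right_mult (G p) (Y p) (D p w \<phi>)"
proof -
  have eq: "\<forall>q\<in>U. right_mult (G q) (Y q) (\<phi> q) = clifford (G q) (\<phi> q) (flat (G q) (Y q))"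
    using clifford_space.clifford_flat_right[OF clifford_V smooth_forms[OF \<phi>]] by simp
  have sm: "smooth (\<lambda>q. right_mult (G q) (Y q) (\<phi> q))" by (rule smooth_right_mult[OF Y \<phi>])
  then have "smooth (\<lambda>q. clifford (G q) (\<phi> q) (flat (G q) (Y q)))"
    by (rule smooth_form_field_cong[OF U(1), rotated]) (use eq in simp)
  from D_cong[OF sm this eq] show ?thesis
    using D_clifford[OF \<phi> smooth_form_field_flat[OF U(1) Y]]
      clifford_space.clifford_flat_right[OF clifford_space_p] smooth_forms[OF \<phi> U(2)] D_forms[OF \<phi>] D_flat[OF Y]
    by (simp add: add.commute)
qed

lemma dir_deriv_locally_const:
  assumes "\<And>q. q \<in> U \<Longrightarrow> f q = a"
  shows "dir_deriv M p w f = 0"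
proof -
  define c where "c = chart_at M p"
  have c: "c \<in> atlas" "p \<in> fst c" using chart_at[OF top[OF U(2)]] by (simp_all add: c_def)
  have "((\<lambda>x. a) has_derivative (\<lambda>v. 0)) (at (snd c p))" by (rule has_derivative_const)
  then have "((\<lambda>x. f (cinv c x)) has_derivative (\<lambda>v. 0)) (at (snd c p))"
    by (rule has_derivative_transform_within_open[OF _ open_chart_image[OF c(1) U(1)]])
       (use U(2) c assms cinv_in(1)[OF c(1)] in auto)
  then have "frechet_derivative (\<lambda>x. f (cinv c x)) (at (snd c p)) = (\<lambda>v. 0)"
    by (rule frechet_derivative_at[symmetric])
  then show ?thesis by (simp add: dir_deriv_def c_def)
qed

text \<open>The product rule for the constant field a times 1, whose derivative vanishes by the rule
  for scalars.\<close>

lemma D_csmul: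
  assumes \<phi>: "smooth \<phi>"
  shows "D p w (\<lambda>q. a \<odot> \<phi> q) = a \<odot> D p w \<phi>"
proof -
  have a: "smooth (\<lambda>q. a \<odot> one_form0)" by (intro smooth_csmul smooth_form_field_one U)
  have "clifford (G q) (a \<odot> one_form0) \<psi> = a \<odot> \<psi>" if "q \<in> U" "\<psi> \<in> forms" for q \<psi>
    using clifford_space.clifford_csmul_left[OF clifford_V[OF that(1)] forms_one that(2)]
      clifford_space.clifford_one_left[OF clifford_V[OF that(1)] that(2)] by simp
  note mult = this
  have "D p w (\<lambda>q. a \<odot> one_form0) = 0"
    using D_scalar[OF smooth_fun_const[OF U(1)], of w a] dir_deriv_locally_const[of "\<lambda>q. a" a w] by simp
  moreover have eq: "\<forall>q\<in>U. a \<odot> \<phi> q = clifford (G q) (a \<odot> one_form0) (\<phi> q)"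
    using mult smooth_forms[OF \<phi>] by simp
  moreover have "smooth (\<lambda>q. clifford (G q) (a \<odot> one_form0) (\<phi> q))"
    by (rule smooth_form_field_cong[OF U(1) _ smooth_csmul[OF \<phi>, of a]]) (use eq in simp)
  ultimately have "D p w (\<lambda>q. a \<odot> \<phi> q) = clifford (G p) 0 (\<phi> p) + clifford (G p) (a \<odot> one_form0) (D p w \<phi>)"
    using D_cong[OF smooth_csmul[OF \<phi>, of a], of "\<lambda>q. clifford (G q) (a \<odot> one_form0) (\<phi> q)"] D_clifford[OF a \<phi>, of w]
    by simp
  moreover have "clifford (G p) 0 (\<phi> p) = 0"
    using clifford_space.clifford_csmul_left[OF clifford_space_p forms_0 smooth_forms[OF \<phi> U(2)], of 0] by simp
  ultimately show ?thesis using mult[OF U(2) D_forms[OF \<phi>]] by simp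
qed

lemma D_diff: "smooth \<phi> \<Longrightarrow> smooth \<psi> \<Longrightarrow> D p w (\<lambda>q. \<phi> q - \<psi> q) = D p w \<phi> - D p w \<psi>"
  using D_add[of \<phi> "\<lambda>q. (-1) \<odot> \<psi> q" w] D_csmul[of \<psi> w "-1"] smooth_csmul[of \<psi> "-1"] by simp

lemma D_sum:
  assumes "\<And>i. i < m \<Longrightarrow> smooth (\<phi> i)"
  shows "D p w (\<lambda>q. \<Sum>i<(m::nat). \<phi> i q) = (\<Sum>i<m. D p w (\<phi> i))"
  using assms
proof (induction m)
  case 0
  have "D p w (\<lambda>q. 0 \<odot> one_form0) = 0 \<odot> D p w (\<lambda>q. one_form0)"
    by (intro D_csmul smooth_form_field_one U)
  then show ?case by simp
next
  case (Suc m)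
  then show ?case using D_add[of "\<lambda>q. \<Sum>i<m. \<phi> i q" "\<phi> m" w] smooth_form_field_sum[OF U(1), of "{..<m}" \<phi>] by simp
qed

lemma nabla_minus:
  assumes Y: "smooth_vf M U Y"
  shows "nabla p w (\<lambda>q. - Y q) = - nabla p w Y"
proof -
  have aff: "affine_connection M nabla" using canonical by (simp add: canonical_connection_def)
  have "nabla p w (\<lambda>q. (-1) *\<^sub>R Y q) = dir_deriv M p w (\<lambda>q. -1 :: real) *\<^sub>R Y p + (-1) *\<^sub>R nabla p w Y"
    using aff[unfolded affine_connection_def, THEN conjunct1, rule_format, of U p Y Y w] U Y
      smooth_fun_const[OF U(1), of "-1 :: real"] by blast
  then show ?thesis using dir_deriv_locally_const[of "\<lambda>q. -1 :: real" "-1" w] by simp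
qed

lemma nabla_J: "smooth_vf M U Y \<Longrightarrow> nabla p w (\<lambda>q. J q (Y q)) = J p (nabla p w Y)"
  and nabla_metric: "smooth_vf M U X \<Longrightarrow> smooth_vf M U Y \<Longrightarrow>
    dir_deriv M p w (\<lambda>q. G q (X q) (Y q)) = G p (nabla p w X) (Y p) + G p (X p) (nabla p w Y)"
  using canonical[unfolded canonical_connection_def, THEN conjunct2, rule_format, of U p] U by blast+

text \<open>Differentiating the constants G (V j) (V k) with a metric connection shows that the
  derivative of the frame is an infinitesimal rotation, the hypothesis of
  \<open>trace_skew\<close>.\<close>

lemma nabla_V_skew:
  assumes "j < DIM('e)" "k < DIM('e)"
  shows "G p (nabla p w (V j)) (V k p) + G p (V j p) (nabla p w (V k)) = 0"
proof -
  have "dir_deriv M p w (\<lambda>q. G q (V j q) (V k q)) = 0"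
    by (rule dir_deriv_locally_const[where a = "if j = k then 1 else 0"])
       (use ortho_V assms in \<open>simp add: orthonormal_basis_def\<close>)
  then show ?thesis using nabla_metric[OF smooth_V[OF assms(1)] smooth_V[OF assms(2)], of w] by simp
qed

subsection \<open>The operators J, transpose and L are parallel\<close>

text \<open>Since \<open>Jalg\<close> is chosen pointwise, smoothness of the image field is itself a
  claim and is proved together with the derivative formula. The case with content is left
  multiplication, where \<open>nabla_J\<close> moves the derivative of the frame past J.\<close>

lemma Jalg_parallel:
  assumes "smooth \<phi>"
  shows "smooth (\<lambda>q. Jalg (G q) (J q) (\<phi> q)) \<and> D p w (\<lambda>q. Jalg (G q) (J q) (\<phi> q)) = Jalg (G p) (J p) (D p w \<phi>)"
  using assms
proof (induction rule: smooth_induct)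
  case (cong \<phi> \<psi>)
  have \<psi>: "smooth \<psi>" using smooth_form_field_cong[OF U(1) cong(2,1)] .
  have eq: "\<forall>q\<in>U. Jalg (G q) (J q) (\<phi> q) = Jalg (G q) (J q) (\<psi> q)" using cong(2) by simp
  then have sm: "smooth (\<lambda>q. Jalg (G q) (J q) (\<psi> q))"
    by (intro smooth_form_field_cong[OF U(1) _ conjunct1[OF cong(3)]]) simp
  show ?case
    using D_cong[OF conjunct1[OF cong(3)] sm eq, of w] D_cong[OF cong(1) \<psi>, of w] cong(2,3) sm by simp
next
  case (scalar f)
  have eq: "Jalg (G q) (J q) (f q \<odot> one_form0) = f q \<odot> one_form0" if "q \<in> U" for q
    using clinear_formsD(3)[OF hermitian_space.clinear_Jalg[OF hermitian_V[OF that]] forms_one]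
      hermitian_space.Jalg_one[OF hermitian_V[OF that]] by simp
  have sm: "smooth (\<lambda>q. Jalg (G q) (J q) (f q \<odot> one_form0))"
    by (rule smooth_form_field_cong[OF U(1) _ smooth_scalar[OF scalar]]) (simp add: eq)
  have "D p w (\<lambda>q. Jalg (G q) (J q) (f q \<odot> one_form0)) = dir_deriv M p w f \<odot> one_form0"
    using D_cong[OF sm smooth_scalar[OF scalar], of w] D_scalar[OF scalar, of w] eq by simp
  also have "\<dots> = Jalg (G p) (J p) (dir_deriv M p w f \<odot> one_form0)"
    using clinear_formsD(3)[OF hermitian_space.clinear_Jalg[OF hermitian_V[OF U(2)]] forms_one]
      hermitian_space.Jalg_one[OF hermitian_V[OF U(2)]] by simp
  finally show ?case using sm D_scalar[OF scalar, of w] by simp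
next
  case (add \<phi> \<psi>)
  have eq: "Jalg (G q) (J q) (\<phi> q + \<psi> q) = Jalg (G q) (J q) (\<phi> q) + Jalg (G q) (J q) (\<psi> q)" if "q \<in> U" for q
    using clinear_formsD(2)[OF hermitian_space.clinear_Jalg[OF hermitian_V[OF that]]] add(1,2) smooth_forms that by simp
  have sm': "smooth (\<lambda>q. Jalg (G q) (J q) (\<phi> q) + Jalg (G q) (J q) (\<psi> q))"
    using add by (intro smooth_form_field_add[OF U(1)]) auto
  have sm: "smooth (\<lambda>q. Jalg (G q) (J q) (\<phi> q + \<psi> q))"
    by (rule smooth_form_field_cong[OF U(1) _ sm']) (simp add: eq)
  have "D p w (\<lambda>q. Jalg (G q) (J q) (\<phi> q + \<psi> q)) = Jalg (G p) (J p) (D p w \<phi>) + Jalg (G p) (J p) (D p w \<psi>)"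
    using D_cong[OF sm sm', of w] eq add(3,4)
      D_add[of "\<lambda>q. Jalg (G q) (J q) (\<phi> q)" "\<lambda>q. Jalg (G q) (J q) (\<psi> q)" w] by simp
  then show ?case
    using sm D_add[OF add(1,2)] D_forms[OF add(1)] D_forms[OF add(2)]
      clinear_formsD(2)[OF hermitian_space.clinear_Jalg[OF hermitian_V[OF U(2)]]] by simp
next
  case (left_mult j \<phi>)
  let ?\<phi> = "\<lambda>q. Jalg (G q) (J q) (\<phi> q)"
  note Vj = smooth_V[OF left_mult(1)]
  have eq: "Jalg (G q) (J q) (left_mult (G q) (V j q) (\<phi> q)) = left_mult (G q) (J q (V j q)) (?\<phi> q)" if "q \<in> U" for q
    using hermitian_space.Jalg_left_mult[OF hermitian_V[OF that] smooth_forms[OF left_mult(2) that]] .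
  have sm': "smooth (\<lambda>q. left_mult (G q) (J q (V j q)) (?\<phi> q))"
    using left_mult(3) smooth_left_mult[OF smooth_vf_J[OF U(1) Vj]] by blast
  have sm: "smooth (\<lambda>q. Jalg (G q) (J q) (left_mult (G q) (V j q) (\<phi> q)))"
    by (rule smooth_form_field_cong[OF U(1) _ sm']) (simp add: eq)
  have "D p w (\<lambda>q. Jalg (G q) (J q) (left_mult (G q) (V j q) (\<phi> q))) =
      left_mult (G p) (J p (nabla p w (V j))) (?\<phi> p) + left_mult (G p) (J p (V j p)) (Jalg (G p) (J p) (D p w \<phi>))"
    using D_cong[OF sm sm', of w] eq left_mult(3) D_left_mult[OF smooth_vf_J[OF U(1) Vj], of ?\<phi> w] nabla_J[OF Vj] by simp
  also have "\<dots> = Jalg (G p) (J p) (left_mult (G p) (nabla p w (V j)) (\<phi> p) + left_mult (G p) (V j p) (D p w \<phi>))"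
    using hermitian_space.Jalg_left_mult[OF hermitian_V[OF U(2)]] smooth_forms[OF left_mult(2) U(2)] D_forms[OF left_mult(2)]
      clinear_formsD(2)[OF hermitian_space.clinear_Jalg[OF hermitian_V[OF U(2)]]] forms_left_mult[OF inner_metric[OF top[OF U(2)]]]
    by simp
  finally show ?case using sm D_left_mult[OF Vj left_mult(2), of w] by simp
qed

text \<open>The scheme is that for \<open>Jalg\<close>; left multiplications now become right ones,
  so \<open>D_right_mult\<close> supplies the derivative, while the frame vectors stay as they
  are.\<close>

lemma transpose_parallel:
  assumes "smooth \<phi>"
  shows "smooth (\<lambda>q. transpose_form (G q) (\<phi> q)) \<and>
    D p w (\<lambda>q. transpose_form (G q) (\<phi> q)) = transpose_form (G p) (D p w \<phi>)"
  using assms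
proof (induction rule: smooth_induct)
  case (cong \<phi> \<psi>)
  have \<psi>: "smooth \<psi>" using smooth_form_field_cong[OF U(1) cong(2,1)] .
  have eq: "\<forall>q\<in>U. transpose_form (G q) (\<phi> q) = transpose_form (G q) (\<psi> q)" using cong(2) by simp
  then have sm: "smooth (\<lambda>q. transpose_form (G q) (\<psi> q))"
    by (intro smooth_form_field_cong[OF U(1) _ conjunct1[OF cong(3)]]) simp
  show ?case
    using D_cong[OF conjunct1[OF cong(3)] sm eq, of w] D_cong[OF cong(1) \<psi>, of w] cong(2,3) sm by simp
next
  case (scalar f)
  have eq: "transpose_form (G q) (a \<odot> one_form0) = a \<odot> one_form0" if "q \<in> U" for q a
    using clinear_formsD(3)[OF clifford_space.clinear_transpose[OF clifford_V[OF that]] forms_one]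
      clifford_space.transpose_one[OF clifford_V[OF that]] by simp
  have sm: "smooth (\<lambda>q. transpose_form (G q) (f q \<odot> one_form0))"
    by (rule smooth_form_field_cong[OF U(1) _ smooth_scalar[OF scalar]]) (simp add: eq)
  show ?case
    using D_cong[OF sm smooth_scalar[OF scalar], of w] D_scalar[OF scalar, of w] eq eq[OF U(2)] sm by simp
next
  case (add \<phi> \<psi>)
  have eq: "transpose_form (G q) (\<phi> q + \<psi> q) = transpose_form (G q) (\<phi> q) + transpose_form (G q) (\<psi> q)" if "q \<in> U" for q
    using clinear_formsD(2)[OF clifford_space.clinear_transpose[OF clifford_V[OF that]]] add(1,2) smooth_forms that by simp
  have sm': "smooth (\<lambda>q. transpose_form (G q) (\<phi> q) + transpose_form (G q) (\<psi> q))"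
    using add by (intro smooth_form_field_add[OF U(1)]) auto
  have sm: "smooth (\<lambda>q. transpose_form (G q) (\<phi> q + \<psi> q))"
    by (rule smooth_form_field_cong[OF U(1) _ sm']) (simp add: eq)
  have "D p w (\<lambda>q. transpose_form (G q) (\<phi> q + \<psi> q)) = transpose_form (G p) (D p w \<phi>) + transpose_form (G p) (D p w \<psi>)"
    using D_cong[OF sm sm', of w] eq add(3,4)
      D_add[of "\<lambda>q. transpose_form (G q) (\<phi> q)" "\<lambda>q. transpose_form (G q) (\<psi> q)" w] by simp
  then show ?case
    using sm D_add[OF add(1,2)] D_forms[OF add(1)] D_forms[OF add(2)]
      clinear_formsD(2)[OF clifford_space.clinear_transpose[OF clifford_space_p]] by simp
next
  case (left_mult j \<phi>)
  let ?\<phi> = "\<lambda>q. transpose_form (G q) (\<phi> q)"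
  note Vj = smooth_V[OF left_mult(1)]
  have eq: "transpose_form (G q) (left_mult (G q) (V j q) (\<phi> q)) = right_mult (G q) (V j q) (?\<phi> q)" if "q \<in> U" for q
    using clifford_space.transpose_left_mult[OF clifford_V[OF that] smooth_forms[OF left_mult(2) that]] .
  have sm': "smooth (\<lambda>q. right_mult (G q) (V j q) (?\<phi> q))"
    using left_mult(3) smooth_right_mult[OF Vj] by blast
  have sm: "smooth (\<lambda>q. transpose_form (G q) (left_mult (G q) (V j q) (\<phi> q)))"
    by (rule smooth_form_field_cong[OF U(1) _ sm']) (simp add: eq)
  have "D p w (\<lambda>q. transpose_form (G q) (left_mult (G q) (V j q) (\<phi> q))) =
      right_mult (G p) (nabla p w (V j)) (?\<phi> p) + right_mult (G p) (V j p) (transpose_form (G p) (D p w \<phi>))"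
    using D_cong[OF sm sm', of w] eq left_mult(3) D_right_mult[OF Vj, of ?\<phi> w] by simp
  also have "\<dots> = transpose_form (G p) (left_mult (G p) (nabla p w (V j)) (\<phi> p) + left_mult (G p) (V j p) (D p w \<phi>))"
    using clifford_space.transpose_left_mult[OF clifford_space_p] smooth_forms[OF left_mult(2) U(2)] D_forms[OF left_mult(2)]
      clinear_formsD(2)[OF clifford_space.clinear_transpose[OF clifford_space_p]] forms_left_mult[OF inner_metric[OF top[OF U(2)]]]
    by simp
  finally show ?case using sm D_left_mult[OF Vj left_mult(2), of w] by simp
qed

text \<open>The properties of J that the argument for L uses, stated for a general \<open>K\<close>
  so that -J is covered too.\<close>

definition parallel_structure :: "('m \<Rightarrow> 'e \<Rightarrow> 'e) \<Rightarrow> bool" where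
  "parallel_structure K \<longleftrightarrow> (\<forall>q\<in>U. hermitian_space (G q) (\<lambda>j. V j q) (K q)) \<and>
     (\<forall>Y. smooth_vf M U Y \<longrightarrow> smooth_vf M U (\<lambda>q. K q (Y q)) \<and> (\<forall>w. nabla p w (\<lambda>q. K q (Y q)) = K p (nabla p w Y)))"

lemma parallel_J: "parallel_structure J"
  unfolding parallel_structure_def using hermitian_V smooth_vf_J[OF U(1)] nabla_J by simp

lemma parallel_conj:
  assumes "parallel_structure K"
  shows "parallel_structure (\<lambda>q. conj_structure (K q))"
proof -
  have "smooth_vf M U (\<lambda>q. - Y q)" if "smooth_vf M U Y" for Y
    using smooth_vf_scaleR[OF U(1) smooth_fun_const[OF U(1), of "-1"] that] by simp
  moreover have "\<forall>q\<in>U. hermitian_space (G q) (\<lambda>j. V j q) (conj_structure (K q))"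
    using assms hermitian_space.hermitian_space_conj unfolding parallel_structure_def by blast
  ultimately show ?thesis
    using assms nabla_minus by (simp add: parallel_structure_def conj_structure_def)
qed

lemma zmult_parallel:
  assumes K: "parallel_structure K" and Y: "smooth_vf M U Y" and \<phi>: "smooth \<phi>"
  shows "smooth (\<lambda>q. zmult (left_mult (G q)) (K q) (Y q) (\<phi> q))"
    and "D p w (\<lambda>q. zmult (left_mult (G q)) (K q) (Y q) (\<phi> q)) =
      zmult (left_mult (G p)) (K p) (nabla p w Y) (\<phi> p) + zmult (left_mult (G p)) (K p) (Y p) (D p w \<phi>)"
    and "smooth (\<lambda>q. zmult (right_mult (G q)) (K q) (Y q) (\<phi> q))"
    and "D p w (\<lambda>q. zmult (right_mult (G q)) (K q) (Y q) (\<phi> q)) =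
      zmult (right_mult (G p)) (K p) (nabla p w Y) (\<phi> p) + zmult (right_mult (G p)) (K p) (Y p) (D p w \<phi>)"
proof -
  have KY: "smooth_vf M U (\<lambda>q. K q (Y q))" "nabla p w (\<lambda>q. K q (Y q)) = K p (nabla p w Y)"
    using K Y by (simp_all add: parallel_structure_def)
  note l = smooth_left_mult[OF Y \<phi>] smooth_left_mult[OF KY(1) \<phi>]
  note r = smooth_right_mult[OF Y \<phi>] smooth_right_mult[OF KY(1) \<phi>]
  show "smooth (\<lambda>q. zmult (left_mult (G q)) (K q) (Y q) (\<phi> q))"
    "smooth (\<lambda>q. zmult (right_mult (G q)) (K q) (Y q) (\<phi> q))"
    unfolding zmult_def by (intro smooth_diff smooth_csmul l r)+
  show "D p w (\<lambda>q. zmult (left_mult (G q)) (K q) (Y q) (\<phi> q)) =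
      zmult (left_mult (G p)) (K p) (nabla p w Y) (\<phi> p) + zmult (left_mult (G p)) (K p) (Y p) (D p w \<phi>)"
    unfolding zmult_def
    by (simp add: D_diff[OF l(1) smooth_csmul[OF l(2)]] D_csmul[OF l(2)] D_left_mult[OF Y \<phi>] D_left_mult[OF KY(1) \<phi>]
        KY(2) csmul_add_right)
  show "D p w (\<lambda>q. zmult (right_mult (G q)) (K q) (Y q) (\<phi> q)) =
      zmult (right_mult (G p)) (K p) (nabla p w Y) (\<phi> p) + zmult (right_mult (G p)) (K p) (Y p) (D p w \<phi>)"
    unfolding zmult_def
    by (simp add: D_diff[OF r(1) smooth_csmul[OF r(2)]] D_csmul[OF r(2)] D_right_mult[OF Y \<phi>] D_right_mult[OF KY(1) \<phi>]
        KY(2) csmul_add_right)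
qed

text \<open>The product rule yields the wanted term and two terms in which a frame vector is
  differentiated. Summed over the frame these two vanish by \<open>trace_skew\<close>, so L is
  parallel although the frame is not.\<close>

lemma L_form_parallel:
  assumes K: "parallel_structure K" and \<phi>: "smooth \<phi>"
  shows "smooth (\<lambda>q. L_form (G q) (K q) (\<lambda>j. V j q) (\<phi> q))"
    and "D p w (\<lambda>q. L_form (G q) (K q) (\<lambda>j. V j q) (\<phi> q)) = L_form (G p) (K p) (\<lambda>j. V j p) (D p w \<phi>)"
proof -
  interpret hermitian_space "G p" "\<lambda>j. V j p" "K p"
    using K U(2) by (simp add: parallel_structure_def)
  note K' = parallel_conj[OF K]
  let ?R = "\<lambda>j q. zmult (right_mult (G q)) (conj_structure (K q)) (V j q) (\<phi> q)"
  let ?T = "\<lambda>j q. zmult (left_mult (G q)) (K q) (V j q) (?R j q)"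
  have R: "smooth (?R j)" if "j < DIM('e)" for j
    using zmult_parallel(3)[OF K' smooth_V[OF that] \<phi>] .
  have T: "smooth (?T j)" if "j < DIM('e)" for j
    using zmult_parallel(1)[OF K smooth_V[OF that] R[OF that]] .
  have sum: "smooth (\<lambda>q. \<Sum>j<DIM('e). ?T j q)"
    using T by (intro smooth_form_field_sum[OF U(1)]) simp
  show "smooth (\<lambda>q. L_form (G q) (K q) (\<lambda>j. V j q) (\<phi> q))"
    unfolding L_form_def by (rule smooth_csmul[OF sum])
  let ?b = "\<lambda>u x. Z u (Rbar x (\<phi> p))"
  have "D p w (?T j) = ?b (nabla p w (V j)) (V j p) + ?b (V j p) (nabla p w (V j)) + Z (V j p) (Rbar (V j p) (D p w \<phi>))"
    if j: "j < DIM('e)" for j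
    using zmult_parallel(2)[OF K smooth_V[OF j] R[OF j], of w] zmult_parallel(4)[OF K' smooth_V[OF j] \<phi>, of w]
      clinear_formsD(2)[OF clinear_zleft] forms_R smooth_forms[OF \<phi> U(2)] D_forms[OF \<phi>] by (simp add: add.assoc)
  then have "(\<Sum>j<DIM('e). D p w (?T j)) = (\<Sum>j<DIM('e). Z (V j p) (Rbar (V j p) (D p w \<phi>)))"
    using trace_skew[OF form_bilinear_L[OF smooth_forms[OF \<phi> U(2)]], of "\<lambda>j. nabla p w (V j)"] nabla_V_skew
    by (simp add: sum.distrib)
  then show "D p w (\<lambda>q. L_form (G q) (K q) (\<lambda>j. V j q) (\<phi> q)) = L_form (G p) (K p) (\<lambda>j. V j p) (D p w \<phi>)"
    unfolding L_form_def using D_csmul[OF sum] D_sum[of "DIM('e)" ?T w] T by simp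
qed

end

section \<open>The identities\<close>

lemma anticommutator_apply: "anticommutator S T \<phi> p = S (T \<phi>) p + T (S \<phi>) p"
  unfolding anticommutator_def by (rule plus_fun_apply)

lemma commutator_apply: "commutator S T \<phi> p = S (T \<phi>) p - T (S \<phi>) p"
  unfolding commutator_def by (rule minus_apply)

text \<open>Passing from J to -J puts signs on half of the basis: on inner products within that half
  they cancel in pairs, and the mixed inner products vanish.\<close>

lemma adapted_frame_conj:
  assumes G: "inner_product G" and e: "adapted_frame G J (e :: nat \<Rightarrow> 'e::euclidean_space)"
  shows "adapted_frame G (conj_structure J) e"
proof -
  have lin: "linear (G u)" for u using G by (simp add: inner_product_def)
  have "G u (- w) = - G u w" "G (- u) w = - G u w" for u w
    using linear_neg[OF lin] inner_product_sym[OF G] by metis+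
  then show ?thesis
    using e unfolding adapted_frame_def orthonormal_basis_def conj_structure_def
    by (auto split: if_splits)
qed

section \<open>The operators at one point and their identities\<close>

context framed_dirac_setup
begin

lemma frame_at_adapted:
  assumes n: "DIM('e) = 2 * n" and q: "q \<in> U"
  shows "adapted_frame (G q) (J q) (frame_at M q)"
  unfolding frame_at_def using local_adapted_frame[OF top[OF q] n] by (metis someI)

text \<open>\<open>frame_at\<close> may jump between points. Basis independence exchanges it at each
  \<open>q\<close> for the smooth frame \<open>V\<close>, which makes the image under L
  differentiable at all.\<close>

lemma L_op_eq:
  assumes n: "DIM('e) = 2 * n" and q: "q \<in> U" and \<phi>: "\<phi> q \<in> forms"
  shows "L_op M \<phi> q = L_form (G q) (J q) (\<lambda>j. V j q) (\<phi> q)"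
    and "L_bar_op M \<phi> q = L_form (G q) (conj_structure (J q)) (\<lambda>j. V j q) (\<phi> q)"
proof -
  interpret hermitian_space "G q" "\<lambda>j. V j q" "J q" using hermitian_V[OF q] .
  interpret bar: hermitian_space "G q" "\<lambda>j. V j q" "conj_structure (J q)" by (rule hermitian_space_conj)
  note e = frame_at_adapted[OF n q]
  have half: "DIM('e) div 2 = n" using n by simp
  have minus: "flat (G q) (- u) = - flat (G q) u" for u
    using clifford_actionD(3)[OF action_left forms_one, of "-1" u] by (simp add: left_mult_one)
  show "L_op M \<phi> q = L_form (G q) (J q) (\<lambda>j. V j q) (\<phi> q)"
    using L_form_adapted[OF e \<phi> n] unfolding L_op_def eps_def eps_bar_def half .
  show "L_bar_op M \<phi> q = L_form (G q) (conj_structure (J q)) (\<lambda>j. V j q) (\<phi> q)"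
    using bar.L_form_adapted[OF adapted_frame_conj[OF inner e] \<phi> n]
    unfolding L_bar_op_def eps_def eps_bar_def half
    by (simp add: conj_structure_def minus csmul_minus_right)
qed

text \<open>The orthonormal basis used by the Dirac operator at \<open>p\<close>.\<close>

definition basis_p :: "nat \<Rightarrow> 'e" where
  "basis_p = (SOME v. orthonormal_basis (G p) v)"

lemma orthonormal_basis_p: "orthonormal_basis (G p) basis_p"
  unfolding basis_p_def using someI[of "orthonormal_basis (G p)"] ortho_V[OF U(2)] by blast

sublocale hermitian_space "G p" basis_p "J p"
  using hermitian_V[OF U(2)] orthonormal_basis_p
  by (simp add: hermitian_space_def clifford_space_def)

text \<open>Under the prefix \<open>bar\<close> the same pointwise lemmas hold for -J, with L and
  Lbar exchanged, over the same basis.\<close>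

sublocale bar: hermitian_space "G p" basis_p "conj_structure (J p)"
  by (rule hermitian_space_conj)

lemma L_op_p:
  assumes n: "DIM('e) = 2 * n" and \<phi>: "\<phi> p \<in> forms"
  shows "L_op M \<phi> p = L (\<phi> p)" and "L_bar_op M \<phi> p = Lbar (\<phi> p)"
  unfolding L_op_eq[where \<phi> = \<phi>, OF n U(2) \<phi>]
  using L_basis_independent[OF \<phi> ortho_V[OF U(2)]] bar.L_basis_independent[OF \<phi> ortho_V[OF U(2)]] .

lemma L_op_parallel:
  assumes n: "DIM('e) = 2 * n" and \<phi>: "smooth \<phi>"
  shows "smooth (L_op M \<phi>)" "D p w (L_op M \<phi>) = L (D p w \<phi>)"
    and "smooth (L_bar_op M \<phi>)" "D p w (L_bar_op M \<phi>) = Lbar (D p w \<phi>)"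
proof -
  note par = L_form_parallel[OF parallel_J \<phi>] L_form_parallel[OF parallel_conj[OF parallel_J] \<phi>]
  have eq: "\<forall>q\<in>U. L_op M \<phi> q = L_form (G q) (J q) (\<lambda>j. V j q) (\<phi> q)"
    "\<forall>q\<in>U. L_bar_op M \<phi> q = L_form (G q) (conj_structure (J q)) (\<lambda>j. V j q) (\<phi> q)"
    using L_op_eq[where \<phi> = \<phi>, OF n] smooth_forms[OF \<phi>] by blast+
  show sm: "smooth (L_op M \<phi>)" "smooth (L_bar_op M \<phi>)"
    by (rule smooth_form_field_cong[OF U(1) _ par(1)], simp add: eq)
       (rule smooth_form_field_cong[OF U(1) _ par(3)], simp add: eq)
  show "D p w (L_op M \<phi>) = L (D p w \<phi>)"
    using D_cong[OF sm(1) par(1) eq(1), of w] par(2)[of w] L_basis_independent[OF D_forms[OF \<phi>] ortho_V[OF U(2)]] by simp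
  show "D p w (L_bar_op M \<phi>) = Lbar (D p w \<phi>)"
    using D_cong[OF sm(2) par(3) eq(2), of w] par(4)[of w] bar.L_basis_independent[OF D_forms[OF \<phi>] ortho_V[OF U(2)]] by simp
qed

lemma H_op_p:
  assumes n: "DIM('e) = 2 * n" and \<phi>: "\<phi> p \<in> forms"
  shows "H_op M \<phi> p = L (Lbar (\<phi> p)) - Lbar (L (\<phi> p))"
  using L_op_p[OF n] \<phi> clinear_formsD(1)[OF clinear_L \<phi>] clinear_formsD(1)[OF bar.clinear_L \<phi>]
  by (simp add: H_op_def commutator_def minus_apply)

lemma H_op_parallel:
  assumes n: "DIM('e) = 2 * n" and \<phi>: "smooth \<phi>"
  shows "smooth (H_op M \<phi>)" and "D p w (H_op M \<phi>) = L (Lbar (D p w \<phi>)) - Lbar (L (D p w \<phi>))"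
proof -
  note l = L_op_parallel[OF n \<phi>]
  note ll = L_op_parallel(1,2)[OF n l(3)] L_op_parallel(3,4)[OF n l(1)]
  have eq: "H_op M \<phi> = (\<lambda>q. L_op M (L_bar_op M \<phi>) q - L_bar_op M (L_op M \<phi>) q)"
    by (rule ext) (simp add: H_op_def commutator_def minus_apply)
  show "smooth (H_op M \<phi>)" unfolding eq by (rule smooth_diff[OF ll(1,3)])
  show "D p w (H_op M \<phi>) = L (Lbar (D p w \<phi>)) - Lbar (L (D p w \<phi>))"
    unfolding eq D_diff[OF ll(1,3)] ll(2,4) l(2,4) ..
qed

lemma dirac_p: "smooth \<phi> \<Longrightarrow> dirac M D \<phi> p = (\<Sum>j<DIM('e). left_mult (G p) (basis_p j) (D p (basis_p j) \<phi>))"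
  by (simp add: dirac_def Let_def clifford_flat_left D_forms flip: basis_p_def)

text \<open>\<open>Jalg\<close> is multiplicative and parallel, and v = J (- J v). So v times the
  derivative of the transformed field is the image under \<open>Jalg\<close> of -J v times the
  original derivative, and the inverse of \<open>Jalg\<close> strips the outer map.\<close>

lemma op_c_dirac_p:
  assumes \<phi>: "smooth \<phi>"
  shows "op_c M (dirac M D) \<phi> p = (\<Sum>j<DIM('e). left_mult (G p) (- J p (basis_p j)) (D p (basis_p j) \<phi>))"
proof -
  let ?\<psi> = "\<lambda>j. D p (basis_p j) \<phi>" and ?J = "Jalg (G p) (J p)"
  have sm: "smooth (Jalg_op M \<phi>)" and D: "D p w (Jalg_op M \<phi>) = ?J (D p w \<phi>)" for w
    using Jalg_parallel[OF \<phi>] by (simp_all add: Jalg_op_def[abs_def])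
  have closed: "left_mult (G p) u (?\<psi> j) \<in> forms" for u j by (intro forms_left_mult inner D_forms \<phi>)
  have "dirac M D (Jalg_op M \<phi>) p = (\<Sum>j<DIM('e). ?J (left_mult (G p) (- J p (basis_p j)) (?\<psi> j)))"
    by (simp add: dirac_p[OF sm] D Jalg_left_mult D_forms[OF \<phi>] J_minus J_J)
  also have "\<dots> = ?J (\<Sum>j<DIM('e). left_mult (G p) (- J p (basis_p j)) (?\<psi> j))"
    by (rule clinear_forms_sum[OF clinear_Jalg closed, symmetric])
  finally show ?thesis
    using bij_betw_imp_inj_on[OF bij_Jalg] closed
    by (simp add: op_c_def Jalg_inv_op_def forms_sum)
qed

lemma frak_B_p:
  assumes \<phi>: "smooth \<phi>"
  shows "frak_B M D \<phi> p = (1 / 2) \<odot> (\<Sum>j<DIM('e). Z (basis_p j) (D p (basis_p j) \<phi>))"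
    and "frak_B_bar M D \<phi> p = (1 / 2) \<odot> (\<Sum>j<DIM('e). Zbar (basis_p j) (D p (basis_p j) \<phi>))"
proof -
  have minus: "left_mult (G p) (- u) (D p w \<phi>) = - left_mult (G p) u (D p w \<phi>)" for u w
    using clifford_actionD(3)[OF action_left D_forms[OF \<phi>], of "-1" u] by simp
  show "frak_B M D \<phi> p = (1 / 2) \<odot> (\<Sum>j<DIM('e). Z (basis_p j) (D p (basis_p j) \<phi>))"
    "frak_B_bar M D \<phi> p = (1 / 2) \<odot> (\<Sum>j<DIM('e). Zbar (basis_p j) (D p (basis_p j) \<phi>))"
    unfolding frak_B_def frak_B_bar_def dirac_p[OF \<phi>] op_c_dirac_p[OF \<phi>] zmult_def conj_structure_def minus
    by (simp_all add: sum_negf csmul_minus_right sum_subtractf sum.distrib csmul_sum_right)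
qed

lemma forms_frak_B:
  assumes \<phi>: "smooth \<phi>"
  shows "frak_B M D \<phi> p \<in> forms" and "frak_B_bar M D \<phi> p \<in> forms"
  unfolding frak_B_p[OF \<phi>] by (intro forms_csmul forms_sum forms_Z D_forms \<phi>)+

text \<open>The inner transpose commutes with \<open>D\<close>; the outer one turns left
  multiplication into right multiplication and undoes the inner one on the derivative.\<close>

lemma op_star_frak_B_p:
  assumes \<phi>: "smooth \<phi>"
  shows "op_star M (frak_B M D) \<phi> p = (1 / 2) \<odot> (\<Sum>j<DIM('e). R (basis_p j) (D p (basis_p j) \<phi>))"
    and "op_star M (frak_B_bar M D) \<phi> p = (1 / 2) \<odot> (\<Sum>j<DIM('e). Rbar (basis_p j) (D p (basis_p j) \<phi>))"
proof -
  let ?t = "transpose_form (G p)"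
  have sm: "smooth (star_op M \<phi>)" and D: "D p w (star_op M \<phi>) = ?t (D p w \<phi>)" for w
    using transpose_parallel[OF \<phi>] by (simp_all add: star_op_def[abs_def])
  have "?t (zmult (left_mult (G p)) K u (?t \<psi>)) = zmult (right_mult (G p)) K u \<psi>" if "\<psi> \<in> forms" for K u \<psi>
    using that
    by (simp add: zmult_def clinear_forms_diff[OF clinear_transpose] clinear_formsD(3)[OF clinear_transpose]
        forms_csmul forms_left_mult[OF inner] forms_transpose transpose_left_mult transpose_transpose)
  moreover have "zmult (left_mult (G p)) K (basis_p j) (?t (D p (basis_p j) \<phi>)) \<in> forms" for K j
    by (intro forms_Z forms_transpose D_forms \<phi>)
  then have "?t ((1 / 2) \<odot> (\<Sum>j<DIM('e). zmult (left_mult (G p)) K (basis_p j) (?t (D p (basis_p j) \<phi>)))) =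
      (1 / 2) \<odot> (\<Sum>j<DIM('e). ?t (zmult (left_mult (G p)) K (basis_p j) (?t (D p (basis_p j) \<phi>))))" for K
    by (subst clinear_formsD(3)[OF clinear_transpose], intro forms_sum, assumption?)
       (simp_all add: clinear_forms_sum[OF clinear_transpose])
  ultimately show "op_star M (frak_B M D) \<phi> p = (1 / 2) \<odot> (\<Sum>j<DIM('e). R (basis_p j) (D p (basis_p j) \<phi>))"
    "op_star M (frak_B_bar M D) \<phi> p = (1 / 2) \<odot> (\<Sum>j<DIM('e). Rbar (basis_p j) (D p (basis_p j) \<phi>))"
    by (simp_all add: op_star_def star_op_def[of M "frak_B M D _"] star_op_def[of M "frak_B_bar M D _"]
        frak_B_p[OF sm] D D_forms[OF \<phi>])
qed

text \<open>The common shape of all five identities: \<open>T\<close> is L, Lbar or their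
  commutator, and a pointwise relation \<open>h\<close> for each basis vector passes to half the
  sum.\<close>

lemma half_sum_add_image:
  assumes T: "clinear_forms T" and f: "\<And>j. f j \<in> forms" and h: "\<And>j. g j + T (f j) = h j"
  shows "(1 / 2) \<odot> (\<Sum>j<(m::nat). g j) + T ((1 / 2) \<odot> (\<Sum>j<m. f j)) = (1 / 2) \<odot> (\<Sum>j<m. h j)"
proof -
  have "T ((1 / 2) \<odot> (\<Sum>j<m. f j)) = (1 / 2) \<odot> (\<Sum>j<m. T (f j))"
    using clinear_forms_sum[OF T, of "{..<m}" f] clinear_formsD(3)[OF T forms_sum[of "{..<m}" f]] f by simp
  then show ?thesis by (simp only: csmul_add_right[symmetric] sum.distrib[symmetric] h)
qed

lemma identities_at_p:
  assumes n: "DIM('e) = 2 * n" and \<phi>: "smooth \<phi>"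
  shows "anticommutator (frak_B M D) (L_op M) \<phi> p = 0"
    and "anticommutator (frak_B_bar M D) (L_bar_op M) \<phi> p = 0"
    and "anticommutator (frak_B M D) (L_bar_op M) \<phi> p = op_star M (frak_B M D) \<phi> p"
    and "anticommutator (frak_B_bar M D) (L_op M) \<phi> p = op_star M (frak_B_bar M D) \<phi> p"
    and "commutator (H_op M) (frak_B M D) \<phi> p = frak_B M D \<phi> p"
proof -
  let ?\<psi> = "\<lambda>j. D p (basis_p j) \<phi>"
  note par = L_op_parallel[OF n \<phi>]
  note B = frak_B_p[OF \<phi>] forms_frak_B[OF \<phi>]
  have \<psi>: "?\<psi> j \<in> forms" for j by (rule D_forms[OF \<phi>])
  note Z\<psi> = forms_Z[OF \<psi>]
  note half = half_sum_add_image[OF clinear_L Z\<psi>] half_sum_add_image[OF bar.clinear_L Z\<psi>]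
  show "anticommutator (frak_B M D) (L_op M) \<phi> p = 0"
    unfolding anticommutator_apply frak_B_p(1)[OF par(1)] par(2) L_op_p(1)[where \<phi> = "frak_B M D \<phi>", OF n B(3)] B(1)
    using half(1)[OF Z_anticommutator_L[OF \<psi>]] by simp
  show "anticommutator (frak_B_bar M D) (L_bar_op M) \<phi> p = 0"
    unfolding anticommutator_apply frak_B_p(2)[OF par(3)] par(4) L_op_p(2)[where \<phi> = "frak_B_bar M D \<phi>", OF n B(4)] B(2)
    using half(2)[OF bar.Z_anticommutator_L[OF \<psi>]] by simp
  show "anticommutator (frak_B M D) (L_bar_op M) \<phi> p = op_star M (frak_B M D) \<phi> p"
    unfolding anticommutator_apply frak_B_p(1)[OF par(3)] par(4) L_op_p(2)[where \<phi> = "frak_B M D \<phi>", OF n B(3)] B(1)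
      op_star_frak_B_p(1)[OF \<phi>]
    by (rule half(2)[OF Z_anticommutator_Lbar[OF \<psi>]])
  \<comment> \<open>The preceding identity for -J; the double conjugate of J that appears in
    \<open>bar\<close> reduces to J.\<close>
  show "anticommutator (frak_B_bar M D) (L_op M) \<phi> p = op_star M (frak_B_bar M D) \<phi> p"
    unfolding anticommutator_apply frak_B_p(2)[OF par(1)] par(2) L_op_p(1)[where \<phi> = "frak_B_bar M D \<phi>", OF n B(4)] B(2)
      op_star_frak_B_p(2)[OF \<phi>]
    by (rule half(1)[OF bar.Z_anticommutator_Lbar[OF \<psi>, unfolded conj_structure_conj_structure]])
  let ?H = "\<lambda>\<psi>. L (Lbar \<psi>) - Lbar (L \<psi>)"
  have H: "clinear_forms ?H"
    using clinear_L bar.clinear_L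
    by (intro clinear_formsI) (simp_all add: clinear_formsD forms_diff csmul_diff_right)
  \<comment> \<open>The commutator relation is put into the additive form required by
    \<open>half_sum_add_image\<close>, the minus sign being absorbed into \<open>g\<close>.\<close>
  have "- Z (basis_p j) (?H (?\<psi> j)) + ?H (Z (basis_p j) (?\<psi> j)) = Z (basis_p j) (?\<psi> j)" for j
    using H_commutator_Z[OF \<psi>, of "basis_p j" j] by (simp add: algebra_simps)
  from half_sum_add_image[where m = "DIM('e)", OF H Z\<psi> this]
  show "commutator (H_op M) (frak_B M D) \<phi> p = frak_B M D \<phi> p"
    unfolding commutator_apply frak_B_p(1)[OF H_op_parallel(1)[OF n \<phi>]] H_op_parallel(2)[OF n \<phi>]
      H_op_p[where \<phi> = "frak_B M D \<phi>", OF n B(3)] B(1)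
    unfolding sum_negf csmul_minus_right by (simp add: algebra_simps)
qed

end

theorem proposition6p15:
  fixes M :: "('m, 'e::euclidean_space) almost_hermitian"
    and nabla :: "('m, 'e) connection"
    and D :: "('m, 'e) form_connection"
    and n :: nat
  assumes "DIM('e) = 2 * n"
    and "almost_hermitian_manifold M"
    and "canonical_connection M nabla"
    and "derivation_extension M nabla D"
  shows "op_eq M (anticommutator (frak_B M D) (L_op M)) (\<lambda>\<phi>. 0) \<and>
         op_eq M (anticommutator (frak_B_bar M D) (L_bar_op M)) (\<lambda>\<phi>. 0) \<and>
         op_eq M (anticommutator (frak_B M D) (L_bar_op M)) (op_star M (frak_B M D)) \<and>
         op_eq M (anticommutator (frak_B_bar M D) (L_op M)) (op_star M (frak_B_bar M D)) \<and>
         op_eq M (commutator (H_op M) (frak_B M D)) (frak_B M D)"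
proof -
  interpret dirac_setup M nabla D
    using assms by unfold_locales
  have "anticommutator (frak_B M D) (L_op M) \<phi> p = 0"
    "anticommutator (frak_B_bar M D) (L_bar_op M) \<phi> p = 0"
    "anticommutator (frak_B M D) (L_bar_op M) \<phi> p = op_star M (frak_B M D) \<phi> p"
    "anticommutator (frak_B_bar M D) (L_op M) \<phi> p = op_star M (frak_B_bar M D) \<phi> p"
    "commutator (H_op M) (frak_B M D) \<phi> p = frak_B M D \<phi> p"
    if \<phi>: "\<phi> \<in> Gamma_Cl M" and p: "p \<in> topspace (ah_top M)" for \<phi> p
  proof -
    \<comment> \<open>Both sides at \<open>p\<close> depend only on the section near
      \<open>p\<close>, so a frame around \<open>p\<close> and the restriction of the section to its
      domain suffice.\<close>
    obtain U V where U: "openin (ah_top M) U" "p \<in> U" and V: "\<And>j. j < DIM('e) \<Longrightarrow> smooth_vf M U (V j)"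
      "\<And>q. q \<in> U \<Longrightarrow> orthonormal_basis (ah_metric M q) (\<lambda>j. V j q)"
      using local_orthonormal_frame[OF p assms(1)] by metis
    interpret framed_dirac_setup M nabla D p U V
      using U V by unfold_locales
    have "smooth_form_field M U \<phi>"
      using \<phi> smooth_form_field_subset openin_subset[OF U(1)] by (auto simp: Gamma_Cl_def)
    from identities_at_p[OF assms(1) this]
    show "anticommutator (frak_B M D) (L_op M) \<phi> p = 0"
      "anticommutator (frak_B_bar M D) (L_bar_op M) \<phi> p = 0"
      "anticommutator (frak_B M D) (L_bar_op M) \<phi> p = op_star M (frak_B M D) \<phi> p"
      "anticommutator (frak_B_bar M D) (L_op M) \<phi> p = op_star M (frak_B_bar M D) \<phi> p"
      "commutator (H_op M) (frak_B M D) \<phi> p = frak_B M D \<phi> p" .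
  qed
  then show ?thesis by (simp add: op_eq_def zero_fun_apply)
qed

end
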